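(* For any $C^{1,1}$ link $L\subset\mathbb{R}^3$ and any $\sigma\ge\frac12$, $$\mathrm{Thi}_\sigma(L)=\min\Bigl\{\min_{x,y\in L}\mathrm{pd}^*(x,y),\ \tfrac1\sigma\min_L\rho\Bigr\}=\min\Bigl\{\min_{x,y\in L}\mathrm{pd}(x,y),\ \min_{x\in\partial L,\,y\in L}\mathrm{pd}^*(x,y),\ \tfrac1\sigma\min_L\rho\Bigr\}.$$
   Context: A $C^{1,1}$ link $L\subset\mathbb{R}^3$ is a compact embedded 1-dimensional submanifold with boundary (finite union of circles and arcs) whose arclength parametrization is $C^{1,1}$ (Lipschitz unit tangent $T$). $\mathrm{reach}(L)$ is the supremal $r\ge0$ (possibly $\infty$) such that every point at distance less than $r$ from $L$ has a unique nearest point on $L$. $E_L\subset L$ is the set of points where the arclength parametrization is twice differentiable (one-sidedly at endpoints), $\kappa(x)=T'(x)$ there. $\mathrm{Circ}=\{(p,T,\kappa):p\in\mathbb{R}^3,\ |T|=1,\ \kappa\perp T\}$, $R(p,T,\kappa)=1/|\kappa|\in(0,\infty]$. $\overline{\mathrm{Osc}L}$ is the closure in $\mathrm{Circ}$ of $\{(x,T(x),\kappa(x)):x\in E_L\}$, $\rho(x)=\min\{R(c):c\in\overline{\mathrm{Osc}L}\text{ with base point }x\}$. The $\sigma$-thickness is $\mathrm{Thi}_\sigma(L)=\min\{2\,\mathrm{reach}(L),\ \frac1\sigma\min_L\rho\}$. $T_xL$ is the line through $x$ tangent to $L$ (for $x\in\partial L$, the inward tangent ray), $N_xL=\{p:\langle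 p-x,q-x\rangle\le0\ \forall q\in T_xL\}$. For $x\neq y$ in $L$: $\psi(x,y)\in[0,\frac\pi2]$ is the angle between the plane through $x$ normal to $L$ and the segment $xy$; $\psi^*(x,y)\in[0,\frac\pi2]$ is the angle at $x$ between $N_xL$ and the segment $xy$ (zero if $y\in N_xL$). Set $\mathrm{pd}(x,y)=|x-y|\sec^2\psi(x,y)$ and $\mathrm{pd}^*(x,y)=|x-y|\sec^2\psi^*(x,y)$, with values in $(0,\infty]$, and $\mathrm{pd}(x,x)=\mathrm{pd}^*(x,x)=\infty$. Minima over an empty set are $+\infty$. *)

theory Defs
  imports "HOL-Analysis.Analysis"
begin

section \<open>Links of class C\<open>\<^sup>1\<^sup>,\<^sup>1\<close>\<close>

definition velocity :: "(real \<Rightarrow> real^3) \<Rightarrow> real set \<Rightarrow> real \<Rightarrow> real^3" where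
  "velocity \<gamma> D s = vector_derivative \<gamma> (at s within D)"

definition c11_arclength :: "(real \<Rightarrow> real^3) \<Rightarrow> real set \<Rightarrow> bool" where
  "c11_arclength \<gamma> D \<longleftrightarrow>
     (\<forall>s\<in>D. \<gamma> differentiable (at s within D) \<and> norm (velocity \<gamma> D s) = 1) \<and>
     (\<exists>K. K-lipschitz_on D (velocity \<gamma> D))"

text \<open>
  Arclength parametrizations of embedded arcs, with domain \<open>{0..l}\<close>, and of embedded
  circles, as periodic functions with domain \<open>UNIV\<close>.
\<close>

definition c11_arc :: "(real \<Rightarrow> real^3) \<Rightarrow> real set \<Rightarrow> bool" where
  "c11_arc \<gamma> D \<longleftrightarrow> (\<exists>l>0. D = {0..l} \<and> c11_arclength \<gamma> D \<and> inj_on \<gamma> D)"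

definition c11_circle :: "(real \<Rightarrow> real^3) \<Rightarrow> real set \<Rightarrow> bool" where
  "c11_circle \<gamma> D \<longleftrightarrow>
     D = UNIV \<and> c11_arclength \<gamma> D \<and>
     (\<exists>l>0. (\<forall>s. \<gamma> (s + l) = \<gamma> s) \<and> inj_on \<gamma> {0..<l})"

text \<open>
  The connected components of a finite disjoint union of arcs and circles are exactly these
  arcs and circles. Compactness follows; the empty link is allowed.
\<close>

definition c11_link :: "(real^3) set \<Rightarrow> bool" where
  "c11_link L \<longleftrightarrow>
     finite (components L) \<and>
     (\<forall>C\<in>components L. \<exists>\<gamma> D. (c11_arc \<gamma> D \<or> c11_circle \<gamma> D) \<and> \<gamma> ` D = C)"

text \<open>
  A link is not oriented: each component is parametrized in both directions, so that
  both unit tangent vectors \<open>T\<close> and \<open>-T\<close> occur at each point. Radii, tangent sets and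
  normal sets do not depend on this choice.
\<close>

definition link_param :: "(real^3) set \<Rightarrow> (real \<Rightarrow> real^3) \<Rightarrow> real set \<Rightarrow> bool" where
  "link_param L \<gamma> D \<longleftrightarrow> (c11_arc \<gamma> D \<or> c11_circle \<gamma> D) \<and> \<gamma> ` D \<in> components L"

definition link_boundary :: "(real^3) set \<Rightarrow> (real^3) set" where
  "link_boundary L = {x. \<exists>\<gamma> l. link_param L \<gamma> {0..l} \<and> (x = \<gamma> 0 \<or> x = \<gamma> l)}"


section \<open>Minima and reach\<close>

text \<open>
  An attained minimum, which is \<open>\<infinity>\<close> for the empty set; nothing is known
  about the value on a nonempty set without a least element.
\<close>

definition minimum :: "ereal set \<Rightarrow> ereal" where
  "minimum S = (if S = {} then \<infinity> else (LEAST m. m \<in> S))"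

text \<open>
  The distance of \<open>p\<close> from \<open>L\<close> is less than \<open>r\<close> iff some point of \<open>L\<close> has distance less
  than \<open>r\<close> from \<open>p\<close>; unlike \<^const>\<open>infdist\<close>, this gives the empty set infinite reach.
\<close>

definition reach :: "(real^3) set \<Rightarrow> ereal" where
  "reach L = Sup {ereal r | r. 0 \<le> r \<and>
     (\<forall>p. (\<exists>q\<in>L. dist p q < r) \<longrightarrow> (\<exists>!q. q \<in> L \<and> (\<forall>q'\<in>L. dist p q \<le> dist p q')))}"


section \<open>Osculating circles and thickness\<close>

definition Circ :: "((real^3) \<times> (real^3) \<times> (real^3)) set" where
  "Circ = {(p, T, \<kappa>). norm T = 1 \<and> \<kappa> \<bullet> T = 0}"

definition circ_radius :: "(real^3) \<times> (real^3) \<times> (real^3) \<Rightarrow> ereal" where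
  "circ_radius = (\<lambda>(p, T, \<kappa>). if \<kappa> = 0 then \<infinity> else ereal (1 / norm \<kappa>))"

text \<open>At the ends of an arc the second derivative within the domain is one-sided.\<close>

definition Osc :: "(real^3) set \<Rightarrow> ((real^3) \<times> (real^3) \<times> (real^3)) set" where
  "Osc L = {(\<gamma> s, velocity \<gamma> D s, \<kappa>) | \<gamma> D s \<kappa>.
     link_param L \<gamma> D \<and> s \<in> D \<and> (velocity \<gamma> D has_vector_derivative \<kappa>) (at s within D)}"

definition Osc_closure :: "(real^3) set \<Rightarrow> ((real^3) \<times> (real^3) \<times> (real^3)) set" where
  "Osc_closure L = (top_of_set Circ) closure_of (Osc L)"

definition curv_radius :: "(real^3) set \<Rightarrow> real^3 \<Rightarrow> ereal" where
  "curv_radius L x = minimum {circ_radius c | c. c \<in> Osc_closure L \<and> fst c = x}"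

definition min_curv_radius :: "(real^3) set \<Rightarrow> ereal" where
  "min_curv_radius L = minimum (curv_radius L ` L)"

definition Thi :: "real \<Rightarrow> (real^3) set \<Rightarrow> ereal" where
  "Thi \<sigma> L = min (2 * reach L) (ereal (1 / \<sigma>) * min_curv_radius L)"


section \<open>Penalized distances\<close>

text \<open>
  At a boundary point, parametrizations starting there have the inward tangent vector
  as initial velocity; each end of an arc is the start of one of the two parametrizations.
\<close>

definition tangent_set :: "(real^3) set \<Rightarrow> real^3 \<Rightarrow> (real^3) set" where
  "tangent_set L x =
     (if x \<in> link_boundary L
      then {x + t *\<^sub>R velocity \<gamma> {0..l} 0 | t \<gamma> l. link_param L \<gamma> {0..l} \<and> \<gamma> 0 = x \<and> 0 \<le> t}
      else {x + t *\<^sub>R velocity \<gamma> D s | t \<gamma> D s. link_param L \<gamma> D \<and> s \<in> D \<and> \<gamma> s = x})"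

definition normal_set :: "(real^3) set \<Rightarrow> real^3 \<Rightarrow> (real^3) set" where
  "normal_set L x = {p. \<forall>q\<in>tangent_set L x. (p - x) \<bullet> (q - x) \<le> 0}"

text \<open>
  The normal plane, also at boundary points, where it bounds the half-space \<^const>\<open>normal_set\<close>.
\<close>

definition normal_plane :: "(real^3) set \<Rightarrow> real^3 \<Rightarrow> (real^3) set" where
  "normal_plane L x =
     {p. \<forall>\<gamma> D s. link_param L \<gamma> D \<and> s \<in> D \<and> \<gamma> s = x \<longrightarrow> (p - x) \<bullet> velocity \<gamma> D s = 0}"

definition vec_angle :: "real^3 \<Rightarrow> real^3 \<Rightarrow> real" where
  "vec_angle v w = arccos ((v \<bullet> w) / (norm v * norm w))"

text \<open>
  The angle at \<open>x\<close> between a plane or half-space \<open>N\<close> through \<open>x\<close> and the segment \<open>xy\<close> is the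
  smallest angle between the segment and a ray from \<open>x\<close> in \<open>N\<close>; it vanishes if \<open>y \<in> N\<close>.
\<close>

definition angle_to_set :: "real^3 \<Rightarrow> (real^3) set \<Rightarrow> real^3 \<Rightarrow> real" where
  "angle_to_set x N y = Inf {vec_angle (p - x) (y - x) | p. p \<in> N \<and> p \<noteq> x}"

definition psi :: "(real^3) set \<Rightarrow> real^3 \<Rightarrow> real^3 \<Rightarrow> real" where
  "psi L x y = angle_to_set x (normal_plane L x) y"

definition psi_star :: "(real^3) set \<Rightarrow> real^3 \<Rightarrow> real^3 \<Rightarrow> real" where
  "psi_star L x y = angle_to_set x (normal_set L x) y"

definition sec_sq :: "real \<Rightarrow> ereal" where
  "sec_sq \<phi> = (if cos \<phi> = 0 then \<infinity> else ereal (1 / (cos \<phi>)\<^sup>2))"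

definition pd :: "(real^3) set \<Rightarrow> real^3 \<Rightarrow> real^3 \<Rightarrow> ereal" where
  "pd L x y = (if x = y then \<infinity> else ereal (dist x y) * sec_sq (psi L x y))"

definition pd_star :: "(real^3) set \<Rightarrow> real^3 \<Rightarrow> real^3 \<Rightarrow> ereal" where
  "pd_star L x y = (if x = y then \<infinity> else ereal (dist x y) * sec_sq (psi_star L x y))"

end

(*
For x, y in L let F(x, y) = |x - y| / (2 cos psi_star(x, y)) be the radius of the smallest sphere through x
and y with centre in N_xL. Since pd_star = 4 F^2 / |x - y| >= 2 F, both
pd_star and 2 reach are at least 2 inf F: if a point has two nearest points x, y at distance r, then
F(x, y) <= r. Near the diagonal, liminf F >= R = min rho.

If inf F >= R, then 2 reach and pd_star are all at least 2 R >= R / sigma, and nothing is left to compare.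
If inf F < R, the infimum is attained at some (x, y). Moving x along L by dt changes F at the rate
-(<y - x, T> / h) (1 - F <kappa, n>), with n the unit vector of the component of y - x normal to T and h the
length of that component; as F < R = min rho, this forces y to lie in the normal set of x. Then the open
ball with diameter xy misses L, so 2 reach = |x - y| = pd_star(x, y) = min pd_star.

Curvature exists only almost everywhere, so the Lipschitz constant 1/R of T is obtained from
differentiability almost everywhere of Lipschitz functions of one variable (via Vitali's covering theorem).

For the second equation, pd_star = pd off the boundary of L and pd_star <= pd on it.
*)
theory Submission
  imports Defs
begin

section \<open>Lipschitz functions of one real variable\<close>

text \<open>The function F is handled through
  \<open>offset_sq l v (y - x) / norm (y - x) ^ 4\<close>, which equals 1 / (4 F^2). It is 0 where F
  is infinite, and F < R becomes ratio > c^2 / 4 with c = 1 / R, where c = 0 is allowed. The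
  obstacle to attaining the infimum of F is that F jumps at the ends of arcs: N_xL is a plane at
  interior points and a half-space at an end. Compactness is restored by letting x range over
  frames: the tangent line at every point, ends included, and in addition the inward ray at each
  end. At an end the line gives the smaller ratio, so the extra frames do not raise the maximum.
  Existence of minima is part of the work, because \<open>minimum\<close> is a least element and not
  an infimum; for pd and pd_star it comes from a second ratio, with exponent 3, that tends to 0 at
  the diagonal. The definitions do not say how two parametrizations of a component are related, so
  the independence of tangent lines and ends, and a common bound on curvature, are derived from
  Taylor estimates.\<close>

text \<open>Closed balls of the line are closed intervals, with the midpoint as centre and half the
  length as radius. The point \<open>x\<close> may be an endpoint of its intervals, so one-sided
  difference quotients can be used.\<close>

lemma Vitali_covering_intervals:
  fixes S U :: "real set"
  assumes "open U" "S \<subseteq> U"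
    and P: "\<And>x d. x \<in> S \<Longrightarrow> 0 < d \<Longrightarrow> \<exists>a b. P a b \<and> a < b \<and> a \<le> x \<and> x \<le> b \<and> b - a < d"
  obtains C where "countable C" "\<And>a b. (a, b) \<in> C \<Longrightarrow> P a b \<and> a < b \<and> {a..b} \<subseteq> U"
    "disjoint_family_on (\<lambda>(a, b). {a..b}) C" "negligible (S - (\<Union>(a, b)\<in>C. {a..b}))"
proof -
  define K where "K = {(a, b). P a b \<and> a < b \<and> {a..b} \<subseteq> U}"
  define m r where "m = (\<lambda>(a::real, b). (a + b) / 2)" and "r = (\<lambda>(a::real, b). (b - a) / 2)"
  have cb: "cball (m i) (r i) = (\<lambda>(a, b). {a..b}) i" for i
    by (cases i) (auto simp: m_def r_def cball_eq_atLeastAtMost field_simps)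
  have pos: "0 < r i" if "i \<in> K" for i
    using that by (auto simp: K_def r_def)
  have fine: "\<exists>i. i \<in> K \<and> x \<in> cball (m i) (r i) \<and> r i < d" if "x \<in> S" "0 < d" for x d
  proof -
    \<comment> \<open>An interval that contains \<open>x\<close> and is shorter than
      \<open>e\<close> stays inside \<open>U\<close>.\<close>
    obtain e where e: "0 < e" "ball x e \<subseteq> U"
      using \<open>x \<in> S\<close> assms by (meson openE subsetD)
    obtain a b where ab: "P a b" "a < b" "a \<le> x" "x \<le> b" "b - a < min d e"
      using P[OF \<open>x \<in> S\<close>, of "min d e"] e(1) \<open>0 < d\<close> min_less_iff_conj by metis
    have "{a..b} \<subseteq> U"
      using ab e by (auto simp: dist_real_def subset_iff)
    then have "(a, b) \<in> K" "x \<in> cball (m (a, b)) (r (a, b))" "r (a, b) < d"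
      using ab by (auto simp: K_def cb) (auto simp: r_def)
    then show ?thesis by blast
  qed
  obtain C where C: "countable C" "C \<subseteq> K"
      "pairwise (\<lambda>i j. disjnt (cball (m i) (r i)) (cball (m j) (r j))) C"
      "negligible (S - (\<Union>i\<in>C. cball (m i) (r i)))"
    by (rule Vitali_covering_theorem_cballs[OF pos fine])
  show thesis
  proof
    show "disjoint_family_on (\<lambda>(a, b). {a..b}) C"
      using C(3) by (auto simp: cb pairwise_def disjoint_family_on_def disjnt_def)
    show "negligible (S - (\<Union>(a, b)\<in>C. {a..b}))"
      using C(4) by (simp add: cb)
  qed (use C in \<open>auto simp: K_def\<close>)
qed

text \<open>Countable additivity over the disjoint intervals. It is used with the measure of
  increments of a monotone function and Lebesgue measure in both roles.\<close>

lemma emeasure_disjoint_intervals_le: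
  fixes C :: "(real \<times> real) set"
  assumes "countable C" "disjoint_family_on (\<lambda>(a, b). {a..b}) C"
    and "sets M = sets borel" "sets N = sets borel"
    and "\<And>a b. (a, b) \<in> C \<Longrightarrow> emeasure M {a..b} \<le> ennreal p * emeasure N {a..b}"
  shows "emeasure M (\<Union>(a, b)\<in>C. {a..b}) \<le> ennreal p * emeasure N (\<Union>(a, b)\<in>C. {a..b})"
proof -
  let ?I = "\<lambda>(a::real, b). {a..b}"
  have m: "?I i \<in> sets M" "?I i \<in> sets N" for i
    by (auto simp: assms(3,4) split: prod.split)
  have "emeasure M (\<Union>i\<in>C. ?I i) = (\<integral>\<^sup>+ i. emeasure M (?I i) \<partial>count_space C)"
    using assms m by (intro emeasure_UN_countable) auto
  also have "\<dots> \<le> (\<integral>\<^sup>+ i. ennreal p * emeasure N (?I i) \<partial>count_space C)"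
    using assms(5) by (intro nn_integral_mono) auto
  also have "\<dots> = ennreal p * (\<integral>\<^sup>+ i. emeasure N (?I i) \<partial>count_space C)"
    by (rule nn_integral_cmult) auto
  also have "(\<integral>\<^sup>+ i. emeasure N (?I i) \<partial>count_space C) = emeasure N (\<Union>i\<in>C. ?I i)"
    using assms m by (intro emeasure_UN_countable[symmetric]) auto
  finally show ?thesis by simp
qed

text \<open>The core of Lebesgue's theorem on monotone functions. Covering \<open>S\<close> by
  disjoint short intervals of mean slope at most \<open>p\<close> bounds the increments of
  \<open>f\<close> by about \<open>p\<close> times the outer measure \<open>m\<close> of
  \<open>S\<close>; covering it again, inside these, by intervals of mean slope at least
  \<open>q\<close> bounds them below by about \<open>q * m\<close>. As \<open>p < q\<close>, this
  forces \<open>m = 0\<close>.\<close>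

lemma negligible_derivates_gap:
  fixes f :: "real \<Rightarrow> real"
  assumes "mono f" "continuous_on UNIV f" "0 \<le> p" "p < q" "bounded S"
    and P: "\<And>x d. x \<in> S \<Longrightarrow> 0 < d \<Longrightarrow> \<exists>a b. f b - f a \<le> p * (b - a) \<and> a < b \<and> a \<le> x \<and> x \<le> b \<and> b - a < d"
    and Q: "\<And>x d. x \<in> S \<Longrightarrow> 0 < d \<Longrightarrow> \<exists>a b. q * (b - a) \<le> f b - f a \<and> a < b \<and> a \<le> x \<and> x \<le> b \<and> b - a < d"
  shows "negligible S"
proof -
  let ?M = "interval_measure f"
  have M: "emeasure ?M {a..b} = ennreal (f b - f a)" if "a \<le> b" for a b
    using assms that by (intro emeasure_interval_measure_Icc) (auto simp: mono_def)
  \<comment> \<open>\<open>S\<close> is not known to be measurable, so its outer measure is written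
    as an infimum over open supersets.\<close>
  define A where "A = {emeasure lborel U | U. open U \<and> S \<subseteq> U}"
  define m where "m = Inf A"
  obtain B where "S \<subseteq> ball 0 B"
    using \<open>bounded S\<close> bounded_subset_ballD by metis
  then have "emeasure lborel (ball 0 B :: real set) \<in> A"
    unfolding A_def by blast
  then have "m \<le> emeasure lborel (ball 0 B :: real set)"
    unfolding m_def by (rule Inf_lower)
  also have "\<dots> < \<infinity>"
    using emeasure_lborel_ball_finite by simp
  finally have mfin: "m < \<infinity>" .
  have key: "ennreal q * m \<le> ennreal p * (m + ennreal e) + ennreal q * ennreal e" if "0 < e" for e
  proof -
    have "m < m + ennreal e"
      using mfin \<open>0 < e\<close> by (metis add.right_neutral ennreal_add_left_cancel_less ennreal_less_zero_iff infinity_ennreal_def)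
    then obtain U where U: "open U" "S \<subseteq> U" "emeasure lborel U < m + ennreal e"
      unfolding m_def by (auto simp: Inf_less_iff A_def)
    obtain C where C: "countable C" "\<And>a b. (a, b) \<in> C \<Longrightarrow> f b - f a \<le> p * (b - a) \<and> a < b \<and> {a..b} \<subseteq> U"
      "disjoint_family_on (\<lambda>(a, b). {a..b}) C" "negligible (S - (\<Union>(a, b)\<in>C. {a..b}))"
      using Vitali_covering_intervals[OF U(1,2), of "\<lambda>a b. f b - f a \<le> p * (b - a)"] P by metis
    \<comment> \<open>The second covering has to live in an open set, hence the interiors; the
      endpoints lost in this way are countably many and go into \<open>Z\<close>.\<close>
    define V where "V = (\<Union>(a, b)\<in>C. {a<..<b})"
    have "open V"
      unfolding V_def by auto
    define S' where "S' = S \<inter> V"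
    obtain D where D: "countable D" "\<And>a b. (a, b) \<in> D \<Longrightarrow> q * (b - a) \<le> f b - f a \<and> a < b \<and> {a..b} \<subseteq> V"
      "disjoint_family_on (\<lambda>(a, b). {a..b}) D" "negligible (S' - (\<Union>(a, b)\<in>D. {a..b}))"
      using Vitali_covering_intervals[OF \<open>open V\<close>, of S' "\<lambda>a b. q * (b - a) \<le> f b - f a"] Q
      unfolding S'_def by (metis IntD1 inf_le2)
    let ?I = "\<Union>(a, b)\<in>C. {a..b}" and ?J = "\<Union>(a, b)\<in>D. {a..b}"
    have [measurable]: "?I \<in> sets borel" "?J \<in> sets borel"
      using C(1) D(1) by (auto intro!: sets.countable_UN')
    have "emeasure ?M ?I \<le> ennreal p * emeasure lborel ?I"
    proof (rule emeasure_disjoint_intervals_le)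
      fix a b assume "(a, b) \<in> C"
      then show "emeasure ?M {a..b} \<le> ennreal p * emeasure lborel {a..b}"
        using C(2)[of a b] \<open>0 \<le> p\<close> by (simp add: M less_imp_le ennreal_mult[symmetric] ennreal_leI)
    qed (use C in auto)
    also have "\<dots> \<le> ennreal p * (m + ennreal e)"
    proof (rule mult_left_mono)
      have "emeasure lborel ?I \<le> emeasure lborel U"
        using C(2) U(1) by (intro emeasure_mono) auto
      then show "emeasure lborel ?I \<le> m + ennreal e" using U(3) by simp
    qed simp
    finally have 1: "emeasure ?M ?I \<le> ennreal p * (m + ennreal e)" .
    have "ennreal q * emeasure lborel ?J \<le> emeasure ?M ?J"
    proof -
      have "q > 0" using assms by linarith
      have "emeasure lborel ?J \<le> ennreal (1 / q) * emeasure ?M ?J"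
      proof (rule emeasure_disjoint_intervals_le)
        fix a b assume "(a, b) \<in> D"
        then show "emeasure lborel {a..b} \<le> ennreal (1 / q) * emeasure ?M {a..b}"
          using D(2)[of a b] \<open>q > 0\<close> monoD[OF \<open>mono f\<close>, of a b]
          by (simp add: M less_imp_le ennreal_mult[symmetric]) (simp add: field_simps)
      qed (use D in auto)
      then have "ennreal q * emeasure lborel ?J \<le> ennreal q * (ennreal (1 / q) * emeasure ?M ?J)"
        by (rule mult_left_mono) simp
      also have "\<dots> = emeasure ?M ?J"
        using \<open>q > 0\<close> by (simp add: mult.assoc[symmetric] ennreal_mult'[symmetric])
      finally show ?thesis .
    qed
    also have "\<dots> \<le> emeasure ?M ?I"
    proof (rule emeasure_mono)
      have "?J \<subseteq> V" using D(2) by auto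
      also have "V \<subseteq> ?I" unfolding V_def by fastforce
      finally show "?J \<subseteq> ?I" .
    qed simp
    finally have 2: "ennreal q * emeasure lborel ?J \<le> ennreal p * (m + ennreal e)"
      using 1 by (rule order_trans)
    define Z where "Z = (S - ?I) \<union> (\<Union>(a, b)\<in>C. {a, b}) \<union> (S' - ?J)"
    have "countable (\<Union>(a, b)\<in>C. {a, b})"
      using C(1) by (auto intro!: countable_UN)
    then have "negligible Z"
      unfolding Z_def using C(4) D(4)
    by (intro negligible_Un)
      (auto simp: negligible_iff_null_sets intro: null_sets_completionI countable_imp_null_set_lborel)
    have "S \<subseteq> ?J \<union> Z"
    proof
      fix x assume x: "x \<in> S"
      show "x \<in> ?J \<union> Z"
      proof (cases "x \<in> V")
        case True
        then show ?thesis using x unfolding Z_def S'_def by blast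
      next
        case False
        show ?thesis
        proof (cases "x \<in> ?I")
          case True
          then obtain a b where ab: "(a, b) \<in> C" "x \<in> {a..b}" by blast
          then have "x \<notin> {a<..<b}" using False unfolding V_def by blast
          then have "x \<in> {a, b}" using ab(2) by auto
          then have "x \<in> (\<Union>(a, b)\<in>C. {a, b})" using ab(1) by blast
          then show ?thesis unfolding Z_def by blast
        next
          case False
          then show ?thesis using x unfolding Z_def by blast
        qed
      qed
    qed
    \<comment> \<open>\<open>?J \<union> Z\<close> contains \<open>S\<close> and is Lebesgue
      measurable, so it has an open superset \<open>O'\<close> that is larger by less than
      \<open>e\<close>, and \<open>O'\<close> competes for the infimum \<open>m\<close>.\<close>
    have JZ: "?J \<union> Z \<in> sets lebesgue"
      using \<open>negligible Z\<close> by (intro sets.Un) (auto simp: negligible_iff_null_sets)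
    obtain O' where O': "open O'" "?J \<union> Z \<subseteq> O'" "O' - (?J \<union> Z) \<in> lmeasurable"
       "emeasure lebesgue (O' - (?J \<union> Z)) < ennreal e"
      using sets_lebesgue_outer_open[OF JZ \<open>0 < e\<close>] by metis
    have "m \<le> emeasure lborel O'"
      unfolding m_def A_def
      by (rule Inf_lower) (use O'(1,2) \<open>S \<subseteq> ?J \<union> Z\<close> in blast)
    also have "\<dots> = emeasure lebesgue O'"
      using O'(1) by simp
    also have "\<dots> \<le> emeasure lebesgue ((?J \<union> (O' - (?J \<union> Z))) \<union> Z)"
      using O' JZ \<open>negligible Z\<close> by (intro emeasure_mono) (auto simp: negligible_iff_null_sets intro!: sets.Un)
    also have "\<dots> = emeasure lebesgue (?J \<union> (O' - (?J \<union> Z)))"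
      using \<open>negligible Z\<close> O' by (intro emeasure_Un_null_set) (auto simp: negligible_iff_null_sets)
    also have "\<dots> \<le> emeasure lebesgue ?J + emeasure lebesgue (O' - (?J \<union> Z))"
      using O' by (intro emeasure_subadditive) auto
    also have "\<dots> \<le> emeasure lborel ?J + ennreal e"
      using O' by (intro add_mono) auto
    finally have "ennreal q * m \<le> ennreal q * (emeasure lborel ?J + ennreal e)"
      by (rule mult_left_mono) simp
    then show ?thesis
      using 2 by (simp add: distrib_left) (meson add_right_mono order_trans)
  qed
  obtain m' where m': "m = ennreal m'" "0 \<le> m'"
    using mfin by (cases m) auto
  have key': "q * m' \<le> p * (m' + e) + q * e" if "0 < e" for e
    using key[OF that] m' assms that
    by (simp add: ennreal_mult[symmetric] ennreal_plus[symmetric] del: ennreal_plus)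
  have "(q - p) * m' \<le> 0"
  proof (rule field_le_epsilon)
    fix e :: real assume "0 < e"
    \<comment> \<open>The error is scaled so that its two contributions, with factors
      \<open>p\<close> and \<open>q\<close>, add up to \<open>e\<close>.\<close>
    have "q * m' \<le> p * (m' + e / (p + q)) + q * (e / (p + q))"
      using \<open>0 < e\<close> assms by (intro key') auto
    also have "\<dots> = p * m' + (p + q) * (e / (p + q))"
      by (simp only: distrib_left distrib_right add.assoc)
    also have "\<dots> = p * m' + e" using assms by simp
    finally show "(q - p) * m' \<le> 0 + e" by (simp add: algebra_simps)
  qed
  then have "m' \<le> 0"
    using assms by (simp add: mult_le_0_iff)
  then have "m = 0" using m' by simp
  show ?thesis
  proof (rule negligible_outer_le[THEN iffD2], intro allI impI)
    fix e :: real assume "0 < e"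
    then have "m < ennreal e" using \<open>m = 0\<close> by simp
    then obtain U where U: "open U" "S \<subseteq> U" "emeasure lborel U < ennreal e"
      unfolding m_def by (auto simp: Inf_less_iff A_def)
    moreover have "U \<in> lmeasurable"
      using U by (intro fmeasurableI) (auto intro: less_trans[OF _ ennreal_less_top])
    moreover have "measure lebesgue U \<le> e"
      using U \<open>0 < e\<close> emeasure_eq_measure2[OF \<open>U \<in> lmeasurable\<close>]
      by (simp add: ennreal_less_iff less_imp_le)
    ultimately show "\<exists>T. S \<subseteq> T \<and> T \<in> lmeasurable \<and> measure lebesgue T \<le> e" by blast
  qed
qed

text \<open>The candidate for the derivative is the limit superior of the quotients, written as the
  infimum of their eventual upper bounds. Two rationals fit between it and any smaller number; the
  larger one is no eventual upper bound, so the absence of a gap makes the smaller one an eventual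
  lower bound.\<close>

lemma real_differentiable_if_no_derivate_gap:
  fixes f :: "real \<Rightarrow> real"
  assumes bnd: "\<And>h. h \<noteq> 0 \<Longrightarrow> 0 \<le> (f (x + h) - f x) / h \<and> (f (x + h) - f x) / h \<le> B"
    and gap: "\<And>p q. p \<in> \<rat> \<Longrightarrow> q \<in> \<rat> \<Longrightarrow> 0 \<le> p \<Longrightarrow> p < q \<Longrightarrow>
       eventually (\<lambda>h. p < (f (x + h) - f x) / h) (at 0) \<or> eventually (\<lambda>h. (f (x + h) - f x) / h < q) (at 0)"
  shows "f differentiable (at x)"
proof -
  define Q where "Q h = (f (x + h) - f x) / h" for h
  define A where "A = {q. eventually (\<lambda>h. Q h < q) (at 0)}"
  have ev: "eventually (\<lambda>h::real. h \<noteq> 0) (at 0)"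
    by (rule eventually_neq_at_within)
  have "Q h < B + 1" if "h \<noteq> 0" for h
    using bnd[OF that] unfolding Q_def by linarith
  then have "B + 1 \<in> A"
    unfolding A_def mem_Collect_eq by (rule eventually_mono[OF ev])
  have low: "0 \<le> q" if "q \<in> A" for q
  proof -
    have "eventually (\<lambda>h. Q h < q \<and> 0 \<le> Q h) (at 0)"
      using that[unfolded A_def mem_Collect_eq] ev
      by eventually_elim (unfold Q_def, blast dest: bnd)
    then have "\<exists>h. Q h < q \<and> 0 \<le> Q h"
      by (rule eventually_happens'[rotated]) simp
    then obtain h where "Q h < q \<and> 0 \<le> Q h" by blast
    then show ?thesis by linarith
  qed
  then have "bdd_below A" by (auto simp: bdd_below_def)
  define D where "D = Inf A"
  have "(Q \<longlongrightarrow> D) (at 0)"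
  proof (rule order_tendstoI)
    fix a assume "D < a"
    then obtain q where "q \<in> A" "q < a"
      using \<open>B + 1 \<in> A\<close> \<open>bdd_below A\<close> unfolding D_def by (metis cInf_less_iff empty_iff)
    then show "eventually (\<lambda>h. Q h < a) (at 0)"
      by (auto simp: A_def elim!: eventually_mono)
  next
    fix a assume "a < D"
    obtain q where q: "q \<in> \<rat>" "a < q" "q < D" using Rats_dense_in_real[OF \<open>a < D\<close>] by auto
    obtain p where p: "p \<in> \<rat>" "a < p" "p < q" using Rats_dense_in_real[OF q(2)] by auto
    have "q \<notin> A"
      using q \<open>bdd_below A\<close> cInf_lower[of q A] unfolding D_def by force
    then have nq: "\<not> eventually (\<lambda>h. Q h < q) (at 0)" by (simp add: A_def)
    have "eventually (\<lambda>h. p < Q h) (at 0)"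
    proof (cases "0 \<le> p")
      case True
      then show ?thesis using gap[of p q] p q nq unfolding Q_def by blast
    next
      case False
      have "p < Q h" if "h \<noteq> 0" for h
        using bnd[OF that] False unfolding Q_def by linarith
      then show ?thesis by (rule eventually_mono[OF ev])
    qed
    then show "eventually (\<lambda>h. a < Q h) (at 0)"
      using p by (auto elim!: eventually_mono)
  qed
  then have "(f has_field_derivative D) (at x)"
    by (simp add: DERIV_def Q_def[abs_def])
  then show ?thesis
    by (auto simp: differentiable_def has_field_derivative_def)
qed

text \<open>Adding \<open>K * x\<close> makes \<open>f\<close> monotone with quotients between 0 and
  \<open>2 * K\<close>, without changing where it is differentiable. The exceptional points are
  sorted by rationals \<open>p < q\<close> that separate the lower and upper derivates, and by
  \<open>n\<close> because the covering argument treats bounded sets.\<close>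

lemma lipschitz_real_differentiable_ae:
  fixes f :: "real \<Rightarrow> real"
  assumes "K-lipschitz_on UNIV f"
  shows "negligible {x. \<not> f differentiable (at x)}"
proof -
  have K: "0 \<le> K" "\<And>x y. \<bar>f x - f y\<bar> \<le> K * \<bar>x - y\<bar>"
    using assms by (auto simp: lipschitz_on_def dist_real_def)
  define g where "g x = f x + K * x" for x
  have g_diff: "0 \<le> g y - g x \<and> g y - g x \<le> 2 * K * (y - x)" if "x \<le> y" for x y
    using K(2)[of x y] that by (auto simp: g_def algebra_simps)
  have "mono g"
    using g_diff by (simp add: mono_def)
  have "continuous_on UNIV g"
    unfolding g_def by (intro continuous_intros lipschitz_on_continuous_on[OF assms])
  define Q where "Q x h = (g (x + h) - g x) / h" for x h
  have Q: "0 \<le> Q x h \<and> Q x h \<le> 2 * K" if "h \<noteq> 0" for x h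
  proof (cases "h > 0")
    case True
    then show ?thesis using g_diff[of x "x + h"] by (auto simp: Q_def field_simps)
  next
    case False
    then have "h < 0" using that by simp
    then show ?thesis using g_diff[of "x + h" x] by (auto simp: Q_def field_simps)
  qed
  have Q_int: "\<exists>a b. g b - g a = Q x h * (b - a) \<and> a < b \<and> a \<le> x \<and> x \<le> b \<and> b - a = \<bar>h\<bar>" if "h \<noteq> 0" for x h
  proof (cases "h > 0")
    case True
    then show ?thesis by (intro exI[of _ x] exI[of _ "x + h"]) (auto simp: Q_def)
  next
    case False
    then show ?thesis using that by (intro exI[of _ "x + h"] exI[of _ x]) (auto simp: Q_def field_simps)
  qed
  define S where "S n p q = {x. x \<in> cball 0 (real n) \<and> frequently (\<lambda>h. Q x h \<le> p) (at 0) \<and> frequently (\<lambda>h. q \<le> Q x h) (at 0)}"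
    for n p q
  have fin: "\<exists>h. h \<noteq> 0 \<and> \<bar>h\<bar> < d \<and> P h" if "frequently P (at 0)" "0 < d" for P and d :: real
    using that by (auto simp: frequently_at)
  have neg: "negligible (S n p q)" if "0 \<le> p" "p < q" for n p q
  proof (rule negligible_derivates_gap[OF \<open>mono g\<close> \<open>continuous_on UNIV g\<close> that])
    show "bounded (S n p q)"
      by (rule bounded_subset[OF bounded_cball[of 0 "real n"]]) (auto simp: S_def)
  next
    fix x d :: real assume "x \<in> S n p q" "0 < d"
    then obtain h where "h \<noteq> 0" "\<bar>h\<bar> < d" "Q x h \<le> p"
      using fin[of "\<lambda>h. Q x h \<le> p" d] by (auto simp: S_def)
    then show "\<exists>a b. g b - g a \<le> p * (b - a) \<and> a < b \<and> a \<le> x \<and> x \<le> b \<and> b - a < d"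
      using Q_int[of h x] by (metis abs_ge_zero mult_right_mono)
  next
    fix x d :: real assume "x \<in> S n p q" "0 < d"
    then obtain h where "h \<noteq> 0" "\<bar>h\<bar> < d" "q \<le> Q x h"
      using fin[of "\<lambda>h. q \<le> Q x h" d] by (auto simp: S_def)
    then show "\<exists>a b. q * (b - a) \<le> g b - g a \<and> a < b \<and> a \<le> x \<and> x \<le> b \<and> b - a < d"
      using Q_int[of h x] by (metis abs_ge_zero mult_right_mono)
  qed
  define I where "I = {(n :: nat, p, q). p \<in> \<rat> \<and> q \<in> \<rat> \<and> (0::real) \<le> p \<and> p < q}"
  have "I \<subseteq> UNIV \<times> \<rat> \<times> \<rat>" by (auto simp: I_def)
  then have "countable I"
    by (rule countable_subset) (intro countable_SIGMA countable_rat, auto)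
  have "{x. \<not> f differentiable (at x)} \<subseteq> (\<Union>(n, p, q)\<in>I. S n p q)"
  proof
    fix x assume "x \<in> {x. \<not> f differentiable (at x)}"
    then have nf: "\<not> f differentiable (at x)" by simp
    have "\<not> g differentiable (at x)"
    proof
      assume "g differentiable (at x)"
      then have "(\<lambda>y. g y - K * y) differentiable (at x)"
        by (intro derivative_intros) auto
      then show False using nf by (simp add: g_def)
    qed
    obtain p q where pq: "p \<in> \<rat>" "q \<in> \<rat>" "0 \<le> p" "p < q"
       "\<not> (eventually (\<lambda>h. p < Q x h) (at 0) \<or> eventually (\<lambda>h. Q x h < q) (at 0))"
    proof (rule ccontr, goal_cases)
      case *: 1
      then have gap: "eventually (\<lambda>h. p < Q x h) (at 0) \<or> eventually (\<lambda>h. Q x h < q) (at 0)"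
        if "p \<in> \<rat>" "q \<in> \<rat>" "0 \<le> p" "p < q" for p q
        using that * by blast
      show False
        using \<open>\<not> g differentiable (at x)\<close>
          real_differentiable_if_no_derivate_gap[of g x "2 * K", folded Q_def, OF Q gap] by blast
    qed
    obtain n where "\<bar>x\<bar> \<le> real n" using real_arch_simple by blast
    then have "x \<in> S n p q"
      using pq by (auto simp: S_def frequently_def not_le)
    then show "x \<in> (\<Union>(n, p, q)\<in>I. S n p q)"
      using pq by (auto simp: I_def)
  qed
  moreover have "negligible (\<Union>(n, p, q)\<in>I. S n p q)"
    using \<open>countable I\<close> neg by (intro negligible_countable_Union) (auto simp: I_def)
  ultimately show ?thesis
    by (rule negligible_subset[rotated])
qed

lemma lipschitz_vector_differentiable_ae:
  fixes f :: "real \<Rightarrow> 'a::euclidean_space"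
  assumes "K-lipschitz_on UNIV f"
  shows "negligible {x. \<not> f differentiable (at x)}"
proof -
  have "negligible {x. \<not> (\<lambda>x. f x \<bullet> i) differentiable (at x)}" if "i \<in> Basis" for i
  proof (rule lipschitz_real_differentiable_ae)
    show "K-lipschitz_on UNIV (\<lambda>x. f x \<bullet> i)"
    proof (rule lipschitz_onI)
      fix x y
      have "dist (f x \<bullet> i) (f y \<bullet> i) = \<bar>(f x - f y) \<bullet> i\<bar>"
        by (simp add: dist_real_def inner_diff_left)
      also have "\<dots> \<le> norm (f x - f y)"
        using that by (rule Basis_le_norm)
      also have "\<dots> \<le> K * dist x y"
        using lipschitz_onD[OF assms, of x y] by (simp add: dist_norm)
      finally show "dist (f x \<bullet> i) (f y \<bullet> i) \<le> K * dist x y" .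
    qed (use assms in \<open>simp add: lipschitz_on_def\<close>)
  qed
  then have "negligible (\<Union>i\<in>Basis. {x. \<not> (\<lambda>x. f x \<bullet> i) differentiable (at x)})"
    by (intro negligible_Union) auto
  then show ?thesis
    by (rule negligible_subset)
      (use differentiable_componentwise_within[of f _ UNIV] in blast)
qed

text \<open>A mean value inequality that asks for the bound only where a derivative exists.
  Difference quotients of \<open>f\<close>, projected to the direction of \<open>f b - f a\<close>,
  are bounded by the Lipschitz constant and converge almost everywhere, so dominated convergence
  applies; their integrals telescope to mean values of the projection near \<open>b\<close> and near
  \<open>a\<close>.\<close>

lemma lipschitz_norm_diff_le:
  fixes f :: "real \<Rightarrow> 'a::euclidean_space"
  assumes "K-lipschitz_on {a..b} f" "a \<le> b" "0 \<le> c"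
    and der: "\<And>x f'. x \<in> {a<..<b} \<Longrightarrow> (f has_vector_derivative f') (at x) \<Longrightarrow> norm f' \<le> c"
  shows "norm (f b - f a) \<le> c * (b - a)"
proof -
  have K: "0 \<le> K" and Kf: "\<And>x y. x \<in> {a..b} \<Longrightarrow> y \<in> {a..b} \<Longrightarrow> norm (f x - f y) \<le> K * \<bar>x - y\<bar>"
    using lipschitz_on_nonneg[OF assms(1)] lipschitz_onD[OF assms(1)]
    by (simp_all add: dist_norm)
  define r where "r x = max a (min b x)" for x
  have r: "r x \<in> {a..b}" "\<bar>r x - r y\<bar> \<le> \<bar>x - y\<bar>" "x \<in> {a..b} \<Longrightarrow> r x = x" for x y
    using \<open>a \<le> b\<close> by (auto simp: r_def)
  define F where "F x = f (r x)" for x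
  have LF: "K-lipschitz_on UNIV F"
  proof (rule lipschitz_onI[OF _ K])
    fix x y
    have "norm (F x - F y) \<le> K * \<bar>r x - r y\<bar>"
      unfolding F_def by (intro Kf r)
    also have "\<dots> \<le> K * \<bar>x - y\<bar>"
      using K r(2) by (intro mult_left_mono)
    finally show "dist (F x) (F y) \<le> K * dist x y" by (simp add: dist_norm)
  qed
  \<comment> \<open>If \<open>f b = f a\<close>, division by zero makes \<open>u = 0\<close>; the
    bound \<open>norm u \<le> 1\<close> and the final identity hold in that case too.\<close>
  define u where "u = (1 / norm (f b - f a)) *\<^sub>R (f b - f a)"
  have "norm u \<le> 1" by (simp add: u_def)
  define g where "g x = F x \<bullet> u" for x
  have gL: "\<bar>g x - g y\<bar> \<le> K * \<bar>x - y\<bar>" for x y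
  proof -
    have "\<bar>g x - g y\<bar> = \<bar>(F x - F y) \<bullet> u\<bar>" by (simp add: g_def inner_diff_left)
    also have "\<dots> \<le> norm (F x - F y) * norm u" by (rule Cauchy_Schwarz_ineq2)
    also have "\<dots> \<le> norm (F x - F y)" using \<open>norm u \<le> 1\<close> by (simp add: mult_left_le)
    also have "\<dots> \<le> K * \<bar>x - y\<bar>" using lipschitz_onD[OF LF, of x y] by (simp add: dist_norm)
    finally show ?thesis .
  qed
  have gc: "continuous_on S g" for S
    unfolding g_def
    by (intro continuous_intros continuous_on_subset[OF lipschitz_on_continuous_on[OF LF]]) auto
  have gc': "continuous_on S (\<lambda>x. g (x + h))" for S h
    by (rule continuous_on_compose2[OF gc[of UNIV]]) (auto intro!: continuous_intros)
  have gi: "g integrable_on {x..y}" for x y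
    by (rule integrable_continuous_real[OF gc])
  define N where "N = {x. \<not> F differentiable (at x)}"
  have "negligible N"
    unfolding N_def by (rule lipschitz_vector_differentiable_ae[OF LF])
  define h where "h n = inverse (real (Suc n))" for n
  have h: "0 < h n" "h \<longlonglongrightarrow> 0" for n
    unfolding h_def using LIMSEQ_inverse_real_of_nat by simp_all
  define D where "D n x = (g (x + h n) - g x) / h n" for n x
  \<comment> \<open>The ends are removed as well, because the hypothesis on derivatives covers the
    open interval only.\<close>
  define N' where "N' = N \<union> {a, b}"
  have "negligible N'" unfolding N'_def using \<open>negligible N\<close> by (intro negligible_Un) auto
  \<comment> \<open>Setting the quotients and their limit to 0 on \<open>N'\<close> turns
    convergence almost everywhere into convergence at every point, as
    \<open>dominated_convergence\<close> asks.\<close>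
  define D0 where "D0 n x = (if x \<in> N' then 0 else D n x)" for n x
  define g' where "g' x = (if x \<in> N' then 0 else vector_derivative F (at x) \<bullet> u)" for x
  have Dint: "D n integrable_on {a..b}" for n
    unfolding D_def by (intro integrable_continuous_real continuous_intros gc gc') (use h(1)[of n] in auto)
  have D0int: "D0 n integrable_on {a..b}" "integral {a..b} (D0 n) = integral {a..b} (D n)" for n
  proof -
    show "D0 n integrable_on {a..b}"
      by (rule integrable_spike[OF Dint[of n] \<open>negligible N'\<close>]) (auto simp: D0_def)
    show "integral {a..b} (D0 n) = integral {a..b} (D n)"
      by (rule integral_spike[OF \<open>negligible N'\<close>]) (auto simp: D0_def)
  qed
  have D0b: "norm (D0 n x) \<le> K" for n x
    using gL[of "x + h n" x] h(1)[of n] K by (auto simp: D0_def D_def abs_divide field_simps)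
  have D0lim: "(\<lambda>n. D0 n x) \<longlonglongrightarrow> g' x" for x
  proof (cases "x \<in> N'")
    case False
    then have "(F has_vector_derivative vector_derivative F (at x)) (at x)"
      by (simp add: N'_def N_def vector_derivative_works)
    then have "(g has_vector_derivative vector_derivative F (at x) \<bullet> u) (at x)"
      unfolding g_def has_vector_derivative_def
      by (auto intro!: derivative_eq_intros)
    then have "(g has_field_derivative g' x) (at x)"
      using False by (simp add: has_real_derivative_iff_has_vector_derivative g'_def)
    then have "((\<lambda>t. (g (x + t) - g x) / t) \<longlongrightarrow> g' x) (at 0)"
      by (simp add: DERIV_def)
    moreover have "filterlim h (at 0) sequentially"
      using h by (auto simp: filterlim_at intro!: always_eventually) (metis less_irrefl)
    ultimately have "(\<lambda>n. D n x) \<longlonglongrightarrow> g' x"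
      unfolding D_def by (rule filterlim_compose)
    then show ?thesis using False by (simp add: D0_def)
  qed (simp add: D0_def g'_def)
  have conv: "g' integrable_on {a..b}" "(\<lambda>n. integral {a..b} (D0 n)) \<longlonglongrightarrow> integral {a..b} g'"
    using dominated_convergence[of D0 "{a..b}" "\<lambda>_. K" g'] D0int D0b D0lim by auto
  have g'c: "g' x \<le> c" if "x \<in> {a..b}" for x
  proof (cases "x \<in> N'")
    case False
    then have x: "x \<in> {a<..<b}" using that by (auto simp: N'_def)
    have "(F has_vector_derivative vector_derivative F (at x)) (at x)"
      using False by (simp add: N'_def N_def vector_derivative_works)
    then have "(f has_vector_derivative vector_derivative F (at x)) (at x)"
      by (rule has_vector_derivative_transform_within_open[where S = "{a<..<b}"])
        (use x in \<open>auto simp: F_def r(3)\<close>)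
    then have "norm (vector_derivative F (at x)) \<le> c"
      using der x by blast
    moreover have "vector_derivative F (at x) \<bullet> u \<le> norm (vector_derivative F (at x)) * norm u"
      by (rule norm_cauchy_schwarz)
    moreover have "\<dots> \<le> norm (vector_derivative F (at x))"
      using \<open>norm u \<le> 1\<close> by (simp add: mult_left_le)
    ultimately show ?thesis using False by (simp add: g'_def)
  qed (simp add: g'_def \<open>0 \<le> c\<close>)
  have "integral {a..b} g' \<le> integral {a..b} (\<lambda>_. c)"
    using g'c conv by (intro integral_le) auto
  then have up: "integral {a..b} g' \<le> c * (b - a)"
    using \<open>a \<le> b\<close> by (simp add: mult.commute)
  have lo: "g b - g a - K * h n \<le> integral {a..b} (D n)" for n
  proof -
    have hn: "0 < h n" by (rule h)
    have shift: "integral {a..b} (\<lambda>x. g (x + h n)) = integral {a + h n..b + h n} g"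
      using integral_shift_Icc_real[of a b g "h n"] by (simp add: o_def add.commute)
    have "integral {a..b} (D n) = (integral {a..b} (\<lambda>x. g (x + h n)) - integral {a..b} g) / h n"
      unfolding D_def
      by (subst integral_divide, subst integral_diff) (auto intro!: integrable_continuous_real gc gc')
    also have "\<dots> = (integral {a + h n..b + h n} g - integral {a..b} g) / h n"
      by (simp add: shift)
    also have "integral {a + h n..b + h n} g - integral {a..b} g = integral {b..b + h n} g - integral {a..a + h n} g"
    proof -
      have "integral {a..b} g + integral {b..b + h n} g = integral {a..b + h n} g"
        using \<open>a \<le> b\<close> hn gi by (intro Henstock_Kurzweil_Integration.integral_combine) auto
      moreover have "integral {a..a + h n} g + integral {a + h n..b + h n} g = integral {a..b + h n} g"
        using \<open>a \<le> b\<close> hn gi by (intro Henstock_Kurzweil_Integration.integral_combine) auto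
      ultimately show ?thesis by linarith
    qed
    finally have eq: "integral {a..b} (D n) * h n = integral {b..b + h n} g - integral {a..a + h n} g"
      using hn by simp
    \<comment> \<open>To the right of \<open>b\<close> the clamped function is constant, so this
      integral is exact. At \<open>a\<close> the Lipschitz bound is used, with an error
      \<open>K * h n\<close> that vanishes in the limit.\<close>
    have "integral {b..b + h n} g = integral {b..b + h n} (\<lambda>_. g b)"
      using \<open>a \<le> b\<close> by (intro integral_cong) (auto simp: g_def F_def r_def)
    then have 1: "integral {b..b + h n} g = g b * h n" using hn by simp
    have "integral {a..a + h n} g \<le> integral {a..a + h n} (\<lambda>_. g a + K * h n)"
    proof (rule integral_le[OF gi])
      fix x assume "x \<in> {a..a + h n}"
      then have "K * \<bar>x - a\<bar> \<le> K * h n" using K by (intro mult_left_mono) auto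
      then show "g x \<le> g a + K * h n" using gL[of x a] by linarith
    qed auto
    then have "integral {a..a + h n} g \<le> (g a + K * h n) * h n" using hn by (simp add: mult.commute)
    then have "(g b - g a - K * h n) * h n \<le> integral {a..b} (D n) * h n"
      unfolding eq 1 by (simp add: algebra_simps)
    then show ?thesis using hn by simp
  qed
  have "(\<lambda>n. g b - g a - K * h n) \<longlonglongrightarrow> g b - g a - K * 0"
    by (intro tendsto_intros h)
  then have "g b - g a \<le> integral {a..b} g'"
    using LIMSEQ_le[of "\<lambda>n. g b - g a - K * h n" "g b - g a - K * 0" "\<lambda>n. integral {a..b} (D0 n)" "integral {a..b} g'"]
      conv lo D0int by auto
  moreover have "g b - g a = norm (f b - f a)"
  proof -
    have "g b - g a = (f b - f a) \<bullet> u"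
      using \<open>a \<le> b\<close> by (simp add: g_def F_def r_def inner_diff_left)
    also have "\<dots> = norm (f b - f a)"
      by (cases "f b - f a = 0") (auto simp: u_def dot_square_norm power2_eq_square)
    finally show ?thesis .
  qed
  ultimately show ?thesis using up by linarith
qed

section \<open>Parametrizations of links\<close>

lemma link_param_domain:
  assumes "link_param L \<gamma> D"
  obtains "D = UNIV" | l where "0 < l" "D = {0..l}"
  using assms by (auto simp: link_param_def c11_arc_def c11_circle_def)

lemma Icc_neq_UNIV: "{a..b} \<noteq> (UNIV :: real set)"
  by (metis atLeastAtMost_iff UNIV_I gt_ex not_le)

lemma link_param_length_pos:
  assumes "link_param L \<gamma> {0..l}"
  shows "0 < l"
proof (cases rule: link_param_domain[OF assms])
  case (2 l')
  then show ?thesis by (metis Icc_eq_Icc less_imp_le)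
qed (simp add: Icc_neq_UNIV)

lemma link_param_c11: "link_param L \<gamma> D \<Longrightarrow> c11_arclength \<gamma> D"
  by (auto simp: link_param_def c11_arc_def c11_circle_def)

lemma link_param_image_subset: "link_param L \<gamma> D \<Longrightarrow> s \<in> D \<Longrightarrow> \<gamma> s \<in> L"
  using in_components_subset by (auto simp: link_param_def)

lemma link_param_segment:
  assumes "link_param L \<gamma> D" "s \<in> D" "t \<in> D" "s \<le> r" "r \<le> t"
  shows "r \<in> D"
  using assms by (auto elim: link_param_domain)

lemma link_param_not_bot:
  assumes "link_param L \<gamma> D" "s \<in> D"
  shows "at s within D \<noteq> bot"
proof (cases rule: link_param_domain[OF assms(1)])
  case (2 l)
  then show ?thesis using assms(2) by (simp add: trivial_limit_within islimpt_Icc)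
qed (use assms in auto)

lemma link_param_has_derivative:
  assumes "link_param L \<gamma> D" "s \<in> D"
  shows "(\<gamma> has_vector_derivative velocity \<gamma> D s) (at s within D)"
  using link_param_c11[OF assms(1)] assms(2)
  unfolding c11_arclength_def velocity_def by (simp add: vector_derivative_works)

lemma velocity_eqI:
  assumes "link_param L \<gamma> D" "s \<in> D" "(\<gamma> has_vector_derivative v) (at s within D)"
  shows "velocity \<gamma> D s = v"
  unfolding velocity_def
  by (rule vector_derivative_within[OF link_param_not_bot[OF assms(1,2)] assms(3)])

lemma norm_velocity:
  assumes "link_param L \<gamma> D" "s \<in> D"
  shows "norm (velocity \<gamma> D s) = 1"
  using link_param_c11[OF assms(1)] assms(2) by (simp add: c11_arclength_def)

lemma link_param_continuous:
  assumes "link_param L \<gamma> D"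
  shows "continuous_on D \<gamma>"
  unfolding continuous_on_eq_continuous_within
  using link_param_has_derivative[OF assms] by (auto intro: has_vector_derivative_continuous)

lemma link_param_lipschitz:
  assumes "link_param L \<gamma> D"
  obtains K where "0 \<le> K" "K-lipschitz_on D (velocity \<gamma> D)"
  using link_param_c11[OF assms] lipschitz_on_nonneg by (auto simp: c11_arclength_def)

text \<open>The derivative of \<open>?f\<close> at \<open>r\<close> has norm at most
  \<open>K * \<bar>r - s\<bar>\<close>, which is the derivative of a quadratic comparison function;
  backwards from \<open>s\<close> that function takes the opposite sign in order to
  increase.\<close>

lemma link_param_taylor:
  assumes lp: "link_param L \<gamma> D" and "s \<in> D" "t \<in> D" and K: "K-lipschitz_on D (velocity \<gamma> D)"
  shows "norm (\<gamma> t - \<gamma> s - (t - s) *\<^sub>R velocity \<gamma> D s) \<le> K * (t - s)\<^sup>2 / 2"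
proof -
  let ?f = "\<lambda>r. \<gamma> r - r *\<^sub>R velocity \<gamma> D s"
  have der: "(?f has_vector_derivative velocity \<gamma> D r - velocity \<gamma> D s) (at r)"
    if "a < r" "r < b" "a \<in> D" "b \<in> D" for a b r
  proof -
    have sub: "{a<..<b} \<subseteq> D"
      using link_param_segment[OF lp \<open>a \<in> D\<close> \<open>b \<in> D\<close>] by auto
    then have "(\<gamma> has_vector_derivative velocity \<gamma> D r) (at r within {a<..<b})"
      using link_param_has_derivative[OF lp] that
      by (intro has_vector_derivative_within_subset[OF _ sub]) auto
    then have "(\<gamma> has_vector_derivative velocity \<gamma> D r) (at r)"
      using that by (simp add: at_within_open[of _ "{a<..<b}"])
    then show ?thesis
      by (auto intro!: derivative_eq_intros)
  qed
  have cont: "continuous_on {a..b} ?f" if "a \<in> D" "b \<in> D" for a b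
    using link_param_segment[OF lp that]
    by (intro continuous_intros continuous_on_subset[OF link_param_continuous[OF lp]]) auto
  have bound: "norm (velocity \<gamma> D r - velocity \<gamma> D s) \<le> K * \<bar>r - s\<bar>" if "r \<in> D" for r
    using lipschitz_onD[OF K that \<open>s \<in> D\<close>] by (simp add: dist_norm)
  consider "s = t" | "s < t" | "t < s" by linarith
  then show ?thesis
  proof cases
    case 2
    have "norm (?f t - ?f s) \<le> K * (t - s)\<^sup>2 / 2 - K * (s - s)\<^sup>2 / 2"
    proof (rule differentiable_bound_general[where \<phi> = "\<lambda>r. K * (r - s)\<^sup>2 / 2" and \<phi>' = "\<lambda>r. K * (r - s)"])
      show "continuous_on {s..t} ?f" by (rule cont[OF assms(2,3)])
      fix r assume r: "s < r" "r < t"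
      show "(?f has_vector_derivative velocity \<gamma> D r - velocity \<gamma> D s) (at r)"
        using der r assms(2,3) by blast
      show "((\<lambda>r. K * (r - s)\<^sup>2 / 2) has_vector_derivative K * (r - s)) (at r)"
        unfolding has_real_derivative_iff_has_vector_derivative[symmetric]
        by (auto intro!: derivative_eq_intros)
      show "norm (velocity \<gamma> D r - velocity \<gamma> D s) \<le> K * (r - s)"
        using bound[of r] link_param_segment[OF lp assms(2,3)] r by simp
    qed (use 2 in \<open>auto intro!: continuous_intros\<close>)
    then show ?thesis by (simp add: algebra_simps)
  next
    case 3
    have "norm (?f s - ?f t) \<le> - K * (s - s)\<^sup>2 / 2 - (- K * (t - s)\<^sup>2 / 2)"
    proof (rule differentiable_bound_general[where \<phi> = "\<lambda>r. - K * (r - s)\<^sup>2 / 2" and \<phi>' = "\<lambda>r. - K * (r - s)"])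
      show "continuous_on {t..s} ?f" by (rule cont[OF assms(3,2)])
      fix r assume r: "t < r" "r < s"
      show "(?f has_vector_derivative velocity \<gamma> D r - velocity \<gamma> D s) (at r)"
        using der r assms(2,3) by blast
      show "((\<lambda>r. - K * (r - s)\<^sup>2 / 2) has_vector_derivative - K * (r - s)) (at r)"
        unfolding has_real_derivative_iff_has_vector_derivative[symmetric]
        by (auto intro!: derivative_eq_intros)
      show "norm (velocity \<gamma> D r - velocity \<gamma> D s) \<le> - K * (r - s)"
        using bound[of r] link_param_segment[OF lp assms(3,2)] r by (simp add: algebra_simps)
    qed (use 3 in \<open>auto intro!: continuous_intros\<close>)
    moreover have "?f s - ?f t = - (\<gamma> t - \<gamma> s - (t - s) *\<^sub>R velocity \<gamma> D s)"
      by (simp add: algebra_simps)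
    ultimately show ?thesis by (simp only: norm_minus_cancel) simp
  qed simp
qed

text \<open>Reversal yields both signs of the tangent vector and turns the far end of an arc into a
  starting point. The reflection maps the domain to itself: \<open>a\<close> is the length of an
  arc, and 0 for a circle.\<close>

lemma link_param_reverse:
  assumes lp: "link_param L \<gamma> D"
  obtains a where "\<And>s. a - s \<in> D \<longleftrightarrow> s \<in> D" "\<And>l. D = {0..l} \<Longrightarrow> a = l"
    "link_param L (\<lambda>s. \<gamma> (a - s)) D"
    "\<And>s. s \<in> D \<Longrightarrow> velocity (\<lambda>s. \<gamma> (a - s)) D s = - velocity \<gamma> D (a - s)"
proof -
  define a where "a = (if D = UNIV then 0 else THE l. D = {0..l})"
  note Icc = Icc_neq_UNIV
  have inj: "l = l'" if "{0..l} = {0..l'}" "0 < l" for l l' :: real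
    using that by (metis Icc_eq_Icc less_imp_le)
  have a: "a = l" if "D = {0..l}" for l
  proof -
    have "0 < l" using link_param_length_pos lp that by blast
    then have "(THE l. D = {0..l}) = l"
      using inj that by (intro the_equality) auto
    then show ?thesis using that Icc by (simp add: a_def)
  qed
  have D: "a - s \<in> D \<longleftrightarrow> s \<in> D" for s
    using lp
  proof (cases rule: link_param_domain)
    case (2 l)
    then show ?thesis using a[OF 2(2)] by auto
  qed auto
  have img: "(\<lambda>s. a - s) ` D = D"
    using D by (auto simp: image_iff) (metis D diff_diff_eq2 add_diff_cancel_left')
  have der: "((\<lambda>s. \<gamma> (a - s)) has_vector_derivative - velocity \<gamma> D (a - s)) (at s within D)" if "s \<in> D" for s
  proof -
    have "((\<lambda>s. a - s) has_vector_derivative -1) (at s within D)"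
      by (auto intro!: derivative_eq_intros)
    moreover have "(\<gamma> has_vector_derivative velocity \<gamma> D (a - s)) (at (a - s) within (\<lambda>s. a - s) ` D)"
      unfolding img using that D by (intro link_param_has_derivative[OF lp]) auto
    ultimately show ?thesis
      using vector_diff_chain_within by (fastforce simp: o_def)
  qed
  have vel: "velocity (\<lambda>s. \<gamma> (a - s)) D s = - velocity \<gamma> D (a - s)" if "s \<in> D" for s
    unfolding velocity_def[of "\<lambda>s. \<gamma> (a - s)"]
    by (rule vector_derivative_within[OF link_param_not_bot[OF lp that] der[OF that]])
  have c11: "c11_arclength (\<lambda>s. \<gamma> (a - s)) D"
    unfolding c11_arclength_def
  proof (intro conjI ballI)
    fix s assume s: "s \<in> D"
    show "(\<lambda>s. \<gamma> (a - s)) differentiable (at s within D)"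
      using der[OF s] by (rule differentiableI_vector)
    show "norm (velocity (\<lambda>s. \<gamma> (a - s)) D s) = 1"
      using vel[OF s] norm_velocity[OF lp] D s by simp
  next
    obtain K where "0 \<le> K" and K: "K-lipschitz_on D (velocity \<gamma> D)"
      by (rule link_param_lipschitz[OF lp])
    have "K-lipschitz_on D (velocity (\<lambda>s. \<gamma> (a - s)) D)"
    proof (rule lipschitz_onI)
      fix s t assume "s \<in> D" "t \<in> D"
      then show "dist (velocity (\<lambda>s. \<gamma> (a - s)) D s) (velocity (\<lambda>s. \<gamma> (a - s)) D t) \<le> K * dist s t"
        using lipschitz_onD[OF K, of "a - s" "a - t"] D by (simp add: vel dist_minus dist_real_def abs_minus_commute)
    qed fact
    then show "\<exists>K. K-lipschitz_on D (velocity (\<lambda>s. \<gamma> (a - s)) D)" by blast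
  qed
  have image: "(\<lambda>s. \<gamma> (a - s)) ` D = \<gamma> ` D"
    using img by (metis image_image)
  have "link_param L (\<lambda>s. \<gamma> (a - s)) D"
    using lp
  proof (cases rule: link_param_domain)
    case 1
    then have "c11_circle \<gamma> D"
      using lp Icc by (auto simp: link_param_def c11_arc_def)
    then obtain l where l: "0 < l" "\<And>s. \<gamma> (s + l) = \<gamma> s" "inj_on \<gamma> {0..<l}"
      by (auto simp: c11_circle_def)
    have "a = 0" using 1 by (simp add: a_def)
    have "inj_on (\<lambda>s. \<gamma> (- s)) {0..<l}"
    proof (rule inj_onI)
      fix s t assume st: "s \<in> {0..<l}" "t \<in> {0..<l}" "\<gamma> (- s) = \<gamma> (- t)"
      \<comment> \<open>Moves \<open>- s\<close> back into \<open>{0..<l}\<close> by one period; 0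
        stays where it is.\<close>
      define r where "r s = (if s = 0 then 0 else l - s)" for s
      have r: "\<gamma> (r s) = \<gamma> (- s)" "s \<in> {0..<l} \<Longrightarrow> r s \<in> {0..<l}" for s
        using l(2)[of "- s"] l(1) by (auto simp: r_def)
      then have "r s = r t"
        using st l(3) by (metis inj_onD)
      then show "s = t" using st by (auto simp: r_def split: if_splits)
    qed
    moreover have "\<gamma> (- (s + l)) = \<gamma> (- s)" for s
      using l(2)[of "- s - l"] by simp
    ultimately have "c11_circle (\<lambda>s. \<gamma> (a - s)) D"
      using c11 1 l(1) \<open>a = 0\<close> by (auto simp: c11_circle_def)
    then show ?thesis using lp by (simp add: link_param_def image)
  next
    case (2 l)
    then have "c11_arc \<gamma> D"
      using lp Icc by (auto simp: link_param_def c11_circle_def)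
    then have "inj_on \<gamma> D" by (auto simp: c11_arc_def)
    have "inj_on (\<lambda>s. \<gamma> (a - s)) D"
    proof (rule inj_onI)
      fix s t assume "s \<in> D" "t \<in> D" "\<gamma> (a - s) = \<gamma> (a - t)"
      then have "a - s = a - t" using D \<open>inj_on \<gamma> D\<close> by (metis inj_onD)
      then show "s = t" by simp
    qed
    then have "c11_arc (\<lambda>s. \<gamma> (a - s)) D"
      using c11 2 by (auto simp: c11_arc_def)
    then show ?thesis using lp by (simp add: link_param_def image)
  qed
  then show thesis
    using that D a vel by blast
qed

lemma link_param_exists:
  assumes "c11_link L" "x \<in> L"
  obtains \<gamma> D s where "link_param L \<gamma> D" "s \<in> D" "\<gamma> s = x"
proof -
  have "x \<in> \<Union> (components L)" using assms by simp
  then obtain C where C: "C \<in> components L" "x \<in> C" by blast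
  obtain \<gamma> D where "c11_arc \<gamma> D \<or> c11_circle \<gamma> D" "\<gamma> ` D = C"
    using assms(1) C(1) unfolding c11_link_def by blast
  then show thesis using that C by (auto simp: link_param_def)
qed

lemma link_param_period:
  assumes lp: "link_param L \<gamma> UNIV"
  obtains l where "0 < l" "\<And>s k. \<gamma> (s + of_int k * l) = \<gamma> s"
    "\<And>s k. velocity \<gamma> UNIV (s + of_int k * l) = velocity \<gamma> UNIV s"
    "\<And>s t. \<gamma> s = \<gamma> t \<Longrightarrow> \<exists>k::int. t = s + of_int k * l"
proof -
  have "c11_circle \<gamma> UNIV"
    using lp Icc_neq_UNIV by (auto simp: link_param_def c11_arc_def)
  then obtain l where l: "0 < l" "\<And>s. \<gamma> (s + l) = \<gamma> s" "inj_on \<gamma> {0..<l}"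
    by (auto simp: c11_circle_def)
  have per: "\<gamma> (s + of_int k * l) = \<gamma> s" for s k
  proof (induction k arbitrary: s rule: int_induct[where k = 0])
    case (step1 i)
    then show ?case using l(2)[of "s + of_int i * l"] by (simp add: algebra_simps)
  next
    case (step2 i)
    then show ?case using l(2)[of "s + of_int (i - 1) * l"] by (simp add: algebra_simps)
  qed simp
  have "velocity \<gamma> UNIV (s + of_int k * l) = velocity \<gamma> UNIV s" for s k
  proof -
    have "((\<lambda>s. s + of_int k * l) has_vector_derivative 1) (at s)"
      by (auto intro!: derivative_eq_intros)
    moreover have "(\<gamma> has_vector_derivative velocity \<gamma> UNIV (s + of_int k * l)) (at (s + of_int k * l))"
      using link_param_has_derivative[OF lp] by simp
    ultimately have "((\<gamma> \<circ> (\<lambda>s. s + of_int k * l)) has_vector_derivative 1 *\<^sub>R velocity \<gamma> UNIV (s + of_int k * l)) (at s)"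
      by (rule vector_diff_chain_at)
    then have "(\<gamma> has_vector_derivative velocity \<gamma> UNIV (s + of_int k * l)) (at s)"
      by (simp add: o_def per)
    then show ?thesis
      using velocity_eqI[OF lp] by simp
  qed
  moreover have "\<exists>k::int. t = s + of_int k * l" if "\<gamma> s = \<gamma> t" for s t
  proof -
    define r where "r s = s + of_int (- \<lfloor>s / l\<rfloor>) * l" for s
    have "r s \<in> {0..<l}" for s
      using l(1) floor_divide_lower[of l s] floor_divide_upper[of l s] by (simp add: r_def algebra_simps)
    moreover have "\<gamma> (r s) = \<gamma> (r t)"
      unfolding r_def per by (rule that)
    ultimately have "r s = r t" using l(3) by (metis inj_onD)
    then have "t = s + of_int (\<lfloor>t / l\<rfloor> - \<lfloor>s / l\<rfloor>) * l"
      by (simp add: r_def algebra_simps)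
    then show ?thesis by blast
  qed
  ultimately show thesis using that l(1) per by blast
qed

text \<open>Circles are parametrized by the whole line, so compactness arguments need a compact
  piece on which every point occurs together with its velocity: one closed period.\<close>

lemma link_param_fundamental_domain:
  assumes lp: "link_param L \<gamma> D"
  obtains I where "compact I" "I \<subseteq> D"
    "\<And>s. s \<in> D \<Longrightarrow> \<exists>r\<in>I. \<gamma> r = \<gamma> s \<and> velocity \<gamma> D r = velocity \<gamma> D s"
proof (cases rule: link_param_domain[OF lp])
  case 1
  obtain l where l: "0 < l" "\<And>s k. \<gamma> (s + of_int k * l) = \<gamma> s"
    "\<And>s k. velocity \<gamma> UNIV (s + of_int k * l) = velocity \<gamma> UNIV s"
    using lp unfolding 1 by (rule link_param_period) blast
  have "\<exists>r\<in>{0..l}. \<gamma> r = \<gamma> s \<and> velocity \<gamma> D r = velocity \<gamma> D s" for s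
    using l floor_divide_lower[of l s] floor_divide_upper[of l s] unfolding 1
    by (intro bexI[of _ "s + of_int (- \<lfloor>s / l\<rfloor>) * l"]) (auto simp: algebra_simps simp del: of_int_minus)
  then show thesis using that[of "{0..l}"] 1 by auto
next
  case (2 l)
  show thesis
    by (rule that[of D]) (use 2 in auto)
qed

section \<open>Compactness of a link and uniform inverses of its parametrizations\<close>

lemma component_compact:
  assumes "c11_link L" "C \<in> components L"
  shows "compact C"
proof -
  obtain \<gamma> D where "c11_arc \<gamma> D \<or> c11_circle \<gamma> D" "\<gamma> ` D = C"
    using assms unfolding c11_link_def by blast
  then have lp: "link_param L \<gamma> D" using assms by (auto simp: link_param_def)
  obtain I where I: "compact I" "I \<subseteq> D" "\<And>s. s \<in> D \<Longrightarrow> \<exists>r\<in>I. \<gamma> r = \<gamma> s \<and> velocity \<gamma> D r = velocity \<gamma> D s"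
    by (rule link_param_fundamental_domain[OF lp]) blast
  then have "\<gamma> ` I = C"
    using \<open>\<gamma> ` D = C\<close> by (auto simp: image_iff subset_iff) metis
  moreover have "compact (\<gamma> ` I)"
    by (intro compact_continuous_image continuous_on_subset[OF link_param_continuous[OF lp]] I)
  ultimately show ?thesis by simp
qed

lemma link_compact:
  assumes "c11_link L"
  shows "compact L"
proof -
  have "compact (\<Union> (components L))"
    using assms component_compact by (intro compact_Union) (auto simp: c11_link_def)
  then show ?thesis by simp
qed

text \<open>The other components are finitely many compact sets, so they have a positive distance
  from \<open>C\<close>. Hence points of \<open>L\<close> close to a point of \<open>C\<close> lie
  on the same curve.\<close>

lemma link_component_far:
  assumes "c11_link L" "C \<in> components L"
  obtains d where "0 < d" "\<And>x y. x \<in> C \<Longrightarrow> y \<in> L \<Longrightarrow> dist x y < d \<Longrightarrow> y \<in> C"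
proof -
  have "closed (\<Union> (components L - {C}))"
    using assms component_compact by (intro closed_Union) (auto simp: c11_link_def compact_imp_closed)
  moreover have "C \<inter> \<Union> (components L - {C}) = {}"
    using assms(2) components_nonoverlap by fast
  ultimately obtain d where "0 < d" "\<And>x y. x \<in> C \<Longrightarrow> y \<in> \<Union> (components L - {C}) \<Longrightarrow> d \<le> dist x y"
    using separate_compact_closed[OF component_compact[OF assms]] by metis
  moreover have "y \<in> C \<or> y \<in> \<Union> (components L - {C})" if "y \<in> L" for y
    using that Union_components[of L] by blast
  ultimately show thesis using that by (meson not_le)
qed

text \<open>Pairs of parameters at distance at least \<open>\<eta>\<close>, measured modulo the
  period on a circle, form a compact set once the first one is restricted to a period. On it the
  distance of the images has a positive minimum, so the resulting \<open>\<delta>\<close> is uniform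
  in \<open>s\<close>.\<close>

lemma link_param_inverse:
  assumes "c11_link L" and lp: "link_param L \<gamma> D" and "0 < \<eta>"
  obtains \<delta> where "0 < \<delta>"
    "\<And>s y. s \<in> D \<Longrightarrow> y \<in> L \<Longrightarrow> dist (\<gamma> s) y < \<delta> \<Longrightarrow> \<exists>t\<in>D. \<gamma> t = y \<and> \<bar>t - s\<bar> < \<eta>"
proof -
  obtain d where d: "0 < d" "\<And>x y. x \<in> \<gamma> ` D \<Longrightarrow> y \<in> L \<Longrightarrow> dist x y < d \<Longrightarrow> y \<in> \<gamma> ` D"
    using link_component_far[OF assms(1), of "\<gamma> ` D"] lp unfolding link_param_def by metis
  have pos: "\<exists>e>0. \<forall>s t. (s, t) \<in> K \<longrightarrow> e \<le> dist (\<gamma> s) (\<gamma> t)"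
    if "compact K" "K \<subseteq> D \<times> D" "\<And>s t. (s, t) \<in> K \<Longrightarrow> \<gamma> s \<noteq> \<gamma> t" for K
  proof (cases "K = {}")
    case False
    have "continuous_on K (\<lambda>p. dist (\<gamma> (fst p)) (\<gamma> (snd p)))"
      using that(2)
      by (intro continuous_intros continuous_on_compose2[OF link_param_continuous[OF lp]]) auto
    then obtain p where "p \<in> K" "\<And>q. q \<in> K \<Longrightarrow> dist (\<gamma> (fst p)) (\<gamma> (snd p)) \<le> dist (\<gamma> (fst q)) (\<gamma> (snd q))"
      using continuous_attains_inf[OF \<open>compact K\<close> False] by blast
    then show ?thesis
      using that(3)[of "fst p" "snd p"] by (intro exI[of _ "dist (\<gamma> (fst p)) (\<gamma> (snd p))"]) force
  qed (use zero_less_one in blast)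
  have "\<exists>e>0. \<forall>s\<in>D. \<forall>y\<in>\<gamma> ` D. dist (\<gamma> s) y < e \<longrightarrow> (\<exists>t\<in>D. \<gamma> t = y \<and> \<bar>t - s\<bar> < \<eta>)"
    using lp
  proof (cases rule: link_param_domain)
    case 1
    obtain l where l: "0 < l" "\<And>s k. \<gamma> (s + of_int k * l) = \<gamma> s"
      "\<And>s t. \<gamma> s = \<gamma> t \<Longrightarrow> \<exists>k::int. t = s + of_int k * l"
      using lp unfolding 1 by (rule link_param_period) blast
    \<comment> \<open>For \<open>s\<close> in one closed period, \<open>t\<close> runs through the
      part of the period after \<open>s\<close> that keeps distance \<open>\<eta>\<close> from both
      \<open>s\<close> and \<open>s + l\<close>.\<close>
    define K where "K = {p. 0 \<le> fst p \<and> fst p \<le> l \<and> fst p + \<eta> \<le> snd p \<and> snd p \<le> fst p + l - \<eta>}"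
    have "K \<subseteq> {0..l} \<times> {0..2 * l}"
      using \<open>0 < \<eta>\<close> by (auto simp: K_def)
    then have "bounded K"
      by (rule bounded_subset[rotated]) (intro bounded_Times bounded_closed_interval)
    moreover have "closed K"
      unfolding K_def by (intro closed_Collect_conj closed_Collect_le continuous_intros)
    ultimately have "compact K" by (simp add: compact_eq_bounded_closed)
    moreover have "\<gamma> s \<noteq> \<gamma> t" if "(s, t) \<in> K" for s t
    proof
      assume "\<gamma> s = \<gamma> t"
      then obtain k :: int where k: "t = s + of_int k * l" using l(3) by blast
      moreover have "s + \<eta> \<le> t" "t \<le> s + l - \<eta>"
        using that by (simp_all add: K_def)
      ultimately have "0 < of_int k * l" "of_int k * l < 1 * l"
        using \<open>0 < \<eta>\<close> by linarith+
      then have "(0::real) < of_int k" "(of_int k :: real) < 1"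
        using l(1) zero_less_mult_pos2 mult_less_cancel_right_pos by blast+
      then show False by simp
    qed
    ultimately obtain e where e: "0 < e" "\<And>s t. (s, t) \<in> K \<Longrightarrow> e \<le> dist (\<gamma> s) (\<gamma> t)"
      using pos[of K] 1 by (metis UNIV_Times_UNIV top_greatest)
    have "\<exists>t. \<gamma> t = \<gamma> u \<and> \<bar>t - s\<bar> < \<eta>" if "dist (\<gamma> s) (\<gamma> u) < e" for s u
    proof -
      \<comment> \<open>\<open>a\<close> moves \<open>s\<close> into the first period, and
        \<open>b\<close> moves \<open>u\<close> into the period that starts at \<open>s\<close>. Not
        lying in \<open>K\<close> means that \<open>u + b\<close> is close to \<open>s\<close> or to
        \<open>s + l\<close>; in the latter case one more period is subtracted.\<close>
      define a where "a = of_int (- \<lfloor>s / l\<rfloor>) * l"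
      define b where "b = of_int (- \<lfloor>(u - s) / l\<rfloor>) * l"
      have s: "0 \<le> s + a" "s + a \<le> l"
        using floor_divide_lower[OF l(1), of s] floor_divide_upper[OF l(1), of s] by (auto simp: a_def algebra_simps)
      have u: "0 \<le> u - s + b" "u - s + b < l"
        using floor_divide_lower[OF l(1), of "u - s"] floor_divide_upper[OF l(1), of "u - s"]
        by (auto simp: b_def algebra_simps)
      have per: "\<gamma> (s + a) = \<gamma> s" "\<gamma> (u + b + a) = \<gamma> u" "\<gamma> (u + b) = \<gamma> u" "\<gamma> (u + b - l) = \<gamma> u"
        using l(2)[of s "- \<lfloor>s / l\<rfloor>"] l(2)[of "u + b" "- \<lfloor>s / l\<rfloor>"] l(2)[of u "- \<lfloor>(u - s) / l\<rfloor>"]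
          l(2)[of u "- \<lfloor>(u - s) / l\<rfloor> - 1"]
        by (simp_all add: a_def b_def algebra_simps)
      then have "(s + a, u + b + a) \<notin> K"
        using e(2)[of "s + a" "u + b + a"] that by auto
      then consider "u + b < s + \<eta>" | "s + l - \<eta> < u + b"
        using s by (auto simp: K_def)
      then show ?thesis
      proof cases
        case 1
        then show ?thesis using per u by (intro exI[of _ "u + b"]) auto
      next
        case 2
        then show ?thesis using per u by (intro exI[of _ "u + b - l"]) auto
      qed
    qed
    then show ?thesis using e(1) 1 by (intro exI[of _ e]) auto
  next
    case (2 l)
    then have "c11_arc \<gamma> D"
      using lp by (auto simp: link_param_def c11_circle_def)
    then have inj: "inj_on \<gamma> D" by (auto simp: c11_arc_def)
    define K where "K = (D \<times> D) \<inter> {p. \<eta> \<le> \<bar>snd p - fst p\<bar>}"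
    have "closed {p :: real \<times> real. \<eta> \<le> \<bar>snd p - fst p\<bar>}"
      by (intro closed_Collect_le continuous_intros)
    then have "compact K"
      unfolding K_def using 2 by (intro compact_Int_closed compact_Times) auto
    moreover have "\<gamma> s \<noteq> \<gamma> t" if "(s, t) \<in> K" for s t
      using that inj_on_eq_iff[OF inj, of s t] \<open>0 < \<eta>\<close> by (auto simp: K_def)
    ultimately obtain e where "0 < e" "\<And>s t. (s, t) \<in> K \<Longrightarrow> e \<le> dist (\<gamma> s) (\<gamma> t)"
      using pos[of K] by (metis K_def inf_le1)
    then have "\<bar>t - s\<bar> < \<eta>" if "s \<in> D" "t \<in> D" "dist (\<gamma> s) (\<gamma> t) < e" for s t
      using that by (force simp: K_def)
    then show ?thesis using \<open>0 < e\<close> by blast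
  qed
  then obtain e where "0 < e"
    "\<And>s y. s \<in> D \<Longrightarrow> y \<in> \<gamma> ` D \<Longrightarrow> dist (\<gamma> s) y < e \<Longrightarrow> \<exists>t\<in>D. \<gamma> t = y \<and> \<bar>t - s\<bar> < \<eta>"
    by blast
  moreover have "y \<in> \<gamma> ` D" if "s \<in> D" "y \<in> L" "dist (\<gamma> s) y < min d e" for s y
    using d(2)[of "\<gamma> s" y] that by simp
  ultimately show thesis
    by (intro that[of "min d e"]) (use d(1) in simp_all)
qed

section \<open>Tangent vectors\<close>

definition tangent_vectors :: "(real^3) set \<Rightarrow> real^3 \<Rightarrow> (real^3) set" where
  "tangent_vectors L x = {velocity \<gamma> D s | \<gamma> D s. link_param L \<gamma> D \<and> s \<in> D \<and> \<gamma> s = x}"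

text \<open>Velocities of parametrizations that continue forward from \<open>x\<close>: both unit
  tangents at an interior point, only the inward one at an end. Nearest points and the first
  variation lead to one-sided inequalities for these vectors, which treats both kinds of points
  alike.\<close>

definition inward_vectors :: "(real^3) set \<Rightarrow> real^3 \<Rightarrow> (real^3) set" where
  "inward_vectors L x = {velocity \<gamma> D s | \<gamma> D s.
     link_param L \<gamma> D \<and> s \<in> D \<and> \<gamma> s = x \<and> (\<exists>e>0. {s..s + e} \<subseteq> D)}"

lemma norm_orthogonal_part_le:
  fixes v w :: "'a::real_inner"
  assumes "norm v = 1"
  shows "norm (w - (w \<bullet> v) *\<^sub>R v) \<le> norm (w - k *\<^sub>R v)"
proof (rule power2_le_imp_le)
  have "v \<bullet> v = 1" using assms by (simp add: dot_square_norm)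
  then have "(norm (w - k *\<^sub>R v))\<^sup>2 - (norm (w - (w \<bullet> v) *\<^sub>R v))\<^sup>2 = (w \<bullet> v - k)\<^sup>2"
    unfolding power2_norm_eq_inner by (simp add: inner_diff inner_commute power2_eq_square algebra_simps)
  then show "(norm (w - (w \<bullet> v) *\<^sub>R v))\<^sup>2 \<le> (norm (w - k *\<^sub>R v))\<^sup>2"
    using zero_le_power2[of "w \<bullet> v - k"] by linarith
qed simp

text \<open>Once \<open>K * \<bar>t\<bar> \<le> 1\<close>, which is what \<open>\<eta>'\<close>
  ensures, the Taylor remainder is at most half of \<open>\<bar>t\<bar>\<close>; this bounds the
  parameter increment by twice the distance of the points.\<close>

lemma link_param_local:
  assumes "c11_link L" and lp: "link_param L \<gamma> D" and K: "K-lipschitz_on D (velocity \<gamma> D)"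
    and "0 < \<eta>"
  obtains \<delta> where "0 < \<delta>"
    "\<And>s y. s \<in> D \<Longrightarrow> y \<in> L \<Longrightarrow> dist (\<gamma> s) y < \<delta> \<Longrightarrow>
       \<exists>t. s + t \<in> D \<and> \<gamma> (s + t) = y \<and> \<bar>t\<bar> < \<eta> \<and> \<bar>t\<bar> \<le> 2 * norm (y - \<gamma> s) \<and>
         norm (y - \<gamma> s - t *\<^sub>R velocity \<gamma> D s) \<le> K * t\<^sup>2 / 2 \<and> K * t\<^sup>2 / 2 \<le> \<bar>t\<bar> / 2"
proof -
  have "0 \<le> K" using K by (rule lipschitz_on_nonneg)
  define \<eta>' where "\<eta>' = min \<eta> (1 / (K + 1))"
  have "0 < \<eta>'" using \<open>0 < \<eta>\<close> \<open>0 \<le> K\<close> by (simp add: \<eta>'_def)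
  then obtain \<delta> where \<delta>: "0 < \<delta>"
    "\<And>s y. s \<in> D \<Longrightarrow> y \<in> L \<Longrightarrow> dist (\<gamma> s) y < \<delta> \<Longrightarrow> \<exists>t\<in>D. \<gamma> t = y \<and> \<bar>t - s\<bar> < \<eta>'"
    using link_param_inverse[OF assms(1) lp] by blast
  show thesis
  proof (rule that[OF \<delta>(1)])
    fix s y assume s: "s \<in> D" and y: "y \<in> L" "dist (\<gamma> s) y < \<delta>"
    obtain r where r: "r \<in> D" "\<gamma> r = y" "\<bar>r - s\<bar> < \<eta>'" using \<delta>(2)[OF s y] by blast
    define t where "t = r - s"
    have t: "norm (y - \<gamma> s - t *\<^sub>R velocity \<gamma> D s) \<le> K * t\<^sup>2 / 2"
      using link_param_taylor[OF lp s r(1) K] by (simp add: r t_def)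
    have "K * \<bar>t\<bar> \<le> K * (1 / (K + 1))"
      using \<open>0 \<le> K\<close> r(3) by (intro mult_left_mono) (auto simp: t_def \<eta>'_def)
    also have "\<dots> \<le> 1" using \<open>0 \<le> K\<close> by (simp add: field_simps)
    finally have "K * \<bar>t\<bar> * \<bar>t\<bar> \<le> 1 * \<bar>t\<bar>" by (rule mult_right_mono) simp
    then have 1: "K * t\<^sup>2 / 2 \<le> \<bar>t\<bar> / 2" by (simp add: power2_eq_square mult.assoc)
    have "norm (t *\<^sub>R velocity \<gamma> D s) = \<bar>t\<bar>" using norm_velocity[OF lp s] by simp
    moreover have "norm (t *\<^sub>R velocity \<gamma> D s) \<le> norm (y - \<gamma> s) + norm (y - \<gamma> s - t *\<^sub>R velocity \<gamma> D s)"
      by (metis add_diff_cancel_left' diff_add_cancel norm_triangle_sub add.commute norm_minus_commute)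
    ultimately have "\<bar>t\<bar> \<le> 2 * norm (y - \<gamma> s)" using t 1 by linarith
    then show "\<exists>t. s + t \<in> D \<and> \<gamma> (s + t) = y \<and> \<bar>t\<bar> < \<eta> \<and> \<bar>t\<bar> \<le> 2 * norm (y - \<gamma> s) \<and>
         norm (y - \<gamma> s - t *\<^sub>R velocity \<gamma> D s) \<le> K * t\<^sup>2 / 2 \<and> K * t\<^sup>2 / 2 \<le> \<bar>t\<bar> / 2"
      using r t 1 by (intro exI[of _ t]) (auto simp: t_def \<eta>'_def)
  qed
qed

lemma link_param_germ:
  assumes lp: "link_param L \<gamma> D" and "s \<in> D"
  obtains \<sigma> e where "\<sigma> = 1 \<or> \<sigma> = -1" "0 < e" "\<And>t. 0 \<le> t \<Longrightarrow> t \<le> e \<Longrightarrow> s + \<sigma> * t \<in> D"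
proof (cases rule: link_param_domain[OF lp])
  case 1
  then show thesis using that[of 1 1] by simp
next
  case (2 l)
  show thesis
  proof (cases "s = 0")
    case True
    then show thesis using that[of 1 l] 2 by auto
  next
    case False
    then show thesis using that[of "-1" s] 2 \<open>s \<in> D\<close> by auto
  qed
qed

text \<open>A point reached along \<open>\<gamma>'\<close> after a short step
  \<open>\<epsilon>\<close> is also \<open>\<gamma> (s + t)\<close>. Comparing the two first-order
  expansions shows that \<open>\<epsilon>\<close> times \<open>?u\<close> differs from a multiple of
  \<open>?v\<close> by O(\<epsilon>^2), so the part \<open>p\<close> of \<open>?u\<close> orthogonal
  to \<open>?v\<close> is O(\<epsilon>) and vanishes.\<close>

lemma velocity_unique:
  assumes L: "c11_link L" and lp: "link_param L \<gamma> D" "s \<in> D" and lp': "link_param L \<gamma>' D'" "s' \<in> D'"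
    and eq: "\<gamma>' s' = \<gamma> s"
  shows "velocity \<gamma>' D' s' = velocity \<gamma> D s \<or> velocity \<gamma>' D' s' = - velocity \<gamma> D s"
proof -
  let ?v = "velocity \<gamma> D s" and ?u = "velocity \<gamma>' D' s'"
  obtain K where "0 \<le> K" and K: "K-lipschitz_on D (velocity \<gamma> D)" by (rule link_param_lipschitz[OF lp(1)])
  obtain K' where "0 \<le> K'" and K': "K'-lipschitz_on D' (velocity \<gamma>' D')" by (rule link_param_lipschitz[OF lp'(1)])
  obtain \<delta> where \<delta>: "0 < \<delta>" "\<And>s y. s \<in> D \<Longrightarrow> y \<in> L \<Longrightarrow> dist (\<gamma> s) y < \<delta> \<Longrightarrow>
       \<exists>t. s + t \<in> D \<and> \<gamma> (s + t) = y \<and> \<bar>t\<bar> < 1 \<and> \<bar>t\<bar> \<le> 2 * norm (y - \<gamma> s) \<and>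
         norm (y - \<gamma> s - t *\<^sub>R velocity \<gamma> D s) \<le> K * t\<^sup>2 / 2 \<and> K * t\<^sup>2 / 2 \<le> \<bar>t\<bar> / 2"
    by (rule link_param_local[OF L lp(1) K zero_less_one]) blast
  obtain \<sigma> e where \<sigma>: "\<sigma> = 1 \<or> \<sigma> = -1" and e: "0 < e" "\<And>t. 0 \<le> t \<Longrightarrow> t \<le> e \<Longrightarrow> s' + \<sigma> * t \<in> D'"
    using link_param_germ[OF lp'] by blast
  define p where "p = ?u - (?u \<bullet> ?v) *\<^sub>R ?v"
  \<comment> \<open>The first summand is the remainder of \<open>\<gamma>'\<close>; the second is
    the remainder \<open>K * t^2 / 2\<close> of \<open>\<gamma>\<close> with
    \<open>\<bar>t\<bar>\<close> at most \<open>2 * \<epsilon> * (1 + K' / 2)\<close>.\<close>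
  define B where "B = K' / 2 + 2 * K * (1 + K' / 2)\<^sup>2"
  have "0 \<le> B" using \<open>0 \<le> K\<close> \<open>0 \<le> K'\<close> by (simp add: B_def)
  have small: "norm p \<le> \<epsilon> * B" if \<epsilon>: "0 < \<epsilon>" "\<epsilon> \<le> e" "\<epsilon> \<le> 1" "\<epsilon> * (1 + K' / 2) < \<delta>" for \<epsilon>
  proof -
    define y where "y = \<gamma>' (s' + \<sigma> * \<epsilon>)"
    have D': "s' + \<sigma> * \<epsilon> \<in> D'" using e \<epsilon> by simp
    have "norm (y - \<gamma> s - (\<sigma> * \<epsilon>) *\<^sub>R ?u) \<le> K' * (\<sigma> * \<epsilon>)\<^sup>2 / 2"
      using link_param_taylor[OF lp' D' K'] by (simp add: y_def eq)
    also have "(\<sigma> * \<epsilon>)\<^sup>2 = \<epsilon>\<^sup>2" using \<sigma> by auto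
    finally have y: "norm (y - \<gamma> s - (\<sigma> * \<epsilon>) *\<^sub>R ?u) \<le> K' * \<epsilon>\<^sup>2 / 2" .
    have "norm (y - \<gamma> s) \<le> norm ((\<sigma> * \<epsilon>) *\<^sub>R ?u) + norm (y - \<gamma> s - (\<sigma> * \<epsilon>) *\<^sub>R ?u)"
      by (metis add.commute diff_add_cancel norm_triangle_ineq)
    also have "norm ((\<sigma> * \<epsilon>) *\<^sub>R ?u) = \<epsilon>"
      using \<sigma> \<epsilon> norm_velocity[OF lp'] by (auto simp: abs_mult)
    also have "norm (y - \<gamma> s - (\<sigma> * \<epsilon>) *\<^sub>R ?u) \<le> K' * (\<epsilon> * 1) / 2"
      using y mult_left_mono[of "\<epsilon> * \<epsilon>" "\<epsilon> * 1" "K' / 2"] \<epsilon> \<open>0 \<le> K'\<close>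
      by (simp add: power2_eq_square mult_left_le)
    finally have ny: "norm (y - \<gamma> s) \<le> \<epsilon> * (1 + K' / 2)" by (simp add: algebra_simps)
    then have "dist (\<gamma> s) y < \<delta>" using \<epsilon> by (simp add: dist_norm norm_minus_commute)
    then obtain t where t: "\<bar>t\<bar> \<le> 2 * norm (y - \<gamma> s)" "norm (y - \<gamma> s - t *\<^sub>R ?v) \<le> K * t\<^sup>2 / 2"
      using \<delta>(2)[OF lp(2), of y] link_param_image_subset[OF lp'(1) D'] unfolding y_def by blast
    have "\<bar>t\<bar> \<le> 2 * (\<epsilon> * (1 + K' / 2))" using t(1) ny by linarith
    then have "t\<^sup>2 \<le> (2 * (\<epsilon> * (1 + K' / 2)))\<^sup>2" by (metis abs_le_square_iff abs_ge_self order_trans)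
    then have "K * t\<^sup>2 / 2 \<le> K * (2 * (\<epsilon> * (1 + K' / 2)))\<^sup>2 / 2"
      using \<open>0 \<le> K\<close> by (intro divide_right_mono mult_left_mono) auto
    also have "\<dots> = \<epsilon> * (\<epsilon> * (2 * K * (1 + K' / 2)\<^sup>2))"
      by (simp add: power2_eq_square algebra_simps)
    finally have "norm (y - \<gamma> s - t *\<^sub>R ?v) \<le> \<epsilon> * (\<epsilon> * (2 * K * (1 + K' / 2)\<^sup>2))"
      using t(2) by linarith
    moreover have "norm ((\<sigma> * \<epsilon>) *\<^sub>R ?u - t *\<^sub>R ?v) \<le> norm (y - \<gamma> s - t *\<^sub>R ?v) + norm (y - \<gamma> s - (\<sigma> * \<epsilon>) *\<^sub>R ?u)"
      using norm_triangle_ineq4[of "y - \<gamma> s - t *\<^sub>R ?v" "y - \<gamma> s - (\<sigma> * \<epsilon>) *\<^sub>R ?u"] by simp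
    moreover have "norm ((\<sigma> * \<epsilon>) *\<^sub>R p) \<le> norm ((\<sigma> * \<epsilon>) *\<^sub>R ?u - t *\<^sub>R ?v)"
      using norm_orthogonal_part_le[OF norm_velocity[OF lp], of "(\<sigma> * \<epsilon>) *\<^sub>R ?u" t]
      by (simp add: p_def algebra_simps)
    moreover have "norm ((\<sigma> * \<epsilon>) *\<^sub>R p) = \<epsilon> * norm p"
      using \<sigma> \<epsilon> by (auto simp: abs_mult)
    ultimately have "\<epsilon> * norm p \<le> \<epsilon> * (\<epsilon> * (2 * K * (1 + K' / 2)\<^sup>2)) + K' * \<epsilon>\<^sup>2 / 2"
      using y by linarith
    also have "\<dots> = \<epsilon> * (\<epsilon> * B)"
      by (simp add: B_def distrib_left power2_eq_square)
    finally have "\<epsilon> * norm p \<le> \<epsilon> * (\<epsilon> * B)" .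
    then show ?thesis using \<epsilon>(1) by simp
  qed
  have "norm p \<le> 0"
  proof (rule field_le_epsilon)
    fix d :: real assume "0 < d"
    \<comment> \<open>The third entry keeps the step in the range \<open>\<delta>\<close> of the
      local inverse, the last one makes \<open>\<epsilon> * B\<close> at most
      \<open>d\<close>.\<close>
    define \<epsilon> where "\<epsilon> = Min {e, 1, \<delta> / (2 + K'), d / (B + 1)}"
    have \<epsilon>: "0 < \<epsilon>" "\<epsilon> \<le> e" "\<epsilon> \<le> 1" "\<epsilon> \<le> \<delta> / (2 + K')" "\<epsilon> \<le> d / (B + 1)"
      using e(1) \<delta>(1) \<open>0 < d\<close> \<open>0 \<le> B\<close> \<open>0 \<le> K'\<close> by (auto simp: \<epsilon>_def)
    have "\<epsilon> * (1 + K' / 2) \<le> \<delta> / (2 + K') * (1 + K' / 2)"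
      using \<epsilon>(4) \<open>0 \<le> K'\<close> by (intro mult_right_mono) auto
    also have "\<dots> = \<delta> / 2" using \<open>0 \<le> K'\<close> by (simp add: field_simps)
    also have "\<dots> < \<delta>" using \<delta>(1) by simp
    finally have "norm p \<le> \<epsilon> * B" using small \<epsilon> by blast
    also have "\<dots> \<le> d / (B + 1) * B" using \<epsilon>(5) \<open>0 \<le> B\<close> by (intro mult_right_mono) auto
    also have "\<dots> \<le> d" using \<open>0 < d\<close> \<open>0 \<le> B\<close> by (simp add: field_simps)
    finally show "norm p \<le> 0 + d" by simp
  qed
  then have u: "?u = (?u \<bullet> ?v) *\<^sub>R ?v" by (simp add: p_def)
  then have "1 = \<bar>?u \<bullet> ?v\<bar>"
    using norm_velocity[OF lp] norm_velocity[OF lp'] by (metis mult.right_neutral norm_scaleR)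
  then have "?u \<bullet> ?v = 1 \<or> ?u \<bullet> ?v = -1" by linarith
  then show ?thesis using u by (metis scaleR_minus1_left scaleR_one)
qed

lemma tangent_vectors_eq:
  assumes L: "c11_link L" and lp: "link_param L \<gamma> D" "s \<in> D"
  shows "tangent_vectors L (\<gamma> s) = {velocity \<gamma> D s, - velocity \<gamma> D s}"
proof -
  obtain a where a: "\<And>s. a - s \<in> D \<longleftrightarrow> s \<in> D" "link_param L (\<lambda>s. \<gamma> (a - s)) D"
    "\<And>s. s \<in> D \<Longrightarrow> velocity (\<lambda>s. \<gamma> (a - s)) D s = - velocity \<gamma> D (a - s)"
    by (rule link_param_reverse[OF lp(1)]) blast
  have "- velocity \<gamma> D s \<in> tangent_vectors L (\<gamma> s)"
    unfolding tangent_vectors_def mem_Collect_eq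
    by (intro exI[of _ "\<lambda>s. \<gamma> (a - s)"] exI[of _ D] exI[of _ "a - s"]) (use a lp in auto)
  then show ?thesis
    using velocity_unique[OF L lp] lp by (auto simp: tangent_vectors_def)
qed

lemma inward_vectors_interior:
  assumes L: "c11_link L" and "x \<in> L" "x \<notin> link_boundary L"
  shows "inward_vectors L x = tangent_vectors L x"
proof -
  obtain \<gamma> D s where lp: "link_param L \<gamma> D" "s \<in> D" "\<gamma> s = x"
    using link_param_exists[OF assms(1,2)] by blast
  obtain a where a: "\<And>s. a - s \<in> D \<longleftrightarrow> s \<in> D" "link_param L (\<lambda>s. \<gamma> (a - s)) D"
    "\<And>s. s \<in> D \<Longrightarrow> velocity (\<lambda>s. \<gamma> (a - s)) D s = - velocity \<gamma> D (a - s)"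
    by (rule link_param_reverse[OF lp(1)]) blast
  have in': "velocity \<gamma> D s \<in> inward_vectors L x" if lp: "link_param L \<gamma> D" "s \<in> D" "\<gamma> s = x" for \<gamma> D s
  proof -
    have "\<exists>e>0. {s..s + e} \<subseteq> D"
    proof (cases rule: link_param_domain[OF lp(1)])
      case 1
      then show ?thesis using zero_less_one by blast
    next
      case (2 l)
      then have "s \<noteq> l" using assms(3) lp by (auto simp: link_boundary_def)
      then show ?thesis using 2 lp(2) by (intro exI[of _ "l - s"]) auto
    qed
    then show ?thesis using lp unfolding inward_vectors_def by blast
  qed
  have "- velocity \<gamma> D s \<in> inward_vectors L x"
    using in'[OF a(2), of "a - s"] a(1,3) lp by simp
  then have "tangent_vectors L x \<subseteq> inward_vectors L x"
    using in'[OF lp] tangent_vectors_eq[OF L lp(1,2)] lp(3) by simp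
  then show ?thesis
    unfolding inward_vectors_def tangent_vectors_def by blast
qed

text \<open>A parametrization leaving the end with velocity \<open>- ?v\<close> would reach points
  \<open>y\<close> of \<open>L\<close> with negative inner product of \<open>y - \<gamma> 0\<close>
  and \<open>?v\<close>. But every point of \<open>L\<close> near the end is some
  \<open>\<gamma> t\<close> with \<open>t \<ge> 0\<close>, and its expansion makes that product at
  least \<open>t / 2\<close>.\<close>

lemma inward_vectors_boundary:
  assumes L: "c11_link L" and lp: "link_param L \<gamma> {0..l}" "0 < l"
  shows "inward_vectors L (\<gamma> 0) = {velocity \<gamma> {0..l} 0}"
proof -
  let ?v = "velocity \<gamma> {0..l} 0"
  have "0 \<in> {0..l}" using lp by simp
  have "?v \<in> inward_vectors L (\<gamma> 0)"
    unfolding inward_vectors_def using lp by fastforce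
  moreover have False if "- ?v \<in> inward_vectors L (\<gamma> 0)"
  proof -
    obtain \<gamma>' D' s' e where lp': "link_param L \<gamma>' D'" "s' \<in> D'" and e: "\<gamma>' s' = \<gamma> 0" "0 < e" "{s'..s' + e} \<subseteq> D'"
      and v: "velocity \<gamma>' D' s' = - ?v"
      using \<open>- ?v \<in> _\<close> unfolding inward_vectors_def by force
    obtain K where "0 \<le> K" and K: "K-lipschitz_on {0..l} (velocity \<gamma> {0..l})" by (rule link_param_lipschitz[OF lp(1)])
    obtain K' where "0 \<le> K'" and K': "K'-lipschitz_on D' (velocity \<gamma>' D')" by (rule link_param_lipschitz[OF lp'(1)])
    obtain \<delta> where \<delta>: "0 < \<delta>" "\<And>s y. s \<in> {0..l} \<Longrightarrow> y \<in> L \<Longrightarrow> dist (\<gamma> s) y < \<delta> \<Longrightarrow>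
         \<exists>t. s + t \<in> {0..l} \<and> \<gamma> (s + t) = y \<and> \<bar>t\<bar> < 1 \<and> \<bar>t\<bar> \<le> 2 * norm (y - \<gamma> s) \<and>
           norm (y - \<gamma> s - t *\<^sub>R velocity \<gamma> {0..l} s) \<le> K * t\<^sup>2 / 2 \<and> K * t\<^sup>2 / 2 \<le> \<bar>t\<bar> / 2"
      by (rule link_param_local[OF L lp(1) K zero_less_one]) blast
    define \<epsilon> where "\<epsilon> = Min {e, 1 / (K' + 1), \<delta> / 2}"
    have \<epsilon>: "0 < \<epsilon>" "\<epsilon> \<le> e" "\<epsilon> \<le> 1 / (K' + 1)" "\<epsilon> \<le> \<delta> / 2"
      using e(2) \<delta>(1) \<open>0 \<le> K'\<close> by (auto simp: \<epsilon>_def)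
    define y where "y = \<gamma>' (s' + \<epsilon>)"
    have D': "s' + \<epsilon> \<in> D'" using e(3) \<epsilon> by auto
    have "norm (y - \<gamma> 0 + \<epsilon> *\<^sub>R ?v) \<le> K' * \<epsilon>\<^sup>2 / 2"
      using link_param_taylor[OF lp' D' K'] by (simp add: y_def e(1) v)
    also have "\<dots> = (K' * \<epsilon>) * \<epsilon> / 2" by (simp add: power2_eq_square)
    also have "\<dots> \<le> \<epsilon> / 2"
    proof -
      have "K' * \<epsilon> \<le> K' * (1 / (K' + 1))" by (rule mult_left_mono[OF \<epsilon>(3) \<open>0 \<le> K'\<close>])
      also have "\<dots> \<le> 1" using \<open>0 \<le> K'\<close> by simp
      finally show ?thesis using \<epsilon>(1) by simp
    qed
    finally have y: "norm (y - \<gamma> 0 + \<epsilon> *\<^sub>R ?v) \<le> \<epsilon> / 2" .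
    have nv: "norm ?v = 1" using norm_velocity[OF lp(1)] lp(2) by simp
    have "norm (y - \<gamma> 0) \<le> norm (y - \<gamma> 0 + \<epsilon> *\<^sub>R ?v) + norm (\<epsilon> *\<^sub>R ?v)"
      by (metis add_diff_cancel_right' norm_triangle_ineq4)
    then have "norm (y - \<gamma> 0) < \<delta>" using y nv \<epsilon> \<delta>(1) by simp
    then obtain t where t: "t \<in> {0..l}" "norm (y - \<gamma> 0 - t *\<^sub>R ?v) \<le> \<bar>t\<bar> / 2"
      using \<delta>(2)[of 0 y] link_param_image_subset[OF lp'(1) D'] lp(2)
      by (fastforce simp: y_def dist_norm norm_minus_commute)
    have "\<bar>(y - \<gamma> 0 - t *\<^sub>R ?v) \<bullet> ?v\<bar> \<le> \<bar>t\<bar> / 2"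
      using Cauchy_Schwarz_ineq2[of "y - \<gamma> 0 - t *\<^sub>R ?v" ?v] t(2) nv by simp
    moreover have "\<bar>(y - \<gamma> 0 + \<epsilon> *\<^sub>R ?v) \<bullet> ?v\<bar> \<le> \<epsilon> / 2"
      using Cauchy_Schwarz_ineq2[of "y - \<gamma> 0 + \<epsilon> *\<^sub>R ?v" ?v] y nv by simp
    moreover have "?v \<bullet> ?v = 1" using nv by (simp add: dot_square_norm)
    ultimately have "\<bar>(y - \<gamma> 0) \<bullet> ?v - t\<bar> \<le> \<bar>t\<bar> / 2" "\<bar>(y - \<gamma> 0) \<bullet> ?v + \<epsilon>\<bar> \<le> \<epsilon> / 2"
      by (simp_all add: inner_diff_left[of "y - \<gamma> 0"] inner_add_left[of "y - \<gamma> 0"])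
    then show False using t(1) \<epsilon>(1) by (simp only: atLeastAtMost_iff) arith
  qed
  moreover have "inward_vectors L (\<gamma> 0) \<subseteq> {?v, - ?v}"
    using tangent_vectors_eq[OF L lp(1) \<open>0 \<in> {0..l}\<close>]
    unfolding inward_vectors_def tangent_vectors_def by blast
  ultimately show ?thesis by blast
qed

lemma link_boundary_start:
  assumes "c11_link L" "x \<in> link_boundary L"
  obtains \<gamma> l where "link_param L \<gamma> {0..l}" "0 < l" "\<gamma> 0 = x"
proof -
  obtain \<gamma> l where lp: "link_param L \<gamma> {0..l}" "x = \<gamma> 0 \<or> x = \<gamma> l"
    using assms(2) by (auto simp: link_boundary_def)
  have "0 < l" by (rule link_param_length_pos[OF lp(1)])
  show thesis
  proof (cases "x = \<gamma> 0")
    case False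
    obtain a where a: "\<And>l'. {0..l} = {0..l'} \<Longrightarrow> a = l'" "link_param L (\<lambda>s. \<gamma> (a - s)) {0..l}"
      by (rule link_param_reverse[OF lp(1)]) blast
    then show thesis using that[of "\<lambda>s. \<gamma> (a - s)" l] a(1)[of l] False lp(2) \<open>0 < l\<close> by auto
  qed (use that lp \<open>0 < l\<close> in blast)
qed

lemma link_boundary_subset:
  assumes "c11_link L"
  shows "link_boundary L \<subseteq> L"
proof
  fix x assume "x \<in> link_boundary L"
  then obtain \<gamma> l where "link_param L \<gamma> {0..l}" "0 < l" "\<gamma> 0 = x"
    using link_boundary_start[OF assms] by blast
  then show "x \<in> L" using link_param_image_subset[of L \<gamma> "{0..l}" 0] by auto
qed

section \<open>Penalized distances in terms of tangent vectors\<close>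

text \<open>
  For a unit vector \<open>v\<close> this is the squared distance of \<open>w\<close> from the line spanned by \<open>v\<close> if
  \<open>l = 1\<close>, and from the ray spanned by \<open>v\<close> if \<open>l = 0\<close>.
\<close>

definition offset_sq :: "real \<Rightarrow> 'a::real_inner \<Rightarrow> 'a \<Rightarrow> real" where
  "offset_sq l v w = (norm w)\<^sup>2 - (max (w \<bullet> v) (- l * (w \<bullet> v)))\<^sup>2"

lemma offset_sq_line: "offset_sq 1 v w = (norm w)\<^sup>2 - (w \<bullet> v)\<^sup>2"
  by (simp add: offset_sq_def max_def)

lemma offset_sq_ray: "offset_sq 0 v w = (if w \<bullet> v \<le> 0 then (norm w)\<^sup>2 else offset_sq 1 v w)"
  by (simp add: offset_sq_def max_def)

lemma offset_sq_orthogonal_part: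
  assumes "norm v = 1"
  shows "offset_sq 1 v w = (norm (w - (w \<bullet> v) *\<^sub>R v))\<^sup>2"
proof -
  have "v \<bullet> v = 1" using assms by (simp add: dot_square_norm)
  then show ?thesis
    unfolding offset_sq_line power2_norm_eq_inner
    by (simp add: inner_diff inner_commute power2_eq_square algebra_simps)
qed

lemma offset_sq_minus_line: "offset_sq 1 (- v) w = offset_sq 1 v w"
  by (simp add: offset_sq_line)

lemma offset_sq_nonneg:
  assumes "norm v = 1" "l = 0 \<or> l = 1"
  shows "0 \<le> offset_sq l v w"
  using assms by (auto simp: offset_sq_ray offset_sq_orthogonal_part)

lemma offset_sq_le: "offset_sq l v w \<le> (norm w)\<^sup>2"
  by (simp add: offset_sq_def)

lemma offset_sq_ray_ge: "offset_sq 1 v w \<le> offset_sq 0 v w"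
  by (simp add: offset_sq_ray offset_sq_le)

text \<open>The cosine of the angle to the normal plane or half-space is
  \<open>sqrt (offset_sq l v w) / norm w\<close>, so this is \<open>norm w\<close> times the squared
  secant.\<close>

definition penalized :: "real \<Rightarrow> real^3 \<Rightarrow> real^3 \<Rightarrow> ereal" where
  "penalized l v w = (if offset_sq l v w = 0 then \<infinity> else ereal ((norm w)^3 / offset_sq l v w))"

text \<open>\<open>arccos\<close> is decreasing, so the infimum of the angles belongs to the largest
  cosine, which is attained at \<open>p\<close>.\<close>

lemma cos_angle_to_set:
  fixes x y :: "real^3"
  assumes "x \<noteq> y"
    and ub: "\<And>p. p \<in> N \<Longrightarrow> p \<noteq> x \<Longrightarrow> (p - x) \<bullet> (y - x) \<le> m * (norm (p - x) * norm (y - x))"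
    and p: "p \<in> N" "p \<noteq> x" "(p - x) \<bullet> (y - x) = m * (norm (p - x) * norm (y - x))"
  shows "cos (angle_to_set x N y) = m"
proof -
  have q: "\<bar>(q - x) \<bullet> (y - x) / (norm (q - x) * norm (y - x))\<bar> \<le> 1" for q
    using Cauchy_Schwarz_ineq2[of "q - x" "y - x"]
    by (cases "q = x") (auto simp: divide_le_eq_1 assms(1)[symmetric])
  have pos: "0 < norm (q - x) * norm (y - x)" if "q \<noteq> x" for q
    using that assms(1) by simp
  have m: "m = (p - x) \<bullet> (y - x) / (norm (p - x) * norm (y - x))"
    using p assms(1) by simp
  then have "\<bar>m\<bar> \<le> 1" using q by simp
  have "angle_to_set x N y = arccos m"
    unfolding angle_to_set_def
  proof (rule cInf_eq_minimum)
    show "arccos m \<in> {vec_angle (p - x) (y - x) |p. p \<in> N \<and> p \<noteq> x}"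
      using p(1,2) m by (auto simp: vec_angle_def)
  next
    fix a assume "a \<in> {vec_angle (p - x) (y - x) |p. p \<in> N \<and> p \<noteq> x}"
    then obtain q where q': "q \<in> N" "q \<noteq> x" "a = vec_angle (q - x) (y - x)" by blast
    have "(q - x) \<bullet> (y - x) / (norm (q - x) * norm (y - x)) \<le> m"
      using ub[OF q'(1,2)] pos[OF q'(2)] by (simp add: divide_le_eq)
    then show "arccos m \<le> a"
      unfolding q'(3) vec_angle_def using q[of q, unfolded abs_le_iff] \<open>\<bar>m\<bar> \<le> 1\<close>
      by (intro arccos_le_arccos) linarith+
  qed
  then show ?thesis using \<open>\<bar>m\<bar> \<le> 1\<close> by (simp add: cos_arccos_abs)
qed

text \<open>The two conditions on \<open>N\<close> hold for the normal plane, and also for a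
  half-space bounded by it when \<open>y\<close> lies strictly outside. In both cases the projection
  of \<open>y - x\<close> to the plane is the closest direction.\<close>

lemma cos_angle_to_plane:
  fixes x y v :: "real^3"
  assumes "x \<noteq> y" "norm v = 1"
    and N: "\<And>p. (p - x) \<bullet> v = 0 \<Longrightarrow> p \<in> N"
    and ub: "\<And>p. p \<in> N \<Longrightarrow> (p - x) \<bullet> v * ((y - x) \<bullet> v) \<le> 0"
  shows "cos (angle_to_set x N y) = sqrt (offset_sq 1 v (y - x)) / norm (y - x)"
proof -
  define w where "w = y - x"
  define P where "P = w - (w \<bullet> v) *\<^sub>R v"
  have "w \<noteq> 0" using assms(1) by (simp add: w_def)
  have vv: "v \<bullet> v = 1" using assms(2) by (simp add: dot_square_norm)
  have Pv: "P \<bullet> v = 0" by (simp add: P_def inner_diff_left vv)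
  have w: "w = P + (w \<bullet> v) *\<^sub>R v" by (simp add: P_def)
  have nP: "sqrt (offset_sq 1 v w) = norm P"
    using assms(2) by (simp add: offset_sq_orthogonal_part P_def)
  obtain q :: "real^3" where q: "q \<noteq> 0" "orthogonal v q"
    using orthogonal_to_vector_exists[of v] by auto
  \<comment> \<open>If \<open>y - x\<close> is parallel to \<open>v\<close>, the projection vanishes
    and any direction in the plane attains the cosine 0.\<close>
  define d where "d = (if P = 0 then q else P)"
  have d: "d \<noteq> 0" "d \<bullet> v = 0" "d \<bullet> P = norm d * norm P"
    using q Pv by (auto simp: d_def orthogonal_def inner_commute dot_square_norm power2_eq_square)
  have dw: "d \<bullet> w = norm d * norm P"
    using d(2,3) by (subst w) (simp add: inner_add_right)
  have "cos (angle_to_set x N y) = norm P / norm w"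
  proof (rule cos_angle_to_set[OF assms(1), where p = "x + d"])
    show "x + d \<in> N" using d by (intro N) simp
    show "x + d \<noteq> x" using d by simp
    show "(x + d - x) \<bullet> (y - x) = norm P / norm w * (norm (x + d - x) * norm (y - x))"
      using dw \<open>w \<noteq> 0\<close> by (simp add: w_def[symmetric])
  next
    fix p assume "p \<in> N" "p \<noteq> x"
    have "(p - x) \<bullet> w = (p - x) \<bullet> P + (p - x) \<bullet> v * (w \<bullet> v)"
      by (subst w) (simp add: inner_add_right mult.commute)
    also have "\<dots> \<le> norm (p - x) * norm P"
      using ub[OF \<open>p \<in> N\<close>] norm_cauchy_schwarz[of "p - x" P] by (simp add: w_def)
    finally show "(p - x) \<bullet> (y - x) \<le> norm P / norm w * (norm (p - x) * norm (y - x))"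
      using \<open>w \<noteq> 0\<close> by (simp add: w_def[symmetric] mult.commute)
  qed
  then show ?thesis using nP by (simp add: w_def)
qed

lemma dist_sec_sq:
  fixes x y v :: "real^3"
  assumes "x \<noteq> y" "norm v = 1" "l = 0 \<or> l = 1"
    and "cos \<phi> = sqrt (offset_sq l v (y - x)) / norm (y - x)"
  shows "ereal (dist x y) * sec_sq \<phi> = penalized l v (y - x)"
proof -
  have w: "0 < norm (y - x)" "dist x y = norm (y - x)"
    using assms(1) by (auto simp: dist_norm norm_minus_commute)
  have Q: "0 \<le> offset_sq l v (y - x)" using assms by (intro offset_sq_nonneg)
  show ?thesis
  proof (cases "offset_sq l v (y - x) = 0")
    case True
    then show ?thesis using assms(4) w by (simp add: sec_sq_def penalized_def)
  next
    case False
    then have "cos \<phi> \<noteq> 0" "(cos \<phi>)\<^sup>2 = offset_sq l v (y - x) / (norm (y - x))\<^sup>2"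
      using assms(4) w Q by (auto simp: power_divide)
    then show ?thesis
      using False w by (simp add: sec_sq_def penalized_def power3_eq_cube power2_eq_square)
  qed
qed

section \<open>Normal planes and normal sets at interior points and at ends\<close>

lemma norm_tangent_vectors: "v \<in> tangent_vectors L x \<Longrightarrow> norm v = 1"
  using norm_velocity by (auto simp: tangent_vectors_def)

lemma inward_vectors_subset: "inward_vectors L x \<subseteq> tangent_vectors L x"
  by (auto simp: inward_vectors_def tangent_vectors_def)

lemma tangent_vectors_pm:
  assumes "c11_link L" "v \<in> tangent_vectors L x"
  shows "tangent_vectors L x = {v, - v}"
proof -
  obtain \<gamma> D s where "link_param L \<gamma> D" "s \<in> D" "\<gamma> s = x" "v = velocity \<gamma> D s"
    using assms(2) unfolding tangent_vectors_def by blast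
  then show ?thesis using tangent_vectors_eq[OF assms(1)] by metis
qed

lemma inward_vectors_singleton:
  assumes "c11_link L" "x \<in> link_boundary L"
  obtains u where "inward_vectors L x = {u}"
    "\<And>\<gamma> l. link_param L \<gamma> {0..l} \<Longrightarrow> \<gamma> 0 = x \<Longrightarrow> 0 < l \<Longrightarrow> velocity \<gamma> {0..l} 0 = u"
    "\<exists>\<gamma> l. link_param L \<gamma> {0..l} \<and> \<gamma> 0 = x \<and> 0 < l"
proof -
  obtain \<gamma> l where lp: "link_param L \<gamma> {0..l}" "0 < l" "\<gamma> 0 = x"
    using link_boundary_start[OF assms] by blast
  show thesis
  proof (rule that)
    show "inward_vectors L x = {velocity \<gamma> {0..l} 0}"
      using inward_vectors_boundary[OF assms(1) lp(1,2)] lp(3) by simp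
    then show "velocity \<gamma>' {0..l'} 0 = velocity \<gamma> {0..l} 0"
      if "link_param L \<gamma>' {0..l'}" "\<gamma>' 0 = x" "0 < l'" for \<gamma>' l'
      using inward_vectors_boundary[OF assms(1) that(1,3)] that(2) by simp
    show "\<exists>\<gamma> l. link_param L \<gamma> {0..l} \<and> \<gamma> 0 = x \<and> 0 < l" using lp by blast
  qed
qed

lemma ex_inward_vector:
  assumes "c11_link L" "x \<in> link_boundary L"
  shows "\<exists>u. inward_vectors L x = {u}"
  by (rule inward_vectors_singleton[OF assms]) (rule exI)

lemma normal_plane_eq:
  assumes "c11_link L" "v \<in> tangent_vectors L x"
  shows "normal_plane L x = {p. (p - x) \<bullet> v = 0}"
proof -
  have "normal_plane L x = {p. \<forall>u\<in>tangent_vectors L x. (p - x) \<bullet> u = 0}"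
    unfolding normal_plane_def tangent_vectors_def by blast
  then show ?thesis using tangent_vectors_pm[OF assms] by auto
qed

lemma normal_set_interior:
  assumes "c11_link L" "v \<in> tangent_vectors L x" "x \<notin> link_boundary L"
  shows "normal_set L x = {p. (p - x) \<bullet> v = 0}"
proof -
  have "tangent_set L x = {x + t *\<^sub>R u | t u. u \<in> tangent_vectors L x}"
    using assms(3) unfolding tangent_set_def tangent_vectors_def by (simp only: if_False) blast
  then have "normal_set L x = {p. \<forall>t. \<forall>u\<in>tangent_vectors L x. t * ((p - x) \<bullet> u) \<le> 0}"
  proof -
    assume eq: "tangent_set L x = {x + t *\<^sub>R u | t u. u \<in> tangent_vectors L x}"
    have "(\<forall>q\<in>tangent_set L x. (p - x) \<bullet> (q - x) \<le> 0) \<longleftrightarrow>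
        (\<forall>t. \<forall>u\<in>tangent_vectors L x. (p - x) \<bullet> (x + t *\<^sub>R u - x) \<le> 0)" for p
      unfolding eq by blast
    then show ?thesis by (simp add: normal_set_def)
  qed
  also have "\<dots> = {p. (p - x) \<bullet> v = 0}"
  proof -
    have "a = 0" if "\<And>t::real. t * a \<le> 0" for a
      using that[of a] by (metis mult_eq_0_iff not_real_square_gt_zero order_antisym zero_le_square)
    then show ?thesis using tangent_vectors_pm[OF assms(1,2)] by fastforce
  qed
  finally show ?thesis .
qed

lemma normal_set_boundary:
  assumes "c11_link L" "u \<in> inward_vectors L x" "x \<in> link_boundary L"
  shows "normal_set L x = {p. (p - x) \<bullet> u \<le> 0}"
proof -
  obtain u' where u': "inward_vectors L x = {u'}"
    "\<And>\<gamma> l. link_param L \<gamma> {0..l} \<Longrightarrow> \<gamma> 0 = x \<Longrightarrow> 0 < l \<Longrightarrow> velocity \<gamma> {0..l} 0 = u'"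
    "\<exists>\<gamma> l. link_param L \<gamma> {0..l} \<and> \<gamma> 0 = x \<and> 0 < l"
    using inward_vectors_singleton[OF assms(1,3)] by blast
  have "u' = u" using assms(2) u'(1) by simp
  note link_param_length_pos
  then have "tangent_set L x = {x + t *\<^sub>R u | t. 0 \<le> t}"
    using u'(2,3) assms(3) unfolding tangent_set_def \<open>u' = u\<close> by (simp only: if_True) blast
  then have "normal_set L x = {p. \<forall>t\<ge>0. t * ((p - x) \<bullet> u) \<le> 0}"
    unfolding normal_set_def by auto
  also have "\<dots> = {p. (p - x) \<bullet> u \<le> 0}"
    by (auto simp: mult_nonneg_nonpos dest: spec[of _ 1])
  finally show ?thesis .
qed

lemma pd_eq:
  assumes "c11_link L" "x \<noteq> y" "v \<in> tangent_vectors L x"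
  shows "pd L x y = penalized 1 v (y - x)"
proof -
  have v: "norm v = 1" by (rule norm_tangent_vectors[OF assms(3)])
  have "cos (psi L x y) = sqrt (offset_sq 1 v (y - x)) / norm (y - x)"
    unfolding psi_def normal_plane_eq[OF assms(1,3)]
    by (rule cos_angle_to_plane[OF assms(2) v]) auto
  then show ?thesis
    using dist_sec_sq[OF assms(2) v] assms(2) by (simp add: pd_def)
qed

lemma pd_star_interior:
  assumes "c11_link L" "x \<noteq> y" "x \<notin> link_boundary L"
  shows "v \<in> tangent_vectors L x \<Longrightarrow> pd_star L x y = penalized 1 v (y - x)"
proof -
  assume v: "v \<in> tangent_vectors L x"
  have "normal_set L x = normal_plane L x"
    using normal_set_interior[OF assms(1) v assms(3)] normal_plane_eq[OF assms(1) v] by simp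
  then have "pd_star L x y = pd L x y"
    by (simp add: pd_star_def pd_def psi_star_def psi_def)
  then show ?thesis using pd_eq[OF assms(1,2) v] by simp
qed

lemma pd_star_boundary:
  assumes "c11_link L" "x \<noteq> y" "x \<in> link_boundary L" "u \<in> inward_vectors L x"
  shows "pd_star L x y = penalized 0 u (y - x)"
proof -
  have u: "norm u = 1" using norm_tangent_vectors inward_vectors_subset assms(4) by blast
  have "cos (psi_star L x y) = sqrt (offset_sq 0 u (y - x)) / norm (y - x)"
  proof (cases "(y - x) \<bullet> u \<le> 0")
    case True
    have "cos (angle_to_set x {p. (p - x) \<bullet> u \<le> 0} y) = 1"
      by (rule cos_angle_to_set[OF assms(2), where p = y])
        (use True assms(2) norm_cauchy_schwarz in \<open>auto simp: dot_square_norm power2_eq_square\<close>)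
    then show ?thesis
      using True assms(2) by (simp add: psi_star_def normal_set_boundary[OF assms(1,4,3)] offset_sq_ray)
  next
    case False
    have "cos (angle_to_set x {p. (p - x) \<bullet> u \<le> 0} y) = sqrt (offset_sq 1 u (y - x)) / norm (y - x)"
      by (rule cos_angle_to_plane[OF assms(2) u]) (use False in \<open>auto simp: mult_le_0_iff\<close>)
    then show ?thesis
      using False by (simp add: psi_star_def normal_set_boundary[OF assms(1,4,3)] offset_sq_ray)
  qed
  then show ?thesis
    using dist_sec_sq[OF assms(2) u] assms(2) by (simp add: pd_star_def)
qed

section \<open>Curvature\<close>

lemma norm_derivative_le:
  fixes f :: "real \<Rightarrow> 'a::real_normed_vector"
  assumes "(f has_vector_derivative f') (at s within D)" "at s within D \<noteq> bot" "0 < d"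
    and B: "\<And>t. t \<in> D \<Longrightarrow> \<bar>t - s\<bar> < d \<Longrightarrow> norm (f t - f s) \<le> B * \<bar>t - s\<bar>"
  shows "norm f' \<le> B"
proof -
  have "((\<lambda>t. (1 / norm (t - s)) *\<^sub>R (f t - (f s + (t - s) *\<^sub>R f'))) \<longlongrightarrow> 0) (at s within D)"
    using assms(1) unfolding has_vector_derivative_def has_derivative_within by simp
  then have "((\<lambda>t. norm ((1 / norm (t - s)) *\<^sub>R (f t - (f s + (t - s) *\<^sub>R f'))) + B) \<longlongrightarrow> norm (0 :: 'a) + B) (at s within D)"
    by (intro tendsto_intros)
  then have lim: "((\<lambda>t. norm ((1 / norm (t - s)) *\<^sub>R (f t - (f s + (t - s) *\<^sub>R f'))) + B) \<longlongrightarrow> B) (at s within D)"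
    by simp
  show ?thesis
  proof (rule tendsto_lowerbound[OF lim _ assms(2)])
    show "\<forall>\<^sub>F t in at s within D. norm f' \<le> norm ((1 / norm (t - s)) *\<^sub>R (f t - (f s + (t - s) *\<^sub>R f'))) + B"
      unfolding eventually_at
    proof (intro exI[of _ d] conjI ballI impI \<open>0 < d\<close>)
      fix t assume t: "t \<in> D" "t \<noteq> s \<and> dist t s < d"
      have "norm ((t - s) *\<^sub>R f') \<le> norm (f t - (f s + (t - s) *\<^sub>R f')) + norm (f t - f s)"
        using norm_triangle_ineq4[of "f t - f s" "f t - (f s + (t - s) *\<^sub>R f')"] by simp
      also have "norm (f t - f s) \<le> B * \<bar>t - s\<bar>"
        using B t by (simp add: dist_real_def)
      finally have "\<bar>t - s\<bar> * norm f' \<le> norm (f t - (f s + (t - s) *\<^sub>R f')) + B * \<bar>t - s\<bar>" by simp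
      then have "norm f' \<le> norm (f t - (f s + (t - s) *\<^sub>R f')) / \<bar>t - s\<bar> + B"
        using t by (simp add: field_simps)
      then show "norm f' \<le> norm ((1 / norm (t - s)) *\<^sub>R (f t - (f s + (t - s) *\<^sub>R f'))) + B"
        by (simp only: norm_scaleR) simp
    qed
  qed
qed

lemma Osc_subset_Circ: "Osc L \<subseteq> Circ"
proof -
  have "\<kappa> \<bullet> velocity \<gamma> D s = 0"
    if lp: "link_param L \<gamma> D" "s \<in> D" and der: "(velocity \<gamma> D has_vector_derivative \<kappa>) (at s within D)" for \<gamma> D s \<kappa>
  proof -
    let ?T = "velocity \<gamma> D"
    have "((\<lambda>t. ?T t \<bullet> ?T t) has_vector_derivative (?T s \<bullet> \<kappa> + \<kappa> \<bullet> ?T s)) (at s within D)"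
      using der unfolding has_vector_derivative_def
      by (auto intro!: derivative_eq_intros simp: algebra_simps)
    moreover have "((\<lambda>t. ?T t \<bullet> ?T t) has_vector_derivative 0) (at s within D)"
      by (rule has_vector_derivative_transform[OF lp(2) _ has_vector_derivative_const[of 1]])
        (simp add: dot_square_norm norm_velocity[OF lp(1)])
    ultimately have "?T s \<bullet> \<kappa> + \<kappa> \<bullet> ?T s = 0"
      using vector_derivative_unique_within[OF link_param_not_bot[OF lp]] by blast
    then show ?thesis by (simp add: inner_commute)
  qed
  then show ?thesis by (auto simp: Osc_def Circ_def norm_velocity)
qed

text \<open>\<open>Circ\<close> is closed and contains \<open>Osc L\<close>, so the relative closure
  is the ordinary one.\<close>

lemma Osc_closure_eq: "Osc_closure L = closure (Osc L)"
proof -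
  have "Circ = {c. norm (fst (snd c)) = 1} \<inter> {c. snd (snd c) \<bullet> fst (snd c) = 0}"
    by (auto simp: Circ_def)
  moreover have "closed \<dots>"
    by (intro closed_Int closed_Collect_eq continuous_intros)
  ultimately have "closed Circ" by simp
  then have "closure (Osc L) \<subseteq> Circ"
    using Osc_subset_Circ by (rule closure_minimal[rotated])
  then show ?thesis
    using Osc_subset_Circ[of L] by (auto simp: Osc_closure_def closure_of_subtopology Int_absorb1)
qed

text \<open>\<open>Osc\<close> takes in every parametrization of a component, each with a Lipschitz
  constant of its own, while compactness needs one bound for all. The velocity of
  \<open>\<gamma>'\<close> is up to sign that of \<open>\<gamma>\<close> at the corresponding
  parameter, and the parameter increment \<open>t\<close> is at most twice the distance of the
  points, hence at most \<open>4 * \<bar>r - s'\<bar>\<close>.\<close>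

lemma second_derivative_bounded_by_component:
  assumes L: "c11_link L" and lp: "link_param L \<gamma> D" and K: "K-lipschitz_on D (velocity \<gamma> D)"
    and lp': "link_param L \<gamma>' D'" "s' \<in> D'" "\<gamma>' ` D' = \<gamma> ` D"
    and der: "(velocity \<gamma>' D' has_vector_derivative \<kappa>) (at s' within D')"
  shows "norm \<kappa> \<le> 4 * K"
proof -
  have "0 \<le> K" using K by (rule lipschitz_on_nonneg)
  obtain K' where "0 \<le> K'" and K': "K'-lipschitz_on D' (velocity \<gamma>' D')" by (rule link_param_lipschitz[OF lp'(1)])
  obtain s where s: "s \<in> D" "\<gamma> s = \<gamma>' s'" using lp'(2,3) by (metis imageE imageI)
  obtain \<delta> where \<delta>: "0 < \<delta>" "\<And>s y. s \<in> D \<Longrightarrow> y \<in> L \<Longrightarrow> dist (\<gamma> s) y < \<delta> \<Longrightarrow>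
       \<exists>t. s + t \<in> D \<and> \<gamma> (s + t) = y \<and> \<bar>t\<bar> < 1 \<and> \<bar>t\<bar> \<le> 2 * norm (y - \<gamma> s) \<and>
         norm (y - \<gamma> s - t *\<^sub>R velocity \<gamma> D s) \<le> K * t\<^sup>2 / 2 \<and> K * t\<^sup>2 / 2 \<le> \<bar>t\<bar> / 2"
    by (rule link_param_local[OF L lp K zero_less_one]) blast
  \<comment> \<open>The three bounds keep \<open>y\<close> in the range of the local inverse, make
    the velocity of \<open>\<gamma>'\<close> change by less than 1, and that of
    \<open>\<gamma>\<close> by at most 1.\<close>
  define d where "d = Min {\<delta> / 2, 1 / (2 * K' + 1), 1 / (4 * K + 1)}"
  have d: "0 < d" "d \<le> \<delta> / 2" "d \<le> 1 / (2 * K' + 1)" "d \<le> 1 / (4 * K + 1)"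
    using \<delta>(1) \<open>0 \<le> K\<close> \<open>0 \<le> K'\<close> by (auto simp: d_def)
  have le1: "k * d \<le> 1" if "0 \<le> k" "d \<le> 1 / (k + 1)" for k
  proof -
    have "k * d \<le> k * (1 / (k + 1))" using that by (intro mult_left_mono)
    also have "\<dots> \<le> 1" using that by simp
    finally show ?thesis .
  qed
  have K'd: "2 * K' * d \<le> 1" and Kd: "4 * K * d \<le> 1"
    using le1[of "2 * K'"] le1[of "4 * K"] d \<open>0 \<le> K\<close> \<open>0 \<le> K'\<close> by auto
  show ?thesis
  proof (rule norm_derivative_le[OF der link_param_not_bot[OF lp'(1,2)] \<open>0 < d\<close>])
    fix r assume r: "r \<in> D'" "\<bar>r - s'\<bar> < d"
    let ?e = "\<bar>r - s'\<bar>"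
    define y where "y = \<gamma>' r"
    have "norm (y - \<gamma> s - (r - s') *\<^sub>R velocity \<gamma>' D' s') \<le> K' * (r - s')\<^sup>2 / 2"
      using link_param_taylor[OF lp'(1,2) r(1) K'] by (simp add: y_def s(2))
    also have "\<dots> = (K' * ?e) * ?e / 2" by (simp add: power2_eq_square)
    also have "\<dots> \<le> 1 * ?e / 2"
    proof -
      have "K' * ?e \<le> K' * d" using r \<open>0 \<le> K'\<close> by (intro mult_left_mono) auto
      also have "\<dots> \<le> 1" using K'd \<open>0 \<le> K'\<close> d(1) mult_nonneg_nonneg[of K' d] by linarith
      finally show ?thesis by (intro divide_right_mono mult_right_mono) auto
    qed
    finally have "norm (y - \<gamma> s - (r - s') *\<^sub>R velocity \<gamma>' D' s') \<le> ?e / 2" by simp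
    moreover have "norm ((r - s') *\<^sub>R velocity \<gamma>' D' s') = ?e"
      using norm_velocity[OF lp'(1,2)] by simp
    moreover have "norm (y - \<gamma> s) \<le> norm (y - \<gamma> s - (r - s') *\<^sub>R velocity \<gamma>' D' s') + norm ((r - s') *\<^sub>R velocity \<gamma>' D' s')"
      by (metis diff_add_cancel norm_triangle_ineq)
    ultimately have "norm (y - \<gamma> s) \<le> ?e / 2 + ?e" by (metis add_right_mono order_trans)
    also have "\<dots> \<le> 2 * ?e" by simp
    finally have ny: "norm (y - \<gamma> s) \<le> 2 * ?e" .
    then have "dist (\<gamma> s) y < \<delta>" using r d(2) by (simp add: dist_norm norm_minus_commute)
    then obtain t where t: "s + t \<in> D" "\<gamma> (s + t) = y" "\<bar>t\<bar> \<le> 2 * norm (y - \<gamma> s)"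
      using \<delta>(2)[OF s(1), of y] link_param_image_subset[OF lp'(1) r(1)] unfolding y_def by blast
    have te: "\<bar>t\<bar> \<le> 4 * ?e" using t(3) ny by linarith
    have "norm (velocity \<gamma> D (s + t) - velocity \<gamma> D s) \<le> K * \<bar>t\<bar>"
      using lipschitz_onD[OF K t(1) s(1)] by (simp add: dist_norm)
    also have "\<dots> \<le> K * (4 * ?e)" using te \<open>0 \<le> K\<close> by (intro mult_left_mono)
    finally have v: "norm (velocity \<gamma> D (s + t) - velocity \<gamma> D s) \<le> 4 * K * ?e" by simp
    have "4 * K * ?e \<le> 4 * K * d" using r \<open>0 \<le> K\<close> by (intro mult_left_mono) auto
    then have v1: "norm (velocity \<gamma> D (s + t) - velocity \<gamma> D s) \<le> 1" using v Kd by linarith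
    have "norm (velocity \<gamma>' D' r - velocity \<gamma>' D' s') \<le> K' * ?e"
      using lipschitz_onD[OF K' r(1) lp'(2)] by (simp add: dist_norm)
    also have "\<dots> \<le> K' * d" using r \<open>0 \<le> K'\<close> by (intro mult_left_mono) auto
    finally have u1: "norm (velocity \<gamma>' D' r - velocity \<gamma>' D' s') < 1" using K'd by linarith
    have two: "norm (velocity \<gamma> D s + velocity \<gamma> D s) = 2"
      using norm_velocity[OF lp s(1)] by (metis norm_scaleR scaleR_2 abs_numeral mult.right_neutral)
    \<comment> \<open>If the sign relating the two velocities changed between \<open>s'\<close> and
      \<open>r\<close>, the velocity of \<open>\<gamma>'\<close> would change by at least 1, against
      \<open>u1\<close>.\<close>
    have opp: "1 \<le> norm (velocity \<gamma> D (s + t) + velocity \<gamma> D s)"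
      using v1 two norm_triangle_ineq4[of "velocity \<gamma> D (s + t) + velocity \<gamma> D s" "velocity \<gamma> D (s + t) - velocity \<gamma> D s"]
      by simp
    have vr: "velocity \<gamma>' D' r = velocity \<gamma> D (s + t) \<or> velocity \<gamma>' D' r = - velocity \<gamma> D (s + t)"
      by (rule velocity_unique[OF L lp t(1) lp'(1) r(1)]) (simp add: t(2) y_def)
    have "velocity \<gamma>' D' s' = velocity \<gamma> D s \<or> velocity \<gamma>' D' s' = - velocity \<gamma> D s"
      by (rule velocity_unique[OF L lp s(1) lp'(1,2)]) (simp add: s(2))
    then have "norm (velocity \<gamma>' D' r - velocity \<gamma>' D' s') = norm (velocity \<gamma> D (s + t) - velocity \<gamma> D s) \<or>
        norm (velocity \<gamma>' D' r - velocity \<gamma>' D' s') = norm (velocity \<gamma> D (s + t) + velocity \<gamma> D s)"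
    proof -
      have "norm (- b - d) = norm (b + d)" for b d :: "real^3"
        using norm_minus_cancel[of "b + d"] by simp
      then show ?thesis
        using vr \<open>velocity \<gamma>' D' s' = velocity \<gamma> D s \<or> _\<close> by (elim disjE) (simp_all add: norm_minus_commute)
    qed
    then show "norm (velocity \<gamma>' D' r - velocity \<gamma>' D' s') \<le> 4 * K * \<bar>r - s'\<bar>"
      using u1 opp v by linarith
  qed
qed

text \<open>Base points lie in the compact \<open>L\<close>, tangents on the unit sphere, and
  curvature vectors in a ball, by a uniform bound on each of the finitely many components. This is
  what makes the minima in \<open>curv_radius\<close> and \<open>min_curv_radius\<close>
  attained.\<close>

lemma Osc_closure_compact:
  assumes L: "c11_link L"
  shows "compact (Osc_closure L)" "fst ` Osc_closure L \<subseteq> L"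
proof -
  let ?P = "\<lambda>C B. \<forall>\<gamma> D s \<kappa>. link_param L \<gamma> D \<longrightarrow> \<gamma> ` D = C \<longrightarrow> s \<in> D \<longrightarrow>
       (velocity \<gamma> D has_vector_derivative \<kappa>) (at s within D) \<longrightarrow> norm \<kappa> \<le> B"
  have "\<forall>C\<in>components L. \<exists>B. ?P C B"
  proof
    fix C assume C: "C \<in> components L"
    obtain \<gamma> D where "c11_arc \<gamma> D \<or> c11_circle \<gamma> D" "\<gamma> ` D = C"
      using L C unfolding c11_link_def by blast
    then have lp: "link_param L \<gamma> D" using C by (auto simp: link_param_def)
    obtain K where K: "K-lipschitz_on D (velocity \<gamma> D)" by (rule link_param_lipschitz[OF lp])
    have "?P C (4 * K)"
      using second_derivative_bounded_by_component[OF L lp K] unfolding \<open>\<gamma> ` D = C\<close>[symmetric]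
      by (intro allI impI)
    then show "\<exists>B. ?P C B" by (rule exI)
  qed
  from bchoice[OF this] obtain B where B: "\<forall>C\<in>components L. ?P C (B C)" by (rule exE)
  have fin: "finite (components L)" using L by (simp add: c11_link_def)
  define B0 where "B0 = Max (insert 0 (B ` components L))"
  have sub: "Osc L \<subseteq> L \<times> sphere 0 1 \<times> cball 0 B0"
  proof
    fix c assume "c \<in> Osc L"
    then obtain \<gamma> D s \<kappa> where c: "c = (\<gamma> s, velocity \<gamma> D s, \<kappa>)" and lp: "link_param L \<gamma> D" "s \<in> D"
      and der: "(velocity \<gamma> D has_vector_derivative \<kappa>) (at s within D)" by (auto simp: Osc_def)
    have C: "\<gamma> ` D \<in> components L" using lp by (simp add: link_param_def)
    then have "norm \<kappa> \<le> B (\<gamma> ` D)" using B lp der by blast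
    also have "\<dots> \<le> B0" unfolding B0_def using fin C by (intro Max_ge) auto
    finally show "c \<in> L \<times> sphere 0 1 \<times> cball 0 B0"
      using c lp link_param_image_subset norm_velocity by simp
  qed
  have cpt: "compact (L \<times> sphere (0::real^3) 1 \<times> cball (0::real^3) B0)"
    by (intro compact_Times link_compact[OF L] compact_sphere compact_cball)
  then have sub': "Osc_closure L \<subseteq> L \<times> sphere 0 1 \<times> cball 0 B0"
    unfolding Osc_closure_eq using sub by (intro closure_minimal compact_imp_closed)
  then show "fst ` Osc_closure L \<subseteq> L" by auto
  show "compact (Osc_closure L)"
    using compact_Int_closed[OF cpt closed_closure[of "Osc L"]] sub' unfolding Osc_closure_eq
    by (simp add: Int_absorb1)
qed

lemma minimum_eqI:
  assumes "m \<in> S" "\<And>x. x \<in> S \<Longrightarrow> m \<le> x"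
  shows "minimum S = m"
  unfolding minimum_def using assms by (auto intro!: Least_equality)

definition radius :: "real \<Rightarrow> ereal" where
  "radius k = (if k = 0 then \<infinity> else ereal (1 / k))"

lemma radius_antimono: "0 \<le> k \<Longrightarrow> k \<le> k' \<Longrightarrow> radius k' \<le> radius k"
  by (auto simp: radius_def frac_le)

lemma circ_radius_eq: "circ_radius c = radius (norm (snd (snd c)))"
  by (cases c) (simp add: circ_radius_def radius_def)

text \<open>\<open>c\<close> is the largest curvature in the compact closure, and its base point
  realizes both nested minima. If the closure is empty, all radii are \<infinity> and
  \<open>c = 0\<close>.\<close>

lemma min_curv_radius_eq:
  assumes L: "c11_link L"
  shows "\<exists>c\<ge>0. min_curv_radius L = radius c \<and> (\<forall>(p, T, \<kappa>)\<in>Osc L. norm \<kappa> \<le> c)"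
proof -
  let ?M = "Osc_closure L" and ?k = "\<lambda>c :: (real^3) \<times> (real^3) \<times> (real^3). norm (snd (snd c))"
  have Osc: "Osc L \<subseteq> ?M" unfolding Osc_closure_eq by (rule closure_subset)
  have att: "\<exists>c\<in>A. \<forall>c'\<in>A. ?k c' \<le> ?k c" if "A \<noteq> {}" "compact A" for A
    by (rule continuous_attains_sup[OF that(2,1)]) (intro continuous_intros)
  have cmin: "circ_radius c \<le> circ_radius c'" if "?k c' \<le> ?k c" for c c'
    unfolding circ_radius_eq using that by (intro radius_antimono) auto
  have fib: "curv_radius L x = circ_radius c" if "c \<in> ?M" "fst c = x" "\<forall>c'\<in>?M. fst c' = x \<longrightarrow> ?k c' \<le> ?k c" for x c
    unfolding curv_radius_def
  proof (rule minimum_eqI)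
    show "circ_radius c \<in> {circ_radius c |c. c \<in> ?M \<and> fst c = x}" using that(1,2) by blast
    fix r assume "r \<in> {circ_radius c |c. c \<in> ?M \<and> fst c = x}"
    then show "circ_radius c \<le> r" using that(3) cmin by blast
  qed
  show ?thesis
  proof (cases "?M = {}")
    case True
    have "curv_radius L x = \<infinity>" for x by (simp add: curv_radius_def minimum_def True)
    then have "min_curv_radius L = \<infinity>"
      unfolding min_curv_radius_def by (cases "L = {}") (auto simp: minimum_def intro!: Least_equality)
    then show ?thesis using True Osc by (intro exI[of _ 0]) (simp add: radius_def)
  next
    case False
    obtain c where c: "c \<in> ?M" "\<forall>c'\<in>?M. ?k c' \<le> ?k c"
      using att[OF False Osc_closure_compact(1)[OF L]] by blast
    have "min_curv_radius L = circ_radius c"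
      unfolding min_curv_radius_def
    proof (rule minimum_eqI)
      have "fst c \<in> L" using Osc_closure_compact(2)[OF L] c(1) by blast
      then show "circ_radius c \<in> curv_radius L ` L" using fib[OF c(1)] c(2) by (metis imageI)
    next
      fix r assume "r \<in> curv_radius L ` L"
      then obtain x where x: "r = curv_radius L x" by blast
      let ?A = "?M \<inter> {c. fst c = x}"
      have "closed {c :: (real^3) \<times> (real^3) \<times> (real^3). fst c = x}"
        by (intro closed_Collect_eq continuous_intros)
      then have "compact ?A" by (intro compact_Int_closed Osc_closure_compact[OF L])
      show "circ_radius c \<le> r"
      proof (cases "?A = {}")
        case True
        then have "r = \<infinity>" unfolding x curv_radius_def minimum_def by auto
        then show ?thesis by simp
      next
        case False
        obtain c' where "c' \<in> ?A" "\<forall>c''\<in>?A. ?k c'' \<le> ?k c'" using att[OF False \<open>compact ?A\<close>] by blast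
        then have "r = circ_radius c'" "c' \<in> ?M" using fib[of c' x] x by auto
        then show ?thesis using cmin c(2) by blast
      qed
    qed
    moreover have "norm \<kappa> \<le> ?k c" if "(p, T, \<kappa>) \<in> Osc L" for p T \<kappa>
    proof -
      have "(p, T, \<kappa>) \<in> ?M" using Osc that by blast
      from c(2)[rule_format, OF this] show ?thesis by simp
    qed
    ultimately show ?thesis
      by (intro exI[of _ "?k c"]) (auto simp: circ_radius_eq)
  qed
qed

text \<open>Wherever the velocity has a derivative inside a parameter interval, this derivative is a
  curvature vector in \<open>Osc L\<close>; the mean value inequality asks for no more.\<close>

lemma velocity_lipschitz:
  assumes c: "0 \<le> c" "\<And>p T \<kappa>. (p, T, \<kappa>) \<in> Osc L \<Longrightarrow> norm \<kappa> \<le> c" and lp: "link_param L \<gamma> D"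
  shows "c-lipschitz_on D (velocity \<gamma> D)"
proof -
  obtain K where K: "K-lipschitz_on D (velocity \<gamma> D)" by (rule link_param_lipschitz[OF lp])
  have le: "norm (velocity \<gamma> D t - velocity \<gamma> D s) \<le> c * (t - s)" if st: "s \<in> D" "t \<in> D" "s \<le> t" for s t
  proof (rule lipschitz_norm_diff_le[OF _ st(3) c(1)])
    have sub: "{s..t} \<subseteq> D" using link_param_segment[OF lp st(1,2)] by auto
    show "K-lipschitz_on {s..t} (velocity \<gamma> D)" by (rule lipschitz_on_subset[OF K sub])
    fix x \<kappa> assume x: "x \<in> {s<..<t}" and der: "(velocity \<gamma> D has_vector_derivative \<kappa>) (at x)"
    have "x \<in> D" using sub x by auto
    then have "(\<gamma> x, velocity \<gamma> D x, \<kappa>) \<in> Osc L"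
      using lp has_vector_derivative_at_within[OF der] unfolding Osc_def by blast
    then show "norm \<kappa> \<le> c" by (rule c(2))
  qed
  show ?thesis
  proof (rule lipschitz_onI[OF _ c(1)])
    fix s t assume st: "s \<in> D" "t \<in> D"
    show "dist (velocity \<gamma> D s) (velocity \<gamma> D t) \<le> c * dist s t"
      using le[OF st] le[OF st(2,1)]
      by (cases "s \<le> t") (auto simp: dist_norm norm_minus_commute)
  qed
qed

section \<open>Behaviour near the diagonal\<close>

text \<open>A frame consists of the parameter \<open>l\<close> of \<open>offset_sq\<close>, a base
  point and a unit vector. The vector is part of the data, with both signs, because no orientation
  is chosen. Ends are included to keep the set closed.\<close>

definition line_frames :: "(real^3) set \<Rightarrow> (real \<times> (real^3) \<times> (real^3)) set" where
  "line_frames L = {(1, x, v) | x v. x \<in> L \<and> v \<in> tangent_vectors L x}"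

definition ray_frames :: "(real^3) set \<Rightarrow> (real \<times> (real^3) \<times> (real^3)) set" where
  "ray_frames L = {(0, x, u) | x u. x \<in> link_boundary L \<and> u \<in> inward_vectors L x}"

text \<open>If an end were an inner parameter value of some parametrization, the parametrization and
  its reversal would both continue from there, and both tangent vectors would be inward; at an end
  there is only one inward vector.\<close>

lemma link_boundary_param:
  assumes L: "c11_link L" and x: "x \<in> link_boundary L" and lp: "link_param L \<gamma> D" "s \<in> D" "\<gamma> s = x"
  shows "\<exists>l. D = {0..l} \<and> (s = 0 \<or> s = l)"
proof (rule ccontr)
  assume not: "\<not> (\<exists>l. D = {0..l} \<and> (s = 0 \<or> s = l))"
  obtain a where a: "\<And>s. a - s \<in> D \<longleftrightarrow> s \<in> D" "\<And>l. D = {0..l} \<Longrightarrow> a = l" "link_param L (\<lambda>s. \<gamma> (a - s)) D"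
    "\<And>s. s \<in> D \<Longrightarrow> velocity (\<lambda>s. \<gamma> (a - s)) D s = - velocity \<gamma> D (a - s)"
    by (rule link_param_reverse[OF lp(1)]) blast
  have germs: "(\<exists>e>0. {s..s + e} \<subseteq> D) \<and> (\<exists>e>0. {a - s..a - s + e} \<subseteq> D)"
  proof (cases rule: link_param_domain[OF lp(1)])
    case 1
    then show ?thesis using zero_less_one by blast
  next
    case (2 l)
    then have "s \<noteq> 0" "s \<noteq> l" using not by blast+
    then have s: "0 < s" "s < l" using lp(2) 2 by auto
    have "{s..s + (l - s)} \<subseteq> D" "{a - s..a - s + s} \<subseteq> D" using s 2 a(2)[of l] by auto
    then show ?thesis using s by (intro conjI exI[of _ "l - s"] exI[of _ s]) auto
  qed
  have "velocity \<gamma> D s \<in> inward_vectors L x"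
    unfolding inward_vectors_def using lp germs by blast
  moreover have "- velocity \<gamma> D s \<in> inward_vectors L x"
    unfolding inward_vectors_def mem_Collect_eq
    by (intro exI[of _ "\<lambda>s. \<gamma> (a - s)"] exI[of _ D] exI[of _ "a - s"]) (use a lp germs in auto)
  moreover obtain u where "inward_vectors L x = {u}"
    using ex_inward_vector[OF L x] by blast
  ultimately have "velocity \<gamma> D s + velocity \<gamma> D s = 0" by (simp add: eq_neg_iff_add_eq_0)
  then have "velocity \<gamma> D s = 0" by (simp flip: scaleR_2)
  then show False using norm_velocity[OF lp(1,2)] by simp
qed

lemma finite_link_boundary:
  assumes L: "c11_link L"
  shows "finite (link_boundary L)"
proof -
  have "finite (link_boundary L \<inter> C)" if C0: "C \<in> components L" for C
  proof -
    obtain \<gamma> D where "c11_arc \<gamma> D \<or> c11_circle \<gamma> D" and C: "\<gamma> ` D = C"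
      using L C0 unfolding c11_link_def by blast
    then have lp: "link_param L \<gamma> D" using C0 by (auto simp: link_param_def)
    \<comment> \<open>\<open>Sup D\<close> is the far end \<open>l\<close> of an arc; for a circle,
      \<open>link_boundary_param\<close> leaves no boundary points.\<close>
    have "link_boundary L \<inter> C \<subseteq> {\<gamma> 0, \<gamma> (Sup D)}"
    proof
      fix x assume x: "x \<in> link_boundary L \<inter> C"
      then obtain s where s: "s \<in> D" "\<gamma> s = x" using C by blast
      then obtain l where "D = {0..l}" "s = 0 \<or> s = l"
        using link_boundary_param[OF L _ lp, of x s] x by blast
      then show "x \<in> {\<gamma> 0, \<gamma> (Sup D)}" using s by auto
    qed
    then show ?thesis by (rule finite_subset) simp
  qed
  moreover have "finite (components L)" using L by (simp add: c11_link_def)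
  ultimately have "finite (\<Union>C\<in>components L. link_boundary L \<inter> C)" by blast
  moreover have "link_boundary L \<subseteq> (\<Union>C\<in>components L. link_boundary L \<inter> C)"
    using link_boundary_subset[OF L] Union_components[of L] by blast
  ultimately show ?thesis by (rule finite_subset[rotated])
qed

text \<open>On each component these frames are the images of a compact parameter set under two
  continuous maps, one for each sign.\<close>

lemma compact_line_frames:
  assumes L: "c11_link L"
  shows "compact (line_frames L)"
proof -
  let ?F = "\<lambda>C. {(1::real, x, v) | x v. x \<in> C \<and> v \<in> tangent_vectors L x}"
  have "compact (?F C)" if C0: "C \<in> components L" for C
  proof -
    obtain \<gamma> D where "c11_arc \<gamma> D \<or> c11_circle \<gamma> D" and C: "\<gamma> ` D = C"
      using L C0 unfolding c11_link_def by blast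
    then have lp: "link_param L \<gamma> D" using C0 by (auto simp: link_param_def)
    obtain I where I: "compact I" "I \<subseteq> D" "\<And>s. s \<in> D \<Longrightarrow> \<exists>r\<in>I. \<gamma> r = \<gamma> s \<and> velocity \<gamma> D r = velocity \<gamma> D s"
      by (rule link_param_fundamental_domain[OF lp]) blast
    obtain K where K: "K-lipschitz_on D (velocity \<gamma> D)" by (rule link_param_lipschitz[OF lp])
    let ?f = "\<lambda>s. (1::real, \<gamma> s, velocity \<gamma> D s)" and ?g = "\<lambda>s. (1::real, \<gamma> s, - velocity \<gamma> D s)"
    have cont: "continuous_on I \<gamma>" "continuous_on I (velocity \<gamma> D)"
      using continuous_on_subset[OF link_param_continuous[OF lp] I(2)]
        continuous_on_subset[OF lipschitz_on_continuous_on[OF K] I(2)] by auto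
    have "compact (?f ` I \<union> ?g ` I)"
      by (intro compact_Un compact_continuous_image continuous_intros cont I(1))
    moreover have "?F C = ?f ` I \<union> ?g ` I"
    proof
      show "?f ` I \<union> ?g ` I \<subseteq> ?F C"
      proof -
        have "?f s \<in> ?F C \<and> ?g s \<in> ?F C" if "s \<in> I" for s
        proof -
          have "s \<in> D" using that I(2) by blast
          moreover from this have "\<gamma> s \<in> C" using C by blast
          ultimately show ?thesis using tangent_vectors_eq[OF L lp, of s] by simp
        qed
        then show ?thesis by blast
      qed
      show "?F C \<subseteq> ?f ` I \<union> ?g ` I"
      proof
        fix z assume "z \<in> ?F C"
        then obtain x v where z: "z = (1, x, v)" "x \<in> C" "v \<in> tangent_vectors L x" by blast
        obtain s where s: "s \<in> D" "\<gamma> s = x" using z(2) C by blast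
        obtain r where r: "r \<in> I" "\<gamma> r = \<gamma> s" "velocity \<gamma> D r = velocity \<gamma> D s" using I(3)[OF s(1)] by blast
        have "v \<in> {velocity \<gamma> D r, - velocity \<gamma> D r}"
          using tangent_vectors_eq[OF L lp s(1)] z(3) s(2) r(3) by simp
        then have "z = ?f r \<or> z = ?g r" using z(1) s(2) r(2) by auto
        then show "z \<in> ?f ` I \<union> ?g ` I" using r(1) by blast
      qed
    qed
    ultimately show ?thesis by simp
  qed
  moreover have "finite (components L)" using L by (simp add: c11_link_def)
  ultimately have "compact (\<Union>C\<in>components L. ?F C)" by (intro compact_UN) auto
  moreover have "line_frames L = (\<Union>C\<in>components L. ?F C)"
    using Union_components[of L] unfolding line_frames_def by blast
  ultimately show ?thesis by simp
qed

lemma compact_ray_frames: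
  assumes L: "c11_link L"
  shows "compact (ray_frames L)"
proof -
  have "ray_frames L = (\<Union>x\<in>link_boundary L. (\<lambda>u. (0, x, u)) ` inward_vectors L x)"
    unfolding ray_frames_def by blast
  moreover have "finite (inward_vectors L x)" if "x \<in> link_boundary L" for x
    using ex_inward_vector[OF L that] by auto
  ultimately have "finite (ray_frames L)" using finite_link_boundary[OF L] by simp
  then show ?thesis by (rule finite_imp_compact)
qed

lemma frames_props:
  assumes "(l, x, v) \<in> line_frames L \<union> ray_frames L" "c11_link L"
  shows "l = 0 \<or> l = 1" "x \<in> L" "v \<in> tangent_vectors L x" "norm v = 1"
  using assms link_boundary_subset[of L] inward_vectors_subset[of L x] norm_tangent_vectors[of v L x]
  by (auto simp: line_frames_def ray_frames_def)

text \<open>A property of all points at distance less than \<open>\<delta>\<close> is written as a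
  property of all \<open>d < \<delta>\<close>; the thresholds of finitely many components or ends
  then combine by their minimum, whatever \<open>P\<close> is.\<close>

lemma finite_uniform_delta:
  assumes "finite A" "\<And>a. a \<in> A \<Longrightarrow> \<exists>\<delta>>0. \<forall>d<\<delta>. P a d"
  shows "\<exists>\<delta>>(0::real). \<forall>a\<in>A. \<forall>d<\<delta>. P a d"
  using assms
proof (induction rule: finite_induct)
  case empty
  then show ?case by (intro exI[of _ 1]) simp
next
  case (insert a A)
  obtain \<delta>1 where "0 < \<delta>1" "\<forall>a\<in>A. \<forall>d<\<delta>1. P a d" using insert by auto
  moreover obtain \<delta>2 where "0 < \<delta>2" "\<forall>d<\<delta>2. P a d" using insert.prems by blast
  ultimately show ?case by (intro exI[of _ "min \<delta>1 \<delta>2"]) auto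
qed

text \<open>
  The ratio of \<^term>\<open>offset_sq l v (y - x)\<close> to \<open>|y - x|^4\<close> is \<open>1 / (2 r)^2\<close> for the radius \<open>r\<close> of
  the circle through \<open>y\<close> that is tangent at \<open>x\<close>; near the diagonal \<open>r\<close> is almost bounded below by
  the radius of curvature \<open>1 / c\<close>.
\<close>

lemma offset_sq_near_line:
  assumes L: "c11_link L" and c: "0 \<le> c" "\<And>\<gamma> D. link_param L \<gamma> D \<Longrightarrow> c-lipschitz_on D (velocity \<gamma> D)"
    and "0 < \<epsilon>"
  shows "\<exists>\<delta>>0. \<forall>x\<in>L. \<forall>v\<in>tangent_vectors L x. \<forall>y\<in>L. dist x y < \<delta> \<longrightarrow>
     offset_sq 1 v (y - x) \<le> (c\<^sup>2 / 4 + \<epsilon>) * norm (y - x) ^ 4"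
proof -
  define B where "B = c\<^sup>2 / 4 + \<epsilon>"
  \<comment> \<open>The chord can be shorter than \<open>\<bar>t\<bar>\<close> by the factor
    \<open>1 - c * \<eta> / 2\<close>. As \<open>B\<close> exceeds \<open>c^2 / 4\<close>, this loss
    is affordable once the range \<open>\<eta>\<close> of parameters is small.\<close>
  have "((\<lambda>\<eta>. B * (1 - c * \<eta> / 2) ^ 4) \<longlongrightarrow> B * (1 - c * 0 / 2) ^ 4) (at_right 0)"
    by (intro tendsto_intros) simp_all
  then have "eventually (\<lambda>\<eta>. c\<^sup>2 / 4 < B * (1 - c * \<eta> / 2) ^ 4) (at_right 0)"
    by (rule order_tendstoD) (use \<open>0 < \<epsilon>\<close> in \<open>simp add: B_def\<close>)
  moreover have "((\<lambda>\<eta>. c * \<eta> / 2) \<longlongrightarrow> c * 0 / 2) (at_right 0)"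
    by (intro tendsto_intros) simp_all
  then have "eventually (\<lambda>\<eta>. c * \<eta> / 2 < 1) (at_right 0)"
    by (rule order_tendstoD) simp
  moreover have "eventually (\<lambda>\<eta>::real. 0 < \<eta>) (at_right 0)"
    by (simp add: eventually_at_right_less)
  ultimately have "eventually (\<lambda>\<eta>. c\<^sup>2 / 4 < B * (1 - c * \<eta> / 2) ^ 4 \<and> c * \<eta> / 2 < 1 \<and> 0 < \<eta>) (at_right 0)"
    by eventually_elim simp
  then have "\<exists>\<eta>. c\<^sup>2 / 4 < B * (1 - c * \<eta> / 2) ^ 4 \<and> c * \<eta> / 2 < 1 \<and> 0 < \<eta>"
    by (rule eventually_happens'[rotated]) simp
  then obtain \<eta> where \<eta>: "c\<^sup>2 / 4 < B * (1 - c * \<eta> / 2) ^ 4" "c * \<eta> / 2 < 1" "0 < \<eta>" by blast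
  have "0 \<le> B" using \<open>0 < \<epsilon>\<close> by (simp add: B_def)
  have "\<exists>\<delta>>0. \<forall>d<\<delta>. \<forall>x y v. x \<in> C \<longrightarrow> v \<in> tangent_vectors L x \<longrightarrow> y \<in> L \<longrightarrow> dist x y = d \<longrightarrow>
      offset_sq 1 v (y - x) \<le> B * norm (y - x) ^ 4" if C0: "C \<in> components L" for C
  proof -
    obtain \<gamma> D where "c11_arc \<gamma> D \<or> c11_circle \<gamma> D" and C: "\<gamma> ` D = C"
      using L C0 unfolding c11_link_def by blast
    then have lp: "link_param L \<gamma> D" using C0 by (auto simp: link_param_def)
    obtain \<delta> where \<delta>: "0 < \<delta>" "\<And>s y. s \<in> D \<Longrightarrow> y \<in> L \<Longrightarrow> dist (\<gamma> s) y < \<delta> \<Longrightarrow>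
         \<exists>t. s + t \<in> D \<and> \<gamma> (s + t) = y \<and> \<bar>t\<bar> < \<eta> \<and> \<bar>t\<bar> \<le> 2 * norm (y - \<gamma> s) \<and>
           norm (y - \<gamma> s - t *\<^sub>R velocity \<gamma> D s) \<le> c * t\<^sup>2 / 2 \<and> c * t\<^sup>2 / 2 \<le> \<bar>t\<bar> / 2"
      by (rule link_param_local[OF L lp c(2)[OF lp] \<eta>(3)]) blast
    have "offset_sq 1 v (y - x) \<le> B * norm (y - x) ^ 4"
      if xy: "x \<in> C" "v \<in> tangent_vectors L x" "y \<in> L" "dist x y < \<delta>" for x y v
    proof -
      obtain s where s: "s \<in> D" "\<gamma> s = x" using xy(1) C by blast
      let ?T = "velocity \<gamma> D s" and ?w = "y - x"
      obtain t where t: "\<bar>t\<bar> < \<eta>" "norm (?w - t *\<^sub>R ?T) \<le> c * t\<^sup>2 / 2"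
        using \<delta>(2)[OF s(1) xy(3)] xy(4) s(2) by blast
      have nT: "norm ?T = 1" by (rule norm_velocity[OF lp s(1)])
      have "v = ?T \<or> v = - ?T" using tangent_vectors_eq[OF L lp s(1)] xy(2) s(2) by auto
      then have "offset_sq 1 v ?w = (norm (?w - (?w \<bullet> ?T) *\<^sub>R ?T))\<^sup>2"
        using offset_sq_orthogonal_part[OF nT] offset_sq_minus_line by metis
      \<comment> \<open>The distance from the tangent line is at most the distance from the
        first-order approximation on it, which Taylor's estimate bounds by
        \<open>c * t^2 / 2\<close>.\<close>
      also have "\<dots> \<le> (norm (?w - t *\<^sub>R ?T))\<^sup>2"
        using norm_orthogonal_part_le[OF nT] by (intro power_mono) auto
      also have "\<dots> \<le> (c * t\<^sup>2 / 2)\<^sup>2"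
        using t(2) by (intro power_mono) auto
      also have "\<dots> = c\<^sup>2 / 4 * \<bar>t\<bar> ^ 4" by (simp add: power2_eq_square power4_eq_xxxx)
      also have "\<dots> \<le> (B * (1 - c * \<eta> / 2) ^ 4) * \<bar>t\<bar> ^ 4"
        using \<eta>(1) by (intro mult_right_mono) auto
      also have "\<dots> = B * (\<bar>t\<bar> * (1 - c * \<eta> / 2)) ^ 4"
        by (simp add: power_mult_distrib mult.commute mult.left_commute)
      also have "\<dots> \<le> B * norm ?w ^ 4"
      proof (intro mult_left_mono power_mono \<open>0 \<le> B\<close>)
        have "norm (t *\<^sub>R ?T) \<le> norm ?w + norm (?w - t *\<^sub>R ?T)"
          using norm_triangle_ineq4[of ?w "?w - t *\<^sub>R ?T"] by simp
        then have "\<bar>t\<bar> - c * t\<^sup>2 / 2 \<le> norm ?w" using t(2) nT by simp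
        moreover have "c * \<bar>t\<bar> * \<bar>t\<bar> \<le> c * \<eta> * \<bar>t\<bar>"
          using t(1) c(1) by (intro mult_right_mono mult_left_mono) auto
        ultimately show "\<bar>t\<bar> * (1 - c * \<eta> / 2) \<le> norm ?w"
          by (simp add: algebra_simps power2_eq_square)
        show "0 \<le> \<bar>t\<bar> * (1 - c * \<eta> / 2)" using \<eta>(2) by simp
      qed
      finally show ?thesis .
    qed
    then show ?thesis using \<delta>(1) by blast
  qed
  moreover have "finite (components L)" using L by (simp add: c11_link_def)
  ultimately obtain \<delta> where \<delta>: "0 < \<delta>" "\<forall>C\<in>components L. \<forall>d<\<delta>. \<forall>x y v. x \<in> C \<longrightarrow> v \<in> tangent_vectors L x \<longrightarrow> y \<in> L \<longrightarrow>
      dist x y = d \<longrightarrow> offset_sq 1 v (y - x) \<le> B * norm (y - x) ^ 4"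
    using finite_uniform_delta[of "components L" "\<lambda>C d. \<forall>x y v. x \<in> C \<longrightarrow> v \<in> tangent_vectors L x \<longrightarrow> y \<in> L \<longrightarrow>
      dist x y = d \<longrightarrow> offset_sq 1 v (y - x) \<le> B * norm (y - x) ^ 4"] by blast
  show ?thesis
  proof (intro exI[of _ \<delta>] conjI ballI impI \<delta>(1))
    fix x v y assume *: "x \<in> L" "v \<in> tangent_vectors L x" "y \<in> L" "dist x y < \<delta>"
    then obtain C where "C \<in> components L" "x \<in> C" using Union_components[of L] by blast
    then show "offset_sq 1 v (y - x) \<le> (c\<^sup>2 / 4 + \<epsilon>) * norm (y - x) ^ 4"
      using \<delta>(2) * unfolding B_def by blast
  qed
qed

text \<open>Near an end, \<open>L\<close> consists of points \<open>\<gamma> t\<close> with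
  \<open>t \<ge> 0\<close>, whose displacement is \<open>t\<close> times the inward vector up to
  \<open>t / 2\<close>. So close to the diagonal the ray and the line give the same
  \<open>offset_sq\<close>.\<close>

lemma ray_near_line:
  assumes L: "c11_link L" and x: "x \<in> link_boundary L"
  shows "\<exists>\<delta>>0. \<forall>d<\<delta>. \<forall>u y. u \<in> inward_vectors L x \<longrightarrow> y \<in> L \<longrightarrow> dist x y = d \<longrightarrow> 0 \<le> (y - x) \<bullet> u"
proof -
  obtain \<gamma> l where lp: "link_param L \<gamma> {0..l}" "0 < l" "\<gamma> 0 = x"
    by (rule link_boundary_start[OF L x])
  let ?u = "velocity \<gamma> {0..l} 0"
  have nu: "norm ?u = 1" using norm_velocity[OF lp(1)] lp(2) by simp
  obtain K where K: "K-lipschitz_on {0..l} (velocity \<gamma> {0..l})" by (rule link_param_lipschitz[OF lp(1)])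
  obtain \<delta> where \<delta>: "0 < \<delta>" "\<And>s y. s \<in> {0..l} \<Longrightarrow> y \<in> L \<Longrightarrow> dist (\<gamma> s) y < \<delta> \<Longrightarrow>
       \<exists>t. s + t \<in> {0..l} \<and> \<gamma> (s + t) = y \<and> \<bar>t\<bar> < 1 \<and> \<bar>t\<bar> \<le> 2 * norm (y - \<gamma> s) \<and>
         norm (y - \<gamma> s - t *\<^sub>R velocity \<gamma> {0..l} s) \<le> K * t\<^sup>2 / 2 \<and> K * t\<^sup>2 / 2 \<le> \<bar>t\<bar> / 2"
    by (rule link_param_local[OF L lp(1) K zero_less_one]) blast
  have "0 \<le> (y - x) \<bullet> ?u" if y: "y \<in> L" "dist x y < \<delta>" for y
  proof -
    obtain t where t: "0 + t \<in> {0..l}" "norm (y - x - t *\<^sub>R ?u) \<le> K * t\<^sup>2 / 2" "K * t\<^sup>2 / 2 \<le> \<bar>t\<bar> / 2"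
      using \<delta>(2)[of 0 y] y lp(2,3) by auto
    have "\<bar>(y - x - t *\<^sub>R ?u) \<bullet> ?u\<bar> \<le> norm (y - x - t *\<^sub>R ?u) * norm ?u"
      by (rule Cauchy_Schwarz_ineq2)
    also have "\<dots> \<le> \<bar>t\<bar> / 2" using t(2,3) nu by simp
    finally have "\<bar>(y - x - t *\<^sub>R ?u) \<bullet> ?u\<bar> \<le> \<bar>t\<bar> / 2" .
    moreover have "(y - x - t *\<^sub>R ?u) \<bullet> ?u = (y - x) \<bullet> ?u - t"
      using nu by (simp add: inner_diff_left[of "y - x"] dot_square_norm)
    ultimately have "\<bar>(y - x) \<bullet> ?u - t\<bar> \<le> \<bar>t\<bar> / 2" "0 \<le> t" using t(1) by simp_all
    then show ?thesis by arith
  qed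
  then show ?thesis
    using \<delta>(1) inward_vectors_boundary[OF L lp(1,2)] lp(3) by auto
qed

lemma offset_sq_near:
  assumes L: "c11_link L" and c: "0 \<le> c" "\<And>\<gamma> D. link_param L \<gamma> D \<Longrightarrow> c-lipschitz_on D (velocity \<gamma> D)"
    and "0 < \<epsilon>"
  shows "\<exists>\<delta>>0. \<forall>(l, x, v)\<in>line_frames L \<union> ray_frames L. \<forall>y\<in>L. dist x y < \<delta> \<longrightarrow>
     offset_sq l v (y - x) \<le> (c\<^sup>2 / 4 + \<epsilon>) * norm (y - x) ^ 4"
proof -
  obtain \<delta>1 where \<delta>1: "0 < \<delta>1" "\<forall>x\<in>L. \<forall>v\<in>tangent_vectors L x. \<forall>y\<in>L. dist x y < \<delta>1 \<longrightarrow>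
     offset_sq 1 v (y - x) \<le> (c\<^sup>2 / 4 + \<epsilon>) * norm (y - x) ^ 4"
    using offset_sq_near_line[OF assms] by blast
  obtain \<delta>2 where \<delta>2: "0 < \<delta>2" "\<forall>x\<in>link_boundary L. \<forall>d<\<delta>2. \<forall>u y. u \<in> inward_vectors L x \<longrightarrow> y \<in> L \<longrightarrow>
      dist x y = d \<longrightarrow> 0 \<le> (y - x) \<bullet> u"
    using finite_uniform_delta[OF finite_link_boundary[OF L], where P = "\<lambda>x d. \<forall>u y.
      u \<in> inward_vectors L x \<longrightarrow> y \<in> L \<longrightarrow> dist x y = d \<longrightarrow> 0 \<le> (y - x) \<bullet> u"] ray_near_line[OF L] by blast
  have "offset_sq l v (y - x) \<le> (c\<^sup>2 / 4 + \<epsilon>) * norm (y - x) ^ 4"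
    if fr: "(l, x, v) \<in> line_frames L \<union> ray_frames L" and y: "y \<in> L" "dist x y < min \<delta>1 \<delta>2" for l x v y
  proof -
    have "offset_sq l v (y - x) = offset_sq 1 v (y - x)"
    proof (cases "(l, x, v) \<in> line_frames L")
      case False
      then have *: "l = 0" "x \<in> link_boundary L" "v \<in> inward_vectors L x"
        using fr by (auto simp: ray_frames_def)
      have "dist x y < \<delta>2" using y(2) by simp
      then have "0 \<le> (y - x) \<bullet> v" using \<delta>2(2) * y(1) by blast
      then show ?thesis using \<open>l = 0\<close> by (auto simp: offset_sq_ray offset_sq_line)
    qed (auto simp: line_frames_def)
    then show ?thesis
      using \<delta>1(2) y frames_props[OF fr L] by simp
  qed
  then show ?thesis
    using \<delta>1(1) \<delta>2(1) by (intro exI[of _ "min \<delta>1 \<delta>2"]) auto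
qed

text \<open>The ratio need not extend continuously to the diagonal, but near it stays below
  \<open>b + \<epsilon>\<close>. A value above \<open>b\<close> thus confines the competition to
  pairs at distance at least \<open>\<delta>\<close>, a compact set. It serves F with
  \<open>n = 4\<close> and \<open>b = c^2 / 4\<close>, and the penalized distances with
  \<open>n = 3\<close> and \<open>b = 0\<close>.\<close>

lemma maximum_off_diagonal:
  fixes X :: "(real \<times> (real^3) \<times> (real^3)) set"
  assumes "compact X" "compact L"
    and near: "\<And>\<epsilon>. 0 < \<epsilon> \<Longrightarrow> \<exists>\<delta>>0. \<forall>(l, x, v)\<in>X. \<forall>y\<in>L. x \<noteq> y \<longrightarrow> dist x y < \<delta> \<longrightarrow>
       offset_sq l v (y - x) / norm (y - x) ^ n \<le> b + \<epsilon>"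
    and z0: "(l0, x0, v0) \<in> X" "y0 \<in> L" "x0 \<noteq> y0" "b < offset_sq l0 v0 (y0 - x0) / norm (y0 - x0) ^ n"
  shows "\<exists>(l, x, v)\<in>X. \<exists>y\<in>L. x \<noteq> y \<and> b < offset_sq l v (y - x) / norm (y - x) ^ n \<and>
    (\<forall>(l', x', v')\<in>X. \<forall>y'\<in>L. x' \<noteq> y' \<longrightarrow>
       offset_sq l' v' (y' - x') / norm (y' - x') ^ n \<le> offset_sq l v (y - x) / norm (y - x) ^ n)"
proof -
  let ?f = "\<lambda>p :: (real \<times> (real^3) \<times> (real^3)) \<times> (real^3).
    offset_sq (fst (fst p)) (snd (snd (fst p))) (snd p - fst (snd (fst p))) / norm (snd p - fst (snd (fst p))) ^ n"
  let ?m = "offset_sq l0 v0 (y0 - x0) / norm (y0 - x0) ^ n"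
  \<comment> \<open>Half of the excess over \<open>b\<close>, so that the bound near the diagonal
    stays strictly below the value at the given pair.\<close>
  define \<epsilon> where "\<epsilon> = (?m - b) / 2"
  have "0 < \<epsilon>" using z0(4) by (simp add: \<epsilon>_def)
  then obtain \<delta> where \<delta>: "0 < \<delta>" "\<forall>(l, x, v)\<in>X. \<forall>y\<in>L. x \<noteq> y \<longrightarrow> dist x y < \<delta> \<longrightarrow>
       offset_sq l v (y - x) / norm (y - x) ^ n \<le> b + \<epsilon>"
    using near by blast
  have lt: "b + \<epsilon> < ?m" using \<open>0 < \<epsilon>\<close> by (simp add: \<epsilon>_def field_simps)
  let ?K = "(X \<times> L) \<inter> {p. \<delta> \<le> dist (fst (snd (fst p))) (snd p)}"
  have "closed {p :: (real \<times> (real^3) \<times> (real^3)) \<times> (real^3). \<delta> \<le> dist (fst (snd (fst p))) (snd p)}"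
    by (intro closed_Collect_le continuous_intros)
  then have "compact ?K" by (intro compact_Int_closed compact_Times assms)
  moreover have "((l0, x0, v0), y0) \<in> ?K"
    using \<delta>(2) z0 lt by force
  moreover have "continuous_on ?K ?f"
    unfolding offset_sq_def using \<delta>(1) by (intro continuous_intros) auto
  ultimately obtain p where p: "p \<in> ?K" "\<And>q. q \<in> ?K \<Longrightarrow> ?f q \<le> ?f p"
    using continuous_attains_sup[of ?K ?f] by blast
  obtain l x v y where pe: "p = ((l, x, v), y)" by (cases p) auto
  have ge: "?m \<le> offset_sq l v (y - x) / norm (y - x) ^ n"
    using p(2)[OF \<open>((l0, x0, v0), y0) \<in> ?K\<close>] by (simp add: pe)
  have "offset_sq l' v' (y' - x') / norm (y' - x') ^ n \<le> offset_sq l v (y - x) / norm (y - x) ^ n"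
    if q: "(l', x', v') \<in> X" "y' \<in> L" "x' \<noteq> y'" for l' x' v' y'
  proof (cases "dist x' y' < \<delta>")
    case True
    then have "offset_sq l' v' (y' - x') / norm (y' - x') ^ n \<le> b + \<epsilon>" using \<delta>(2) q by blast
    then show ?thesis using lt ge by linarith
  next
    case False
    then show ?thesis using p(2)[of "((l', x', v'), y')"] q by (simp add: pe)
  qed
  moreover have "(l, x, v) \<in> X" "y \<in> L" "x \<noteq> y" using p(1) \<delta>(1) by (auto simp: pe)
  moreover have "b < offset_sq l v (y - x) / norm (y - x) ^ n" using ge z0(4) by linarith
  ultimately show ?thesis by blast
qed

section \<open>Reach and critical pairs\<close>

text \<open>
  First variation: while the ratio exceeds \<open>c\<^sup>2 / 4\<close>, moving \<open>x\<close> towards \<open>y\<close> along the curve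
  increases it.
\<close>

lemma no_ascent:
  assumes lp: "link_param L \<gamma> D" "s \<in> D" and e: "0 < e" "{s..s + e} \<subseteq> D"
    and c: "c-lipschitz_on D (velocity \<gamma> D)"
    and q: "q = offset_sq 1 (velocity \<gamma> D s) (y - \<gamma> s) / norm (y - \<gamma> s) ^ 4" "c\<^sup>2 / 4 < q"
    and max: "\<And>r. r \<in> D \<Longrightarrow> \<gamma> r \<noteq> y \<Longrightarrow> offset_sq 1 (velocity \<gamma> D r) (y - \<gamma> r) / norm (y - \<gamma> r) ^ 4 \<le> q"
    and "\<gamma> s \<noteq> y"
  shows "(y - \<gamma> s) \<bullet> velocity \<gamma> D s \<le> 0"
proof (rule ccontr)
  define u where "u = velocity \<gamma> D s"
  define w where "w = y - \<gamma> s"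
  define a where "a = (norm w)\<^sup>2"
  define b where "b = w \<bullet> u"
  define P where "P = w - b *\<^sub>R u"
  define h where "h = norm P"
  assume "\<not> (y - \<gamma> s) \<bullet> velocity \<gamma> D s \<le> 0"
  then have "0 < b" by (simp add: b_def w_def u_def)
  have "0 \<le> c" using c by (rule lipschitz_on_nonneg)
  have "0 < a" using \<open>\<gamma> s \<noteq> y\<close> by (simp add: a_def w_def)
  have nu: "norm u = 1" unfolding u_def by (rule norm_velocity[OF lp])
  then have uu: "u \<bullet> u = 1" by (simp add: dot_square_norm)
  have h2: "h\<^sup>2 = a - b\<^sup>2"
    using offset_sq_orthogonal_part[OF nu, of w] by (simp add: h_def P_def a_def b_def offset_sq_line)
  have q_eq: "q = h\<^sup>2 / a\<^sup>2"
    unfolding q(1) h2 offset_sq_line by (simp add: a_def b_def u_def w_def power_mult[symmetric])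
  \<comment> \<open>As F = a / (2 h), this says c F < 1, which fixes the sign of the first
    variation.\<close>
  have "(c * a)\<^sup>2 < (2 * h)\<^sup>2"
    using q(2) \<open>0 < a\<close> unfolding q_eq by (simp add: field_simps power_mult_distrib)
  then have cah: "c * a < 2 * h" by (rule power2_less_imp_less) (simp add: h_def)
  then have "0 < h" using \<open>0 \<le> c\<close> \<open>0 < a\<close> mult_nonneg_nonneg[of c a] by linarith
  \<comment> \<open>The velocity need not be differentiable at \<open>s\<close>, so the first
    variation is replaced by polynomial bounds: after a step \<open>t\<close>, the squared distance
    lies between \<open>A1 t\<close> and \<open>A2 t\<close>, and
    \<open>w' \<bullet> u' \<le> B t\<close>, with the second-order errors collected in
    \<open>M\<close>. Maximality would make \<open>\<phi> t\<close> nonnegative, whereas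
    \<open>\<phi>\<close> vanishes at 0 and has negative derivative there.\<close>
  define M where "M = 1 + c + c\<^sup>2 + norm w * c + c\<^sup>2 * c"
  define A1 where "A1 t = a - 2 * b * t - M * t\<^sup>2" for t
  define A2 where "A2 t = a - 2 * b * t + (M + c\<^sup>2) * t\<^sup>2" for t
  define B where "B t = b - (1 - h * c) * t + M * t\<^sup>2" for t
  define \<phi> where "\<phi> t = h\<^sup>2 * (A2 t)\<^sup>2 - a\<^sup>2 * (A1 t - (B t)\<^sup>2)" for t
  have "0 \<le> M" using \<open>0 \<le> c\<close> by (simp add: M_def)
  have \<phi>0: "\<phi> 0 = 0" by (simp add: \<phi>_def A1_def A2_def B_def h2)
  have "(\<phi> has_real_derivative h\<^sup>2 * (2 * a * (- 2 * b)) - a\<^sup>2 * (- 2 * b - 2 * b * (- (1 - h * c)))) (at 0)"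
    unfolding \<phi>_def[abs_def] A1_def A2_def B_def
    by (auto intro!: derivative_eq_intros simp: algebra_simps)
  moreover have "h\<^sup>2 * (2 * a * (- 2 * b)) - a\<^sup>2 * (- 2 * b - 2 * b * (- (1 - h * c))) = 2 * a * b * h * (c * a - 2 * h)"
    by (simp add: algebra_simps power2_eq_square)
  ultimately have der: "(\<phi> has_real_derivative 2 * a * b * h * (c * a - 2 * h)) (at 0)" by (simp only:)
  have "2 * a * b * h * (c * a - 2 * h) < 0"
    using \<open>0 < a\<close> \<open>0 < b\<close> \<open>0 < h\<close> cah by (intro mult_pos_neg) auto
  then obtain d where d: "0 < d" "\<forall>t>0. t < d \<longrightarrow> \<phi> t < 0"
    using DERIV_neg_dec_right[OF der] \<phi>0 by auto
  \<comment> \<open>\<open>t \<le> b / N\<close> makes \<open>w' \<bullet> u'\<close> nonnegative,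
    so that its upper bound \<open>B t\<close> may be squared.\<close>
  define N where "N = norm w * c + c + c\<^sup>2 + 2"
  have "0 < N" using \<open>0 \<le> c\<close> by (simp add: N_def add_nonneg_pos)
  define t where "t = Min {d / 2, e, 1, b / N}"
  have t: "0 < t" "t < d" "t \<le> e" "t \<le> 1" "t \<le> b / N"
    using d(1) e(1) \<open>0 < b\<close> \<open>0 < N\<close> by (auto simp: t_def min_less_iff_disj)
  have tN: "t * N \<le> b" using t(5) \<open>0 < N\<close> by (simp add: field_simps)
  have t2: "t\<^sup>2 \<le> t" "0 \<le> t\<^sup>2" "t ^ 3 \<le> t\<^sup>2" "t ^ 4 \<le> t\<^sup>2" "0 \<le> t ^ 3"
    using t power_decreasing[of 1 2 t] power_decreasing[of 2 3 t] power_decreasing[of 2 4 t] by auto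
  have D: "s + t \<in> D" using e(2) t by auto
  define u' where "u' = velocity \<gamma> D (s + t)"
  define r where "r = \<gamma> (s + t) - \<gamma> s - t *\<^sub>R u"
  define w' where "w' = y - \<gamma> (s + t)"
  have w': "w' = w - t *\<^sub>R u - r" by (simp add: w'_def w_def r_def)
  have nu': "norm u' = 1" unfolding u'_def by (rule norm_velocity[OF lp(1) D])
  have r: "norm r \<le> c * t\<^sup>2 / 2"
    using link_param_taylor[OF lp D c] by (simp add: r_def u_def)
  define \<delta> where "\<delta> = u' - u"
  have \<delta>: "norm \<delta> \<le> c * t"
    using lipschitz_onD[OF c D lp(2)] t by (simp add: \<delta>_def u'_def u_def dist_norm)
  have \<delta>2: "(norm \<delta>)\<^sup>2 \<le> c\<^sup>2 * t\<^sup>2"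
    using power_mono[OF \<delta>, of 2] by (simp add: power_mult_distrib)
  \<comment> \<open>Both velocities are unit vectors, so their difference is orthogonal to
    \<open>u\<close> up to second order. At first order only the part \<open>P\<close> of
    \<open>w\<close> sees it, which gives the term \<open>h * c * t\<close> in
    \<open>B t\<close>.\<close>
  have u\<delta>: "u \<bullet> \<delta> = - (norm \<delta>)\<^sup>2 / 2"
  proof -
    have "u' \<bullet> u' = 1" using nu' by (simp add: dot_square_norm)
    then show ?thesis
      unfolding power2_norm_eq_inner \<delta>_def using uu by (simp add: inner_diff inner_commute)
  qed
  have wr: "\<bar>w \<bullet> r\<bar> \<le> norm w * c * t\<^sup>2 / 2"
    using Cauchy_Schwarz_ineq2[of w r] mult_left_mono[OF r, of "norm w"] by (simp add: mult.assoc)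
  have ur: "\<bar>u \<bullet> r\<bar> \<le> c * t\<^sup>2 / 2" "\<bar>r \<bullet> u'\<bar> \<le> c * t\<^sup>2 / 2"
    using Cauchy_Schwarz_ineq2[of u r] Cauchy_Schwarz_ineq2[of r u'] nu nu' r by auto
  have tur: "\<bar>t * (u \<bullet> r)\<bar> \<le> c * t\<^sup>2 / 2"
  proof -
    have "\<bar>t * (u \<bullet> r)\<bar> = t * \<bar>u \<bullet> r\<bar>" using t by (simp add: abs_mult)
    also have "\<dots> \<le> 1 * \<bar>u \<bullet> r\<bar>" using t by (intro mult_right_mono) auto
    finally show ?thesis using ur by simp
  qed
  have rr: "0 \<le> (norm r)\<^sup>2" "(norm r)\<^sup>2 \<le> c\<^sup>2 * t\<^sup>2"
  proof -
    have "(norm r)\<^sup>2 \<le> (c * t\<^sup>2 / 2)\<^sup>2" using r by (intro power_mono) auto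
    also have "\<dots> = c\<^sup>2 / 4 * t ^ 4" by (simp add: power2_eq_square power4_eq_xxxx)
    also have "\<dots> \<le> c\<^sup>2 / 4 * t\<^sup>2" using t2 by (intro mult_left_mono) auto
    also have "\<dots> \<le> c\<^sup>2 * t\<^sup>2" by simp
    finally show "(norm r)\<^sup>2 \<le> c\<^sup>2 * t\<^sup>2" .
  qed simp
  have a': "(norm w')\<^sup>2 = a - 2 * b * t + t\<^sup>2 - 2 * (w \<bullet> r) + 2 * (t * (u \<bullet> r)) + (norm r)\<^sup>2"
    unfolding w' a_def b_def power2_norm_eq_inner
    by (simp add: inner_diff inner_commute uu algebra_simps power2_eq_square)
  have M_t2: "M * t\<^sup>2 = t\<^sup>2 + c * t\<^sup>2 + c\<^sup>2 * t\<^sup>2 + norm w * c * t\<^sup>2 + c\<^sup>2 * c * t\<^sup>2"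
    by (simp add: M_def algebra_simps)
  have nn: "0 \<le> c * t\<^sup>2" "0 \<le> c\<^sup>2 * t\<^sup>2" "0 \<le> norm w * c * t\<^sup>2" "0 \<le> c\<^sup>2 * c * t\<^sup>2"
    using \<open>0 \<le> c\<close> by auto
  have A1: "A1 t \<le> (norm w')\<^sup>2"
    unfolding A1_def a' M_t2 using wr tur rr nn t2(2) unfolding abs_le_iff by linarith
  have A2: "(norm w')\<^sup>2 \<le> A2 t"
    unfolding A2_def distrib_right a' M_t2 using wr tur rr nn t2(2) unfolding abs_le_iff by linarith
  have b': "w' \<bullet> u' = b + P \<bullet> \<delta> + b * (u \<bullet> \<delta>) - t * (1 + u \<bullet> \<delta>) - r \<bullet> u'"
  proof -
    have "u' = u + \<delta>" by (simp add: \<delta>_def)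
    then show ?thesis
      unfolding w' P_def by (simp add: inner_diff_left inner_add_right inner_diff_right uu b_def algebra_simps)
  qed
  have P\<delta>: "\<bar>P \<bullet> \<delta>\<bar> \<le> h * c * t"
    using Cauchy_Schwarz_ineq2[of P \<delta>] mult_left_mono[OF \<delta>, of h] by (simp add: h_def mult.assoc)
  have b\<delta>: "b * (u \<bullet> \<delta>) \<le> 0" unfolding u\<delta> using \<open>0 < b\<close> by (simp add: mult_le_0_iff)
  have t\<delta>: "- (t * (u \<bullet> \<delta>)) \<le> c\<^sup>2 * t\<^sup>2"
  proof -
    have "- (t * (u \<bullet> \<delta>)) = t * ((norm \<delta>)\<^sup>2 / 2)" unfolding u\<delta> by simp
    also have "\<dots> \<le> 1 * ((norm \<delta>)\<^sup>2 / 2)" using t by (intro mult_right_mono) auto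
    also have "\<dots> \<le> c\<^sup>2 * t\<^sup>2" using \<delta>2 nn(2) by linarith
    finally show ?thesis .
  qed
  have B: "B t = b - t + h * c * t + (t\<^sup>2 + c * t\<^sup>2 + c\<^sup>2 * t\<^sup>2 + norm w * c * t\<^sup>2 + c\<^sup>2 * c * t\<^sup>2)"
    unfolding B_def M_t2 by (simp add: algebra_simps)
  have "t * (1 + u \<bullet> \<delta>) = t + t * (u \<bullet> \<delta>)" by (simp add: distrib_left)
  then have bB: "w' \<bullet> u' \<le> B t"
    unfolding B b' using P\<delta> b\<delta> t\<delta> ur(2) nn t2(2) unfolding abs_le_iff by linarith
  have b0: "0 \<le> w' \<bullet> u'"
  proof -
    have "\<bar>w \<bullet> \<delta>\<bar> \<le> norm w * (c * t)"
      using Cauchy_Schwarz_ineq2[of w \<delta>] mult_left_mono[OF \<delta>, of "norm w"] by simp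
    moreover have "w' \<bullet> u' = b + w \<bullet> \<delta> - t - t * (u \<bullet> \<delta>) - r \<bullet> u'"
      unfolding b' P_def by (simp add: inner_diff_left algebra_simps)
    moreover have "- (t * (u \<bullet> \<delta>)) \<ge> 0" unfolding u\<delta> using t by simp
    moreover have "c * t\<^sup>2 / 2 \<le> c * t"
      using mult_left_mono[OF t2(1) \<open>0 \<le> c\<close>] nn(1) by linarith
    moreover have "t * N = norm w * (c * t) + c * t + c\<^sup>2 * t + 2 * t" by (simp add: N_def algebra_simps)
    moreover have "0 \<le> c\<^sup>2 * t" using t by simp
    ultimately show ?thesis using tN ur(2) t(1) unfolding abs_le_iff by linarith
  qed
  have key: "a\<^sup>2 * ((norm w')\<^sup>2 - (w' \<bullet> u')\<^sup>2) \<le> h\<^sup>2 * ((norm w')\<^sup>2)\<^sup>2"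
  \<comment> \<open>If the step ends exactly at \<open>y\<close>, maximality says nothing, but both
    sides are 0.\<close>
  proof (cases "w' = 0")
    case False
    then have "offset_sq 1 u' w' / norm w' ^ 4 \<le> q"
      using max[OF D] by (simp add: w'_def u'_def)
    then show ?thesis
      unfolding q_eq offset_sq_line using False \<open>0 < a\<close>
      by (simp add: field_simps power_mult[symmetric])
  qed simp
  have "(w' \<bullet> u')\<^sup>2 \<le> (B t)\<^sup>2" using b0 bB by (intro power_mono)
  then have "a\<^sup>2 * (A1 t - (B t)\<^sup>2) \<le> a\<^sup>2 * ((norm w')\<^sup>2 - (w' \<bullet> u')\<^sup>2)"
    using A1 by (intro mult_left_mono) auto
  also note key
  also have "h\<^sup>2 * ((norm w')\<^sup>2)\<^sup>2 \<le> h\<^sup>2 * (A2 t)\<^sup>2"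
    using A2 by (intro mult_left_mono power_mono) auto
  finally have "0 \<le> \<phi> t" by (simp add: \<phi>_def)
  then show False using d(2) t(1,2) by fastforce
qed

section \<open>Bounds for the reach and for the penalized distances\<close>

text \<open>\<open>x\<close> and \<open>y\<close> are two nearest points to \<open>p\<close>, at
  distance \<open>r\<close>, so uniqueness fails for every larger radius.\<close>

lemma reach_leI:
  assumes "x \<in> L" "y \<in> L" "x \<noteq> y" "dist p x = r" "dist p y = r" "\<And>z. z \<in> L \<Longrightarrow> r \<le> dist p z"
  shows "reach L \<le> ereal r"
  unfolding reach_def
proof (rule Sup_least)
  fix R assume "R \<in> {ereal r | r. 0 \<le> r \<and>
     (\<forall>p. (\<exists>q\<in>L. dist p q < r) \<longrightarrow> (\<exists>!q. q \<in> L \<and> (\<forall>q'\<in>L. dist p q \<le> dist p q')))}"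
  then obtain r' where r': "R = ereal r'"
    "\<And>p. \<exists>q\<in>L. dist p q < r' \<Longrightarrow> \<exists>!q. q \<in> L \<and> (\<forall>q'\<in>L. dist p q \<le> dist p q')" by blast
  have "\<not> r < r'"
  proof
    assume "r < r'"
    then have "\<exists>!q. q \<in> L \<and> (\<forall>q'\<in>L. dist p q \<le> dist p q')" using r'(2)[of p] assms by blast
    then show False using assms by metis
  qed
  then show "R \<le> ereal r" by (simp add: r'(1))
qed

text \<open>Along the curve the squared distance from \<open>p\<close> has one-sided derivative
  \<open>- 2 * ((p - x) \<bullet> u)\<close>, which cannot be negative at a minimum. Only forward
  motion is used, so ends are covered.\<close>

lemma nearest_point_normal:
  assumes "u \<in> inward_vectors L x" "\<And>z. z \<in> L \<Longrightarrow> dist p x \<le> dist p z"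
  shows "(p - x) \<bullet> u \<le> 0"
proof (rule ccontr)
  assume "\<not> (p - x) \<bullet> u \<le> 0"
  then have "0 < (p - x) \<bullet> u" by simp
  obtain \<gamma> D s e where lp: "link_param L \<gamma> D" "s \<in> D" and x: "\<gamma> s = x" "u = velocity \<gamma> D s"
    and e: "0 < e" "{s..s + e} \<subseteq> D" using assms(1) unfolding inward_vectors_def by blast
  have "((\<lambda>r. (p - \<gamma> r) \<bullet> (p - \<gamma> r)) has_vector_derivative - 2 * ((p - x) \<bullet> u)) (at s within {s..s + e})"
    using has_vector_derivative_within_subset[OF link_param_has_derivative[OF lp] e(2)]
    unfolding has_vector_derivative_def x(1)[symmetric] x(2)
    by (auto intro!: derivative_eq_intros simp: inner_commute algebra_simps)
  then have der: "((\<lambda>r. (p - \<gamma> r) \<bullet> (p - \<gamma> r)) has_real_derivative - 2 * ((p - x) \<bullet> u)) (at s within {s..s + e})"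
    by (simp add: has_real_derivative_iff_has_vector_derivative)
  have "- 2 * ((p - x) \<bullet> u) < 0" using \<open>0 < (p - x) \<bullet> u\<close> by simp
  from has_real_derivative_neg_dec_right[OF der this] obtain d where d: "0 < d"
    "\<And>t. 0 < t \<Longrightarrow> s + t \<in> {s..s + e} \<Longrightarrow> t < d \<Longrightarrow>
      (p - \<gamma> (s + t)) \<bullet> (p - \<gamma> (s + t)) < (p - \<gamma> s) \<bullet> (p - \<gamma> s)"
    by blast
  define t where "t = min e (d / 2)"
  have t: "0 < t" "s + t \<in> {s..s + e}" "t < d" using d(1) e(1) by (auto simp: t_def)
  then have "(dist p (\<gamma> (s + t)))\<^sup>2 < (dist p x)\<^sup>2"
    using d(2) by (simp add: dist_norm power2_norm_eq_inner x)
  moreover have "dist p x \<le> dist p (\<gamma> (s + t))"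
    using assms(2) link_param_image_subset[OF lp(1)] e(2) t(2) by blast
  then have "(dist p x)\<^sup>2 \<le> (dist p (\<gamma> (s + t)))\<^sup>2" by (intro power_mono) auto
  ultimately show False by linarith
qed

text \<open>Each point gets the frame that computes \<open>pd_star\<close>: the inward ray at an
  end, a tangent line elsewhere. The last two clauses describe normality through inward vectors
  alone: \<open>sqrt (offset_sq l v w)\<close> bounds the component of \<open>w\<close> in any
  normal direction, and it is the full length if \<open>w\<close> itself is normal. At interior
  points both tangents are inward, so the inequalities become orthogonality.\<close>

lemma ex_frame:
  assumes L: "c11_link L" and "x \<in> L"
  shows "\<exists>l v. (l, x, v) \<in> line_frames L \<union> ray_frames L \<and>
    (\<forall>y. x \<noteq> y \<longrightarrow> pd_star L x y = penalized l v (y - x)) \<and>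
    (\<forall>n w. (\<forall>u\<in>inward_vectors L x. n \<bullet> u \<le> 0) \<longrightarrow> w \<bullet> n \<le> sqrt (offset_sq l v w) * norm n) \<and>
    (\<forall>w. (\<forall>u\<in>inward_vectors L x. w \<bullet> u \<le> 0) \<longrightarrow> offset_sq l v w = (norm w)\<^sup>2)"
proof -
  have *: "w \<bullet> n \<le> sqrt (offset_sq 1 v w) * norm n" if "norm v = 1" "(w \<bullet> v) * (n \<bullet> v) \<le> 0" for v w n :: "real^3"
  proof -
    have "w \<bullet> n = (w - (w \<bullet> v) *\<^sub>R v) \<bullet> n + (w \<bullet> v) * (n \<bullet> v)"
      by (simp add: inner_diff_left inner_commute[of v n])
    also have "\<dots> \<le> norm (w - (w \<bullet> v) *\<^sub>R v) * norm n"
      using that(2) norm_cauchy_schwarz[of "w - (w \<bullet> v) *\<^sub>R v" n] by linarith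
    finally show ?thesis by (simp add: offset_sq_orthogonal_part[OF that(1)])
  qed
  show ?thesis
  proof (cases "x \<in> link_boundary L")
    case True
    obtain u where u: "inward_vectors L x = {u}" using ex_inward_vector[OF L True] by blast
    then have "norm u = 1" using inward_vectors_subset norm_tangent_vectors by blast
    show ?thesis
    proof (intro exI[of _ "0::real"] exI[of _ u] conjI allI impI)
      show "(0, x, u) \<in> line_frames L \<union> ray_frames L" using True u by (simp add: ray_frames_def)
      have "u \<in> inward_vectors L x" by (simp add: u)
      then show "pd_star L x y = penalized 0 u (y - x)" if "x \<noteq> y" for y
        by (rule pd_star_boundary[OF L that True])
      show "w \<bullet> n \<le> sqrt (offset_sq 0 u w) * norm n" if "\<forall>u\<in>inward_vectors L x. n \<bullet> u \<le> 0" for n w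
        using *[OF \<open>norm u = 1\<close>, of w n] that norm_cauchy_schwarz[of w n]
        by (simp add: offset_sq_ray u mult_le_0_iff)
      show "offset_sq 0 u w = (norm w)\<^sup>2" if "\<forall>u\<in>inward_vectors L x. w \<bullet> u \<le> 0" for w
        using that by (simp add: offset_sq_ray u)
    qed
  next
    case False
    have eq: "inward_vectors L x = tangent_vectors L x"
      by (rule inward_vectors_interior[OF L \<open>x \<in> L\<close> False])
    obtain \<gamma> D s where lp: "link_param L \<gamma> D" "s \<in> D" "\<gamma> s = x"
      by (rule link_param_exists[OF L \<open>x \<in> L\<close>])
    then obtain v where v: "v \<in> tangent_vectors L x" unfolding tangent_vectors_def by blast
    have nv: "norm v = 1" by (rule norm_tangent_vectors[OF v])
    have "- v \<in> tangent_vectors L x" using tangent_vectors_pm[OF L v] by simp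
    then have orth: "n \<bullet> v = 0" if "\<forall>u\<in>inward_vectors L x. n \<bullet> u \<le> 0" for n
      using that[rule_format, of v] that[rule_format, of "- v"] v eq by simp
    show ?thesis
    proof (intro exI[of _ "1::real"] exI[of _ v] conjI allI impI)
      show "(1, x, v) \<in> line_frames L \<union> ray_frames L" using v \<open>x \<in> L\<close> by (simp add: line_frames_def)
      show "pd_star L x y = penalized 1 v (y - x)" if "x \<noteq> y" for y
        by (rule pd_star_interior[OF L that False v])
      show "w \<bullet> n \<le> sqrt (offset_sq 1 v w) * norm n" if "\<forall>u\<in>inward_vectors L x. n \<bullet> u \<le> 0" for n w
        using *[OF nv] orth[OF that] by simp
      show "offset_sq 1 v w = (norm w)\<^sup>2" if "\<forall>u\<in>inward_vectors L x. w \<bullet> u \<le> 0" for w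
        using orth[OF that] by (simp add: offset_sq_line)
    qed
  qed
qed

text \<open>\<open>S\<close> bounds 1 / (4 F^2). If \<open>x\<close> and \<open>y\<close> are both
  nearest to \<open>p\<close>, at distance \<open>d\<close>, then \<open>p - x\<close> is normal at
  \<open>x\<close> and |w|^2 = 2 w \<bullet> (p - x) is at most
  \<open>2 * sqrt (offset_sq l v w) * d\<close>. Squaring gives \<open>1 \<le> 4 * d^2 * S\<close>,
  which excludes \<open>d < r\<close>. The condition on \<open>r\<close> is a product so that
  \<open>S = 0\<close> admits every \<open>r\<close>.\<close>

lemma reach_ge:
  assumes L: "c11_link L" and "0 \<le> r" "4 * r\<^sup>2 * S \<le> 1" "0 \<le> S"
    and le: "\<And>l x v y. (l, x, v) \<in> line_frames L \<union> ray_frames L \<Longrightarrow> y \<in> L \<Longrightarrow> x \<noteq> y \<Longrightarrow>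
      offset_sq l v (y - x) / norm (y - x) ^ 4 \<le> S"
  shows "ereal r \<le> reach L"
proof -
  have "\<exists>!q. q \<in> L \<and> (\<forall>q'\<in>L. dist p q \<le> dist p q')" if q0: "q0 \<in> L" "dist p q0 < r" for p q0
  proof -
    have "closed L" "L \<noteq> {}" using compact_imp_closed[OF link_compact[OF L]] q0(1) by auto
    then have "\<exists>x\<in>L. \<forall>z\<in>L. dist p x \<le> dist p z" by (rule distance_attains_inf) blast
    then obtain x where x: "x \<in> L" "\<forall>z\<in>L. dist p x \<le> dist p z" by blast
    have "y = x" if y: "y \<in> L" "\<forall>z\<in>L. dist p y \<le> dist p z" for y
    proof (rule ccontr)
      assume "y \<noteq> x"
      obtain l v where v: "(l, x, v) \<in> line_frames L \<union> ray_frames L" and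
        n: "\<forall>n w. (\<forall>u\<in>inward_vectors L x. n \<bullet> u \<le> 0) \<longrightarrow> w \<bullet> n \<le> sqrt (offset_sq l v w) * norm n"
        using ex_frame[OF L x(1)] by blast
      define w where "w = y - x"
      define d where "d = norm (p - x)"
      have dr: "d < r" using x(2) \<open>q0 \<in> L\<close> \<open>dist p q0 < r\<close> by (fastforce simp: d_def dist_norm)
      have "0 < norm w" using \<open>y \<noteq> x\<close> by (simp add: w_def)
      have Q: "0 \<le> offset_sq l v w" using frames_props[OF v L] by (intro offset_sq_nonneg) auto
      have "(p - x) \<bullet> u \<le> 0" if "u \<in> inward_vectors L x" for u
        using nearest_point_normal[OF that] x(2) by blast
      then have wn: "w \<bullet> (p - x) \<le> sqrt (offset_sq l v w) * d" unfolding d_def using n by blast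
      have "dist p x = dist p y" using x y by (meson order_antisym)
      then have "(norm (p - x))\<^sup>2 = (norm (p - x - w))\<^sup>2" by (simp add: dist_norm w_def)
      then have "(norm w)\<^sup>2 = 2 * (w \<bullet> (p - x))"
        unfolding power2_norm_eq_inner by (simp add: inner_diff inner_commute)
      then have "(norm w)\<^sup>2 \<le> 2 * sqrt (offset_sq l v w) * d" using wn by simp
      then have "((norm w)\<^sup>2)\<^sup>2 \<le> (2 * sqrt (offset_sq l v w) * d)\<^sup>2" by (intro power_mono) auto
      also have "\<dots> = 4 * d\<^sup>2 * offset_sq l v w" using Q by (simp add: power_mult_distrib)
      also have "\<dots> \<le> 4 * d\<^sup>2 * (S * norm w ^ 4)"
        using le[OF v y(1)] \<open>y \<noteq> x\<close> \<open>0 < norm w\<close>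
        by (intro mult_left_mono) (auto simp: w_def divide_le_eq)
      also have "((norm w)\<^sup>2)\<^sup>2 = norm w ^ 4" by (simp add: power_mult[symmetric])
      finally have "norm w ^ 4 * 1 \<le> norm w ^ 4 * (4 * d\<^sup>2 * S)" by (simp add: mult_ac)
      then have 1: "1 \<le> 4 * d\<^sup>2 * S" using \<open>0 < norm w\<close> by simp
      have "d\<^sup>2 < r\<^sup>2" using dr by (intro power_strict_mono) (auto simp: d_def)
      moreover have "0 < S" using 1 \<open>0 \<le> S\<close> by (cases "S = 0") auto
      ultimately have "4 * d\<^sup>2 * S < 4 * r\<^sup>2 * S" by simp
      then show False using 1 assms(3) by linarith
    qed
    then show ?thesis using x by blast
  qed
  then show ?thesis
    unfolding reach_def using \<open>0 \<le> r\<close> by (intro Sup_upper) blast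
qed

text \<open>With \<open>Q = offset_sq l v w\<close>, the bounds Q \<le> S |w|^4 and Q \<le> |w|^2
  are multiplied. Given the condition on \<open>S\<close>, the first expresses F \<ge> r; the second
  expresses 2 F \<ge> |w|.\<close>

lemma penalized_ge:
  assumes "0 \<le> r" "4 * r\<^sup>2 * S \<le> 1" "norm v = 1" "l = 0 \<or> l = 1" "w \<noteq> 0"
    and le: "offset_sq l v w / norm w ^ 4 \<le> S"
  shows "ereal (2 * r) \<le> penalized l v w"
proof (cases "offset_sq l v w = 0")
  case False
  define Q where "Q = offset_sq l v w"
  have "0 < Q" using False offset_sq_nonneg[OF assms(3,4), of w] by (simp add: Q_def)
  have "0 < norm w" using \<open>w \<noteq> 0\<close> by simp
  have "Q \<le> S * norm w ^ 4" using le \<open>0 < norm w\<close> by (simp add: Q_def divide_le_eq)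
  moreover have "Q \<le> (norm w)\<^sup>2" unfolding Q_def by (rule offset_sq_le)
  ultimately have "Q * Q \<le> (S * norm w ^ 4) * (norm w)\<^sup>2"
    using \<open>0 < Q\<close> by (intro mult_mono) auto
  then have "4 * r\<^sup>2 * (Q * Q) \<le> 4 * r\<^sup>2 * ((S * norm w ^ 4) * (norm w)\<^sup>2)"
    by (intro mult_left_mono) auto
  also have "\<dots> = (4 * r\<^sup>2 * S) * norm w ^ 6" by (simp add: power_add[symmetric] mult.assoc)
  also have "\<dots> \<le> 1 * norm w ^ 6" using assms(2) by (intro mult_right_mono) auto
  finally have "(2 * r * Q)\<^sup>2 \<le> (norm w ^ 3)\<^sup>2"
    by (simp add: power_mult_distrib power_mult[symmetric] power2_eq_square mult_ac)
  then have "2 * r * Q \<le> norm w ^ 3" by (rule power2_le_imp_le) simp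
  then have "2 * r \<le> norm w ^ 3 / Q" using \<open>0 < Q\<close> by (simp add: le_divide_eq)
  then show ?thesis using False by (simp add: penalized_def Q_def)
qed (simp add: penalized_def)

section \<open>Attained minima of the penalized distances\<close>

text \<open>The reciprocal of \<open>penalized\<close> is the ratio with exponent 3, which tends to
  0 at the diagonal because \<open>offset_sq\<close> is O(|y - x|^4) there. So either the ratio is 0
  everywhere or its maximum is attained.\<close>

lemma penalized_min_attained:
  assumes L: "c11_link L" and c: "0 \<le> c" "\<And>\<gamma> D. link_param L \<gamma> D \<Longrightarrow> c-lipschitz_on D (velocity \<gamma> D)"
    and Fr: "compact Fr" "Fr \<subseteq> line_frames L \<union> ray_frames L"
  shows "(\<forall>(l, x, v)\<in>Fr. \<forall>y\<in>L. x \<noteq> y \<longrightarrow> penalized l v (y - x) = \<infinity>) \<or>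
    (\<exists>(l, x, v)\<in>Fr. \<exists>y\<in>L. x \<noteq> y \<and>
       (\<forall>(l', x', v')\<in>Fr. \<forall>y'\<in>L. x' \<noteq> y' \<longrightarrow> penalized l v (y - x) \<le> penalized l' v' (y' - x')))"
proof (cases "\<exists>l x v y. (l, x, v) \<in> Fr \<and> y \<in> L \<and> x \<noteq> y \<and> offset_sq l v (y - x) \<noteq> 0")
  case False
  then have "\<forall>(l, x, v)\<in>Fr. \<forall>y\<in>L. x \<noteq> y \<longrightarrow> penalized l v (y - x) = \<infinity>"
    by (auto simp: penalized_def)
  then show ?thesis by blast
next
  case True
  then obtain l0 x0 v0 y0 where z0: "(l0, x0, v0) \<in> Fr" "y0 \<in> L" "x0 \<noteq> y0" "offset_sq l0 v0 (y0 - x0) \<noteq> 0"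
    by blast
  have nonneg: "0 \<le> offset_sq l v w" if "(l, x, v) \<in> Fr" for l x v w
    using frames_props[OF _ L, of l x v] that Fr(2) by (intro offset_sq_nonneg) auto
  have pos0: "0 < offset_sq l0 v0 (y0 - x0) / norm (y0 - x0) ^ 3"
    using nonneg[OF z0(1), of "y0 - x0"] z0(3,4) by simp
  have near: "\<exists>\<delta>>0. \<forall>(l, x, v)\<in>Fr. \<forall>y\<in>L. x \<noteq> y \<longrightarrow> dist x y < \<delta> \<longrightarrow>
       offset_sq l v (y - x) / norm (y - x) ^ 3 \<le> 0 + \<epsilon>" if "0 < \<epsilon>" for \<epsilon>
  proof -
    define B where "B = c\<^sup>2 / 4 + 1"
    have "0 < B" by (simp add: B_def add_nonneg_pos)
    obtain \<delta> where \<delta>: "0 < \<delta>" "\<forall>(l, x, v)\<in>line_frames L \<union> ray_frames L. \<forall>y\<in>L. dist x y < \<delta> \<longrightarrow>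
       offset_sq l v (y - x) \<le> B * norm (y - x) ^ 4"
      using offset_sq_near[OF L c zero_less_one] unfolding B_def by blast
    have "offset_sq l v (y - x) / norm (y - x) ^ 3 \<le> \<epsilon>"
      if "(l, x, v) \<in> Fr" "y \<in> L" "x \<noteq> y" "dist x y < min \<delta> (\<epsilon> / B)" for l x v y
    proof -
      have "0 < norm (y - x)" using that by simp
      have "(l, x, v) \<in> line_frames L \<union> ray_frames L" "dist x y < \<delta>" using that Fr(2) by auto
      then have "offset_sq l v (y - x) \<le> B * norm (y - x) ^ 4" using \<delta>(2) that(2) by blast
      also have "\<dots> = B * norm (y - x) * norm (y - x) ^ 3" by (simp add: power4_eq_xxxx power3_eq_cube)
      finally have "offset_sq l v (y - x) / norm (y - x) ^ 3 \<le> B * norm (y - x)"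
        using \<open>0 < norm (y - x)\<close> by (simp add: divide_le_eq)
      also have "\<dots> \<le> B * (\<epsilon> / B)"
        using that(4) \<open>0 < B\<close> by (intro mult_left_mono) (auto simp: dist_norm norm_minus_commute)
      finally show ?thesis using \<open>0 < B\<close> by simp
    qed
    then show ?thesis using \<delta>(1) \<open>0 < B\<close> \<open>0 < \<epsilon>\<close> by (intro exI[of _ "min \<delta> (\<epsilon> / B)"]) auto
  qed
  obtain l x v y where m: "(l, x, v) \<in> Fr" "y \<in> L" "x \<noteq> y"
    "0 < offset_sq l v (y - x) / norm (y - x) ^ 3"
    "\<forall>(l', x', v')\<in>Fr. \<forall>y'\<in>L. x' \<noteq> y' \<longrightarrow>
       offset_sq l' v' (y' - x') / norm (y' - x') ^ 3 \<le> offset_sq l v (y - x) / norm (y - x) ^ 3"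
    using maximum_off_diagonal[OF Fr(1) link_compact[OF L] near z0(1,2,3) pos0] by blast
  have "penalized l v (y - x) \<le> penalized l' v' (y' - x')"
    if "(l', x', v') \<in> Fr" "y' \<in> L" "x' \<noteq> y'" for l' x' v' y'
  proof (cases "offset_sq l' v' (y' - x') = 0")
    case False
    define G where "G = offset_sq l v (y - x) / norm (y - x) ^ 3"
    define G' where "G' = offset_sq l' v' (y' - x') / norm (y' - x') ^ 3"
    have "0 < G'" using False nonneg[OF that(1), of "y' - x'"] that(3) by (simp add: G'_def)
    moreover have "G' \<le> G" unfolding G_def G'_def using m(5) that by blast
    ultimately have "1 / G \<le> 1 / G'" by (simp add: frac_le)
    then show ?thesis using False m(4) by (auto simp: penalized_def G_def G'_def)
  qed (simp add: penalized_def)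
  then have "\<forall>(l', x', v')\<in>Fr. \<forall>y'\<in>L. x' \<noteq> y' \<longrightarrow> penalized l v (y - x) \<le> penalized l' v' (y' - x')"
    by blast
  then show ?thesis using m(1,2,3) by blast
qed

lemma ex_tangent_vector:
  assumes "c11_link L" "x \<in> L"
  shows "\<exists>v. v \<in> tangent_vectors L x"
proof -
  obtain \<gamma> D s where "link_param L \<gamma> D" "s \<in> D" "\<gamma> s = x"
    by (rule link_param_exists[OF assms])
  then show ?thesis unfolding tangent_vectors_def by blast
qed

lemma pd_star_le_pd:
  assumes L: "c11_link L" and "x \<in> L"
  shows "pd_star L x y \<le> pd L x y"
proof (cases "x = y")
  case False
  show ?thesis
  proof (cases "x \<in> link_boundary L")
    case True
    obtain u where u: "u \<in> inward_vectors L x" using ex_inward_vector[OF L True] by blast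
    then have ut: "u \<in> tangent_vectors L x" using inward_vectors_subset by blast
    have "0 \<le> offset_sq 1 u (y - x)" using norm_tangent_vectors[OF ut] by (intro offset_sq_nonneg) auto
    moreover have "offset_sq 1 u (y - x) \<le> offset_sq 0 u (y - x)" by (rule offset_sq_ray_ge)
    ultimately have "penalized 0 u (y - x) \<le> penalized 1 u (y - x)"
      by (auto simp: penalized_def intro!: divide_left_mono)
    then show ?thesis
      using pd_star_boundary[OF L False True u] pd_eq[OF L False ut] by simp
  next
    case nb: False
    obtain v where "v \<in> tangent_vectors L x" using ex_tangent_vector[OF assms] by blast
    then show ?thesis using pd_star_interior[OF L False nb] pd_eq[OF L False] by simp
  qed
qed (simp add: pd_star_def pd_def)

lemma pd_star_eq_pd:
  assumes L: "c11_link L" and "x \<in> L" "x \<notin> link_boundary L"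
  shows "pd_star L x y = pd L x y"
proof (cases "x = y")
  case False
  obtain v where "v \<in> tangent_vectors L x" using ex_tangent_vector[OF assms(1,2)] by blast
  then show ?thesis using pd_star_interior[OF L False assms(3)] pd_eq[OF L False] by simp
qed (simp add: pd_star_def pd_def)

lemma link_lipschitz_constant:
  assumes "c11_link L"
  shows "\<exists>c\<ge>0. min_curv_radius L = radius c \<and> (\<forall>\<gamma> D. link_param L \<gamma> D \<longrightarrow> c-lipschitz_on D (velocity \<gamma> D))"
proof -
  obtain c where c: "0 \<le> c" "min_curv_radius L = radius c" "\<forall>(p, T, \<kappa>)\<in>Osc L. norm \<kappa> \<le> c"
    using min_curv_radius_eq[OF assms] by blast
  have "c-lipschitz_on D (velocity \<gamma> D)" if "link_param L \<gamma> D" for \<gamma> D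
    by (rule velocity_lipschitz[OF c(1) _ that]) (use c(3) in blast)
  then show ?thesis using c(1,2) by blast
qed

lemma pd_min_attained:
  assumes L: "c11_link L" and "L \<noteq> {}"
  shows "\<exists>x\<in>L. \<exists>y\<in>L. \<forall>x'\<in>L. \<forall>y'\<in>L. pd L x y \<le> pd L x' y'"
proof -
  obtain c where c0: "0 \<le> c" and c1: "\<forall>\<gamma> D. link_param L \<gamma> D \<longrightarrow> c-lipschitz_on D (velocity \<gamma> D)"
    using link_lipschitz_constant[OF L] by blast
  note c = c0 c1[rule_format]
  have fr: "\<exists>v. (1, x, v) \<in> line_frames L \<and> (\<forall>y. x \<noteq> y \<longrightarrow> pd L x y = penalized 1 v (y - x))" if x: "x \<in> L" for x
    using ex_tangent_vector[OF L x] pd_eq[OF L] x unfolding line_frames_def by blast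
  have diag: "pd L x x = \<infinity>" for x by (simp add: pd_def)
  from penalized_min_attained[OF L c compact_line_frames[OF L] Un_upper1]
  show ?thesis
  proof
    assume *: "\<forall>(l, x, v)\<in>line_frames L. \<forall>y\<in>L. x \<noteq> y \<longrightarrow> penalized l v (y - x) = \<infinity>"
    have "pd L x y = \<infinity>" if "x \<in> L" "y \<in> L" for x y
    proof (cases "x = y")
      case False
      then show ?thesis using fr[OF that(1)] * that(2) by fastforce
    qed (simp add: diag)
    then show ?thesis using \<open>L \<noteq> {}\<close> by auto
  next
    assume "\<exists>(l, x, v)\<in>line_frames L. \<exists>y\<in>L. x \<noteq> y \<and>
       (\<forall>(l', x', v')\<in>line_frames L. \<forall>y'\<in>L. x' \<noteq> y' \<longrightarrow> penalized l v (y - x) \<le> penalized l' v' (y' - x'))"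
    then obtain l x v y where m: "(l, x, v) \<in> line_frames L" "y \<in> L" "x \<noteq> y"
      "\<forall>(l', x', v')\<in>line_frames L. \<forall>y'\<in>L. x' \<noteq> y' \<longrightarrow> penalized l v (y - x) \<le> penalized l' v' (y' - x')"
      by blast
    then have x: "x \<in> L" "l = 1" "v \<in> tangent_vectors L x" by (auto simp: line_frames_def)
    have "pd L x y \<le> pd L x' y'" if *: "x' \<in> L" "y' \<in> L" for x' y'
    proof (cases "x' = y'")
      case False
      obtain v' where "(1, x', v') \<in> line_frames L" "pd L x' y' = penalized 1 v' (y' - x')"
        using fr[OF *(1)] False by blast
      then show ?thesis using m(4) *(2) False pd_eq[OF L m(3) x(3)] x(2) by fastforce
    qed (simp add: diag)
    then show ?thesis using x(1) m(2) by blast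
  qed
qed

lemma pd_star_boundary_min_attained:
  assumes L: "c11_link L" and "link_boundary L \<noteq> {}"
  shows "\<exists>x\<in>link_boundary L. \<exists>y\<in>L. \<forall>x'\<in>link_boundary L. \<forall>y'\<in>L. pd_star L x y \<le> pd_star L x' y'"
proof -
  obtain c where c0: "0 \<le> c" and c1: "\<forall>\<gamma> D. link_param L \<gamma> D \<longrightarrow> c-lipschitz_on D (velocity \<gamma> D)"
    using link_lipschitz_constant[OF L] by blast
  note c = c0 c1[rule_format]
  have fr: "\<exists>v. (0, x, v) \<in> ray_frames L \<and> (\<forall>y. x \<noteq> y \<longrightarrow> pd_star L x y = penalized 0 v (y - x))"
    if x: "x \<in> link_boundary L" for x
    using ex_inward_vector[OF L x] pd_star_boundary[OF L _ x] x unfolding ray_frames_def by blast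
  have diag: "pd_star L x x = \<infinity>" for x by (simp add: pd_star_def)
  from penalized_min_attained[OF L c compact_ray_frames[OF L] Un_upper2]
  show ?thesis
  proof
    assume *: "\<forall>(l, x, v)\<in>ray_frames L. \<forall>y\<in>L. x \<noteq> y \<longrightarrow> penalized l v (y - x) = \<infinity>"
    have "pd_star L x y = \<infinity>" if "x \<in> link_boundary L" "y \<in> L" for x y
    proof (cases "x = y")
      case False
      then show ?thesis using fr[OF that(1)] * that(2) by fastforce
    qed (simp add: diag)
    then show ?thesis using assms(2) link_boundary_subset[OF L] by auto
  next
    assume "\<exists>(l, x, v)\<in>ray_frames L. \<exists>y\<in>L. x \<noteq> y \<and>
       (\<forall>(l', x', v')\<in>ray_frames L. \<forall>y'\<in>L. x' \<noteq> y' \<longrightarrow> penalized l v (y - x) \<le> penalized l' v' (y' - x'))"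
    then obtain l x v y where m: "(l, x, v) \<in> ray_frames L" "y \<in> L" "x \<noteq> y"
      "\<forall>(l', x', v')\<in>ray_frames L. \<forall>y'\<in>L. x' \<noteq> y' \<longrightarrow> penalized l v (y - x) \<le> penalized l' v' (y' - x')"
      by blast
    then have x: "x \<in> link_boundary L" "l = 0" "v \<in> inward_vectors L x" by (auto simp: ray_frames_def)
    have "pd_star L x y \<le> pd_star L x' y'" if *: "x' \<in> link_boundary L" "y' \<in> L" for x' y'
    proof (cases "x' = y'")
      case False
      obtain v' where "(0, x', v') \<in> ray_frames L" "pd_star L x' y' = penalized 0 v' (y' - x')"
        using fr[OF *(1)] False by blast
      then show ?thesis using m(4) *(2) False pd_star_boundary[OF L m(3) x(1,3)] x(2) by fastforce
    qed (simp add: diag)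
    then show ?thesis using x(1) m(2) by blast
  qed
qed

text \<open>Line frames at ends belong to \<open>pd\<close>, so the minimum of
  \<open>pd_star\<close> is pieced together from the two minima on the right instead of one
  compactness argument. The point is that the smaller of them is itself a value of
  \<open>pd_star\<close>.\<close>

lemma minimum_pd_star:
  assumes L: "c11_link L"
  shows "minimum {pd_star L x y | x y. x \<in> L \<and> y \<in> L} =
     min (minimum {pd L x y | x y. x \<in> L \<and> y \<in> L})
       (minimum {pd_star L x y | x y. x \<in> link_boundary L \<and> y \<in> L})" (is "minimum ?S = min ?m1 ?m2")
    and "L \<noteq> {} \<Longrightarrow> minimum {pd_star L x y | x y. x \<in> L \<and> y \<in> L} \<in> {pd_star L x y | x y. x \<in> L \<and> y \<in> L}"
proof -
  note sub = link_boundary_subset[OF L]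
  have "minimum ?S = min ?m1 ?m2 \<and> (L \<noteq> {} \<longrightarrow> minimum ?S \<in> ?S)"
  proof (cases "L = {}")
    case True
    then have "link_boundary L = {}" using sub by simp
    then show ?thesis using True by (simp add: minimum_def)
  next
    case False
    obtain x1 y1 where 1: "x1 \<in> L" "y1 \<in> L" "\<forall>x'\<in>L. \<forall>y'\<in>L. pd L x1 y1 \<le> pd L x' y'"
      using pd_min_attained[OF L False] by blast
    have m1: "?m1 = pd L x1 y1" by (rule minimum_eqI) (use 1 in blast)+
    have m2: "(link_boundary L = {} \<and> ?m2 = \<infinity>) \<or> (\<exists>x2\<in>link_boundary L. \<exists>y2\<in>L. ?m2 = pd_star L x2 y2 \<and>
        (\<forall>x'\<in>link_boundary L. \<forall>y'\<in>L. ?m2 \<le> pd_star L x' y'))"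
    proof (cases "link_boundary L = {}")
      case True
      then show ?thesis by (simp add: minimum_def)
    next
      case False
      obtain x2 y2 where 2: "x2 \<in> link_boundary L" "y2 \<in> L"
        "\<forall>x'\<in>link_boundary L. \<forall>y'\<in>L. pd_star L x2 y2 \<le> pd_star L x' y'"
        using pd_star_boundary_min_attained[OF L False] by blast
      have "?m2 = pd_star L x2 y2" by (rule minimum_eqI) (use 2 in blast)+
      then show ?thesis using 2 by auto
    qed
    have lower: "min ?m1 ?m2 \<le> pd_star L x y" if "x \<in> L" "y \<in> L" for x y
    proof (cases "x \<in> link_boundary L")
      case True
      then have "?m2 \<le> pd_star L x y" using m2 that by blast
      then show ?thesis by (simp add: min.coboundedI2)
    next
      case False
      then have "?m1 \<le> pd_star L x y" using m1 1(3) that pd_star_eq_pd[OF L that(1) False] by simp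
      then show ?thesis by (simp add: min.coboundedI1)
    qed
    have "min ?m1 ?m2 \<in> ?S"
    proof (cases "?m1 < ?m2")
      case True
      \<comment> \<open>At an end, \<open>pd_star \<le> pd\<close> would make the second minimum no
        larger than the first.\<close>
      have "x1 \<notin> link_boundary L"
      proof
        assume "x1 \<in> link_boundary L"
        then have "?m2 \<le> pd_star L x1 y1" using m2 1(2) by blast
        also have "\<dots> \<le> ?m1" unfolding m1 by (rule pd_star_le_pd[OF L 1(1)])
        finally show False using True by simp
      qed
      then have "min ?m1 ?m2 = pd_star L x1 y1"
        using True m1 pd_star_eq_pd[OF L 1(1)] by simp
      then show ?thesis using 1 by blast
    next
      case False
      show ?thesis
      \<comment> \<open>Without ends the second minimum is \<infinity> by convention and need not be
        a value of \<open>pd_star\<close>; but then the first one is \<infinity> too, and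
        \<open>x1\<close>, \<open>y1\<close> attain it.\<close>
      proof (cases "link_boundary L = {}")
        case True
        then have "?m2 = \<infinity>" using m2 by blast
        then have "min ?m1 ?m2 = pd_star L x1 y1"
          using m1 pd_star_eq_pd[OF L 1(1)] True by simp
        then show ?thesis using 1 by blast
      next
        case ne: False
        obtain x2 y2 where "x2 \<in> link_boundary L" "y2 \<in> L" "?m2 = pd_star L x2 y2" using m2 ne by blast
        moreover have "min ?m1 ?m2 = ?m2" using False by simp
        ultimately show ?thesis using sub by auto
      qed
    qed
    moreover from this have "minimum ?S = min ?m1 ?m2"
      by (rule minimum_eqI) (use lower in blast)
    ultimately show ?thesis by simp
  qed
  then show "minimum ?S = min ?m1 ?m2" "L \<noteq> {} \<Longrightarrow> minimum ?S \<in> ?S" by blast+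
qed

section \<open>Comparison of thickness with the minimal penalized distance\<close>

text \<open>Here \<open>\<sigma> \<ge> 1/2\<close> enters, as \<open>1 / \<sigma> \<le> 2\<close>.
  The hypothesis ranges over all finite \<open>r\<close> with \<open>r * c \<le> 1\<close>, and not
  just over \<open>1 / c\<close>, so that an infinite radius, \<open>c = 0\<close>, is
  included.\<close>

lemma scaled_radius_le:
  assumes "0 \<le> c" "1/2 \<le> \<sigma>" and X: "\<And>r. 0 \<le> r \<Longrightarrow> r * c \<le> 1 \<Longrightarrow> ereal (2 * r) \<le> X"
  shows "ereal (1 / \<sigma>) * radius c \<le> X"
proof (cases "c = 0")
  case True
  have "ereal B \<le> X" for B
  proof (cases "0 \<le> B")
    case True
    then show ?thesis using X[of "B / 2"] \<open>c = 0\<close> by simp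
  next
    case False
    then have "ereal B \<le> ereal 0" by simp
    also have "\<dots> \<le> X" using X[of 0] by simp
    finally show ?thesis .
  qed
  then have "X = \<infinity>" by (rule ereal_top)
  then show ?thesis by simp
next
  case False
  then have "0 < c" using \<open>0 \<le> c\<close> by simp
  have "1 / \<sigma> \<le> 2" using assms(2) by (simp add: divide_le_eq)
  then have "1 / \<sigma> * (1 / c) \<le> 2 * (1 / c)" using \<open>0 < c\<close> by (intro mult_right_mono) auto
  then have "ereal (1 / \<sigma>) * radius c \<le> ereal (2 * (1 / c))" using False by (simp add: radius_def)
  also have "\<dots> \<le> X" using \<open>0 < c\<close> by (intro X) auto
  finally show ?thesis .
qed

text \<open>The conclusion does not mention the maximizing frame: its ratio is at most 1 / |y - x|^2
  because \<open>offset_sq\<close> is at most the squared length. Any frame at \<open>x\<close> can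
  therefore be used afterwards.\<close>

lemma critical_pair:
  assumes L: "c11_link L" and c: "0 \<le> c" "\<And>\<gamma> D. link_param L \<gamma> D \<Longrightarrow> c-lipschitz_on D (velocity \<gamma> D)"
    and z0: "(l0, x0, v0) \<in> line_frames L \<union> ray_frames L" "y0 \<in> L" "x0 \<noteq> y0"
      "c\<^sup>2 / 4 < offset_sq l0 v0 (y0 - x0) / norm (y0 - x0) ^ 4"
  obtains x y where "x \<in> L" "y \<in> L" "x \<noteq> y" "\<And>u. u \<in> inward_vectors L x \<Longrightarrow> (y - x) \<bullet> u \<le> 0"
    "\<And>l' x' v' y'. (l', x', v') \<in> line_frames L \<union> ray_frames L \<Longrightarrow> y' \<in> L \<Longrightarrow> x' \<noteq> y' \<Longrightarrow>
       offset_sq l' v' (y' - x') / norm (y' - x') ^ 4 \<le> 1 / (norm (y - x))\<^sup>2"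
proof -
  let ?Fr = "line_frames L \<union> ray_frames L"
  have cpt: "compact ?Fr" by (intro compact_Un compact_line_frames compact_ray_frames L)
  have near: "\<exists>\<delta>>0. \<forall>(l, x, v)\<in>?Fr. \<forall>y\<in>L. x \<noteq> y \<longrightarrow> dist x y < \<delta> \<longrightarrow>
       offset_sq l v (y - x) / norm (y - x) ^ 4 \<le> c\<^sup>2 / 4 + \<epsilon>" if "0 < \<epsilon>" for \<epsilon>
  proof -
    obtain \<delta> where \<delta>: "0 < \<delta>" "\<forall>(l, x, v)\<in>?Fr. \<forall>y\<in>L. dist x y < \<delta> \<longrightarrow>
       offset_sq l v (y - x) \<le> (c\<^sup>2 / 4 + \<epsilon>) * norm (y - x) ^ 4"
      using offset_sq_near[OF L c \<open>0 < \<epsilon>\<close>] by blast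
    have "offset_sq l v (y - x) / norm (y - x) ^ 4 \<le> c\<^sup>2 / 4 + \<epsilon>"
      if "(l, x, v) \<in> ?Fr" "y \<in> L" "x \<noteq> y" "dist x y < \<delta>" for l x v y
      using \<delta>(2) that by (fastforce simp: divide_le_eq)
    then show ?thesis using \<delta>(1) by blast
  qed
  obtain l x v y where m: "(l, x, v) \<in> ?Fr" "y \<in> L" "x \<noteq> y"
    "c\<^sup>2 / 4 < offset_sq l v (y - x) / norm (y - x) ^ 4"
    and m': "\<forall>(l', x', v')\<in>?Fr. \<forall>y'\<in>L. x' \<noteq> y' \<longrightarrow>
       offset_sq l' v' (y' - x') / norm (y' - x') ^ 4 \<le> offset_sq l v (y - x) / norm (y - x) ^ 4"
    using maximum_off_diagonal[OF cpt link_compact[OF L] near z0] by blast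
  have max: "offset_sq l' v' (y' - x') / norm (y' - x') ^ 4 \<le> offset_sq l v (y - x) / norm (y - x) ^ 4"
    if "(l', x', v') \<in> ?Fr" "y' \<in> L" "x' \<noteq> y'" for l' x' v' y'
    using m' that by blast
  define w where "w = y - x"
  have x: "x \<in> L" and v: "v \<in> tangent_vectors L x" using frames_props[OF m(1) L] by auto
  have crit: "w \<bullet> u \<le> 0" if u: "u \<in> inward_vectors L x" for u
  proof (rule ccontr)
    assume "\<not> w \<bullet> u \<le> 0"
    \<comment> \<open>An ascent along \<open>u\<close> starts from the frame
      \<open>(l, x, v)\<close> but continues with line frames. For a ray frame the two ratios agree
      at the start, because \<open>y\<close> lies on the inner side by the assumption to be
      refuted.\<close>
    have eq: "offset_sq l v w = offset_sq 1 u w"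
    proof (cases "(l, x, v) \<in> line_frames L")
      case True
      then have "l = 1" by (simp add: line_frames_def)
      moreover have "u \<in> {v, - v}" using tangent_vectors_pm[OF L v] u inward_vectors_subset by blast
      ultimately show ?thesis by (auto simp: offset_sq_minus_line)
    next
      case False
      then have *: "l = 0" "x \<in> link_boundary L" "v \<in> inward_vectors L x"
        using m(1) by (auto simp: ray_frames_def)
      then have "u = v" using ex_inward_vector[OF L *(2)] u by auto
      then show ?thesis using \<open>l = 0\<close> \<open>\<not> w \<bullet> u \<le> 0\<close> by (simp add: offset_sq_ray)
    qed
    obtain \<gamma> D s e where lp: "link_param L \<gamma> D" "s \<in> D" and s: "\<gamma> s = x" "u = velocity \<gamma> D s"
      and e: "0 < e" "{s..s + e} \<subseteq> D" using u unfolding inward_vectors_def by blast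
    have "(y - \<gamma> s) \<bullet> velocity \<gamma> D s \<le> 0"
    proof (rule no_ascent[OF lp e c(2)[OF lp(1)]])
      show "offset_sq l v w / norm w ^ 4 = offset_sq 1 (velocity \<gamma> D s) (y - \<gamma> s) / norm (y - \<gamma> s) ^ 4"
        using eq by (simp add: w_def s)
      show "c\<^sup>2 / 4 < offset_sq l v w / norm w ^ 4" using m(4) by (simp add: w_def)
      show "\<gamma> s \<noteq> y" using m(3) s by simp
      fix r assume r: "r \<in> D" "\<gamma> r \<noteq> y"
      have "velocity \<gamma> D r \<in> tangent_vectors L (\<gamma> r)"
        using lp(1) r(1) unfolding tangent_vectors_def by blast
      then have "(1, \<gamma> r, velocity \<gamma> D r) \<in> ?Fr"
        using link_param_image_subset[OF lp(1) r(1)] by (simp add: line_frames_def)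
      then show "offset_sq 1 (velocity \<gamma> D r) (y - \<gamma> r) / norm (y - \<gamma> r) ^ 4 \<le> offset_sq l v w / norm w ^ 4"
        unfolding w_def using m(2) r(2) by (rule max)
    qed
    then show False using \<open>\<not> w \<bullet> u \<le> 0\<close> by (simp add: w_def s)
  qed
  have "offset_sq l v w / norm w ^ 4 \<le> (norm w)\<^sup>2 / norm w ^ 4"
    by (intro divide_right_mono offset_sq_le) simp
  also have "\<dots> = 1 / (norm w)\<^sup>2" using m(3) by (simp add: w_def power4_eq_xxxx power2_eq_square)
  finally have top: "offset_sq l v w / norm w ^ 4 \<le> 1 / (norm w)\<^sup>2" .
  show thesis
  proof (rule that[OF x m(2,3)])
    show "(y - x) \<bullet> u \<le> 0" if "u \<in> inward_vectors L x" for u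
      using crit[OF that] by (simp add: w_def)
    show "offset_sq l' v' (y' - x') / norm (y' - x') ^ 4 \<le> 1 / (norm (y - x))\<^sup>2"
      if "(l', x', v') \<in> ?Fr" "y' \<in> L" "x' \<noteq> y'" for l' x' v' y'
      using max[OF that] top by (simp add: w_def)
  qed
qed

lemma pd_star_ge:
  assumes L: "c11_link L" and "0 \<le> r" "4 * r\<^sup>2 * S \<le> 1"
    and le: "\<And>l x v y. (l, x, v) \<in> line_frames L \<union> ray_frames L \<Longrightarrow> y \<in> L \<Longrightarrow> x \<noteq> y \<Longrightarrow>
      offset_sq l v (y - x) / norm (y - x) ^ 4 \<le> S"
    and "x \<in> L" "y \<in> L"
  shows "ereal (2 * r) \<le> pd_star L x y"
proof (cases "x = y")
  case False
  obtain l v where v: "(l, x, v) \<in> line_frames L \<union> ray_frames L" "\<forall>y. x \<noteq> y \<longrightarrow> pd_star L x y = penalized l v (y - x)"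
    using ex_frame[OF L \<open>x \<in> L\<close>] by blast
  have "ereal (2 * r) \<le> penalized l v (y - x)"
    using assms(2,3) frames_props[OF v(1) L] False le[OF v(1) \<open>y \<in> L\<close> False]
    by (intro penalized_ge[where S = S]) auto
  then show ?thesis using v(2) False by simp
qed (simp add: pd_star_def)

text \<open>The ratio bound 1 / |w|^2 gives reach at least |w| / 2 and \<open>pd_star\<close> at
  least |w|, and the pair \<open>x\<close>, \<open>y\<close> attains both. A point of
  \<open>L\<close> strictly inside the ball with diameter from \<open>x\<close> to \<open>y\<close>,
  with displacement d from \<open>x\<close>, would have d \<bullet> w > |d|^2; but \<open>w\<close>
  is normal at \<open>x\<close>, so d \<bullet> w is at most |w| times
  \<open>sqrt (offset_sq l v d)\<close>, and the ratio bound makes this at most |d|^2.\<close>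

lemma twice_reach_eq_minimum_pd_star:
  assumes L: "c11_link L" and x: "x \<in> L" "y \<in> L" "x \<noteq> y"
    and crit: "\<And>u. u \<in> inward_vectors L x \<Longrightarrow> (y - x) \<bullet> u \<le> 0"
    and max: "\<And>l' x' v' y'. (l', x', v') \<in> line_frames L \<union> ray_frames L \<Longrightarrow> y' \<in> L \<Longrightarrow> x' \<noteq> y' \<Longrightarrow>
       offset_sq l' v' (y' - x') / norm (y' - x') ^ 4 \<le> 1 / (norm (y - x))\<^sup>2"
  shows "2 * reach L = minimum {pd_star L x y | x y. x \<in> L \<and> y \<in> L}"
proof -
  define w where "w = y - x"
  define r where "r = norm w / 2"
  have w: "0 < norm w" using x by (simp add: w_def)
  have rS: "0 \<le> r" "4 * r\<^sup>2 * (1 / (norm w)\<^sup>2) \<le> 1" "0 \<le> 1 / (norm w)\<^sup>2"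
    using w by (auto simp: r_def power_divide)
  note max' = max[folded w_def]
  obtain l v where v: "(l, x, v) \<in> line_frames L \<union> ray_frames L" "\<forall>y. x \<noteq> y \<longrightarrow> pd_star L x y = penalized l v (y - x)"
    and n: "\<forall>n w. (\<forall>u\<in>inward_vectors L x. n \<bullet> u \<le> 0) \<longrightarrow> w \<bullet> n \<le> sqrt (offset_sq l v w) * norm n"
    and o: "\<forall>w. (\<forall>u\<in>inward_vectors L x. w \<bullet> u \<le> 0) \<longrightarrow> offset_sq l v w = (norm w)\<^sup>2"
    using ex_frame[OF L x(1)] by blast
  have crit': "\<forall>u\<in>inward_vectors L x. w \<bullet> u \<le> 0" using crit by (simp add: w_def)
  have "pd_star L x y = penalized l v w" using v(2) x(3) by (simp add: w_def)
  also have "\<dots> = ereal (2 * r)"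
    using o crit' w by (simp add: penalized_def r_def power3_eq_cube power2_eq_square)
  finally have pd: "pd_star L x y = ereal (2 * r)" .
  have "minimum {pd_star L x y | x y. x \<in> L \<and> y \<in> L} = ereal (2 * r)"
  proof (rule minimum_eqI)
    show "ereal (2 * r) \<in> {pd_star L x y | x y. x \<in> L \<and> y \<in> L}"
      using x pd by (metis (mono_tags, lifting) mem_Collect_eq)
    fix z assume "z \<in> {pd_star L x y | x y. x \<in> L \<and> y \<in> L}"
    then obtain x' y' where z: "z = pd_star L x' y'" "x' \<in> L" "y' \<in> L" by blast
    show "ereal (2 * r) \<le> z"
      unfolding z(1) by (rule pd_star_ge[OF L rS(1,2) max' z(2,3)])
  qed
  moreover have "reach L = ereal r"
  proof (rule antisym)
    show "ereal r \<le> reach L" by (rule reach_ge[OF L rS max'])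
    define p where "p = x + (1 / 2) *\<^sub>R w"
    have px: "dist p x = r" by (simp add: p_def r_def dist_norm)
    have "p - y = - ((1 / 2) *\<^sub>R w)"
      by (simp add: p_def w_def algebra_simps flip: scaleR_2)
    then have py: "dist p y = r" by (simp add: dist_norm r_def)
    show "reach L \<le> ereal r"
    proof (rule reach_leI[OF x px py])
      fix z assume z: "z \<in> L"
      show "r \<le> dist p z"
      proof (cases "z = x")
        case False
        define d where "d = z - x"
        have Q: "0 \<le> offset_sq l v d" using frames_props[OF v(1) L] by (intro offset_sq_nonneg) auto
        have "offset_sq l v d / norm d ^ 4 \<le> 1 / (norm w)\<^sup>2"
          using max'[OF v(1) z] False by (simp add: d_def)
        then have "offset_sq l v d \<le> norm d ^ 4 / (norm w)\<^sup>2"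
          using False w by (simp add: d_def field_simps)
        also have "\<dots> = ((norm d)\<^sup>2 / norm w)\<^sup>2" by (simp add: power_divide power_mult[symmetric])
        finally have "sqrt (offset_sq l v d) \<le> (norm d)\<^sup>2 / norm w"
          by (intro real_le_lsqrt) auto
        then have "sqrt (offset_sq l v d) * norm w \<le> (norm d)\<^sup>2" using w by (simp add: le_divide_eq)
        moreover have "d \<bullet> w \<le> sqrt (offset_sq l v d) * norm w" using n crit' by blast
        ultimately have dw: "d \<bullet> w \<le> (norm d)\<^sup>2" by linarith
        have "z - p = d - (1 / 2) *\<^sub>R w" by (simp add: d_def p_def)
        then have "(norm (z - p))\<^sup>2 = (norm d)\<^sup>2 - d \<bullet> w + (norm w)\<^sup>2 / 4"
          unfolding power2_norm_eq_inner by (simp add: inner_diff inner_commute)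
        then have "r\<^sup>2 \<le> (dist p z)\<^sup>2" using dw by (simp add: r_def dist_norm norm_minus_commute power_divide)
        then show ?thesis by (rule power2_le_imp_le) simp
      qed (simp add: px)
    qed
  qed
  ultimately show ?thesis by simp
qed

theorem corollary2p16:
  fixes L :: "(real^3) set" and \<sigma> :: real
  assumes "c11_link L" and "1/2 \<le> \<sigma>"
  shows "Thi \<sigma> L =
           min (minimum {pd_star L x y | x y. x \<in> L \<and> y \<in> L})
               (ereal (1 / \<sigma>) * min_curv_radius L)
       \<and> min (minimum {pd_star L x y | x y. x \<in> L \<and> y \<in> L})
             (ereal (1 / \<sigma>) * min_curv_radius L) =
           min (minimum {pd L x y | x y. x \<in> L \<and> y \<in> L})
               (min (minimum {pd_star L x y | x y. x \<in> link_boundary L \<and> y \<in> L})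
                    (ereal (1 / \<sigma>) * min_curv_radius L))"
proof
  note L = assms(1)
  let ?S = "{pd_star L x y | x y. x \<in> L \<and> y \<in> L}" and ?R = "ereal (1 / \<sigma>) * min_curv_radius L"
  obtain c where c0: "0 \<le> c" "min_curv_radius L = radius c"
    and c1: "\<forall>\<gamma> D. link_param L \<gamma> D \<longrightarrow> c-lipschitz_on D (velocity \<gamma> D)"
    using link_lipschitz_constant[OF L] by blast
  note c = c0 c1[rule_format]
  show "Thi \<sigma> L = min (minimum ?S) ?R"
  \<comment> \<open>The ratio is 1 / (4 F^2) and \<open>c\<close> is 1 / R, so this asks whether F
    falls below R somewhere.\<close>
  proof (cases "\<exists>l x v y. (l, x, v) \<in> line_frames L \<union> ray_frames L \<and> y \<in> L \<and> x \<noteq> y \<and>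
      c\<^sup>2 / 4 < offset_sq l v (y - x) / norm (y - x) ^ 4")
    case True
    then obtain l0 x0 v0 y0 where z0: "(l0, x0, v0) \<in> line_frames L \<union> ray_frames L" "y0 \<in> L" "x0 \<noteq> y0"
      "c\<^sup>2 / 4 < offset_sq l0 v0 (y0 - x0) / norm (y0 - x0) ^ 4" by blast
    have "2 * reach L = minimum ?S"
      by (rule critical_pair[OF L c(1,3) z0]) (assumption, rule twice_reach_eq_minimum_pd_star[OF L])
    then show ?thesis by (simp add: Thi_def)
  next
    case False
    then have le: "offset_sq l v (y - x) / norm (y - x) ^ 4 \<le> c\<^sup>2 / 4"
      if "(l, x, v) \<in> line_frames L \<union> ray_frames L" "y \<in> L" "x \<noteq> y" for l x v y
      using that by (meson not_le)
    \<comment> \<open>With \<open>S = c^2 / 4\<close>, the condition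
      \<open>4 * r^2 * S \<le> 1\<close> says no more than r \<le> R.\<close>
    have rc: "4 * r\<^sup>2 * (c\<^sup>2 / 4) \<le> 1" if "0 \<le> r" "r * c \<le> 1" for r
      using power_le_one[of "r * c" 2] that c(1) by (simp add: power_mult_distrib)
    have "?R \<le> 2 * reach L"
      unfolding c(2)
    proof (rule scaled_radius_le[OF c(1) assms(2)])
      fix r :: real assume r: "0 \<le> r" "r * c \<le> 1"
      have "ereal r \<le> reach L"
        by (rule reach_ge[OF L r(1) rc[OF r] _ le]) simp
      then have "2 * ereal r \<le> 2 * reach L" by (intro ereal_mult_left_mono) auto
      then show "ereal (2 * r) \<le> 2 * reach L" by simp
    qed
    moreover have "?R \<le> minimum ?S"
    proof (cases "L = {}")
      case True
      then show ?thesis by (simp add: minimum_def)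
    next
      case False
      then obtain x y where xy: "minimum ?S = pd_star L x y" "x \<in> L" "y \<in> L"
        using minimum_pd_star(2)[OF L] by blast
      show ?thesis
        unfolding c(2) xy(1)
        by (rule scaled_radius_le[OF c(1) assms(2)]) (rule pd_star_ge[OF L _ rc le xy(2,3)])
    qed
    ultimately show ?thesis by (simp add: Thi_def min_absorb2)
  qed
  show "min (minimum ?S) ?R =
      min (minimum {pd L x y | x y. x \<in> L \<and> y \<in> L})
        (min (minimum {pd_star L x y | x y. x \<in> link_boundary L \<and> y \<in> L}) ?R)"
    unfolding minimum_pd_star(1)[OF L] by (rule min.assoc)
qed

end
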